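(* Let $k$ be a field, let $A$, $B$ be two Hopf algebras over $k$ and let $f, g: B \rightarrow A$ be Hopf algebra maps. Let $I$ be the two-sided ideal of $A$ generated by $\{ f(b) - g(b) \mid b \in B \}$. Then $I$ is a Hopf ideal of $A$, and $(A/I, \pi)$ is the coequalizer of the morphisms $(f, g)$ in the category $k$-HopfAlg, where $\pi: A \rightarrow A/I$ is the canonical projection.
   Context: $k$-HopfAlg denotes the category of Hopf algebras over the field $k$. A Hopf ideal of a Hopf algebra $A$ is a two-sided ideal that is also a coideal and is stable under the antipode of $A$. *)

theory Defs
  imports "HOL-Algebra.Module" "HOL-Algebra.QuotRing"
begin

section \<open>Linear maps, spans and quotients\<close>

definition linear_maps ::
  "('k, 'm) ring_scheme \<Rightarrow> ('k, 'a, 'p) module_scheme \<Rightarrow> ('k, 'b, 'q) module_scheme \<Rightarrow> ('a \<Rightarrow> 'b) set"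
  where "linear_maps K M N =
    {h. h \<in> carrier M \<rightarrow> carrier N
      \<and> (\<forall>x \<in> carrier M. \<forall>y \<in> carrier M. h (x \<oplus>\<^bsub>M\<^esub> y) = h x \<oplus>\<^bsub>N\<^esub> h y)
      \<and> (\<forall>r \<in> carrier K. \<forall>x \<in> carrier M. h (r \<odot>\<^bsub>M\<^esub> x) = r \<odot>\<^bsub>N\<^esub> h x)}"

definition span ::
  "('k, 'm) ring_scheme \<Rightarrow> ('k, 'a, 'p) module_scheme \<Rightarrow> 'a set \<Rightarrow> 'a set"
  where "span K M S = \<Inter>{H. submodule H K M \<and> S \<subseteq> H}"

text \<open>
  The quotient by a submodule. If \<open>M\<close> is an algebra and \<open>H\<close> a two-sided ideal, the fields
  \<open>mult\<close> and \<open>one\<close> inherited from \<open>Quot\<close> make it the quotient algebra; otherwise they carry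
  no meaning.
\<close>

definition quotient_module :: "('k, 'a, 'p) module_scheme \<Rightarrow> 'a set \<Rightarrow> ('k, 'a set) module"
  where "quotient_module M H =
    \<lparr>carrier = carrier (M Quot H), mult = mult (M Quot H), one = one (M Quot H),
     zero = zero (M Quot H), add = add (M Quot H),
     smult = (\<lambda>r X. \<Union>x \<in> X. H +>\<^bsub>M\<^esub> (r \<odot>\<^bsub>M\<^esub> x))\<rparr>"

definition scalar_module :: "('k, 'm) ring_scheme \<Rightarrow> ('k, 'k) module"
  where "scalar_module K =
    \<lparr>carrier = carrier K, mult = mult K, one = one K, zero = zero K, add = add K, smult = mult K\<rparr>"

text \<open>
  The common value of \<open>F\<close> on a set on which it is constant. Maps out of quotients are defined by
  their values on representatives; on other sets the value is unspecified.
\<close>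

definition common_value :: "('a \<Rightarrow> 'b) \<Rightarrow> 'a set \<Rightarrow> 'b"
  where "common_value F X = the_elem (F ` X)"


section \<open>Tensor products\<close>

text \<open>
  \<open>M \<otimes> N\<close> is the free module on \<open>carrier M \<times> carrier N\<close> modulo the bilinearity relations. Elements
  of the free module are finitely supported functions; the fields \<open>mult\<close> and \<open>one\<close> carry no meaning.
\<close>

definition free_module :: "('k, 'm) ring_scheme \<Rightarrow> 'x set \<Rightarrow> ('k, 'x \<Rightarrow> 'k) module"
  where "free_module K S =
    \<lparr>carrier = {\<phi>. finite {p. \<phi> p \<noteq> \<zero>\<^bsub>K\<^esub>} \<and> (\<forall>p \<in> S. \<phi> p \<in> carrier K) \<and> (\<forall>p. p \<notin> S \<longrightarrow> \<phi> p = \<zero>\<^bsub>K\<^esub>)},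
     mult = undefined, one = undefined,
     zero = (\<lambda>p. \<zero>\<^bsub>K\<^esub>),
     add = (\<lambda>\<phi> \<psi> p. \<phi> p \<oplus>\<^bsub>K\<^esub> \<psi> p),
     smult = (\<lambda>r \<phi> p. r \<otimes>\<^bsub>K\<^esub> \<phi> p)\<rparr>"

definition free_gen :: "('k, 'm) ring_scheme \<Rightarrow> 'x \<Rightarrow> 'x \<Rightarrow> 'k"
  where "free_gen K p = (\<lambda>q. if q = p then \<one>\<^bsub>K\<^esub> else \<zero>\<^bsub>K\<^esub>)"

abbreviation free_on_pairs ::
  "('k, 'm) ring_scheme \<Rightarrow> ('k, 'a, 'p) module_scheme \<Rightarrow> ('k, 'b, 'q) module_scheme \<Rightarrow>
    ('k, 'a \<times> 'b \<Rightarrow> 'k) module"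
  where "free_on_pairs K M N \<equiv> free_module K (carrier M \<times> carrier N)"

definition bilinear_relations ::
  "('k, 'm) ring_scheme \<Rightarrow> ('k, 'a, 'p) module_scheme \<Rightarrow> ('k, 'b, 'q) module_scheme \<Rightarrow>
    ('a \<times> 'b \<Rightarrow> 'k) set"
  where "bilinear_relations K M N = (let F = free_on_pairs K M N; e = free_gen K in
      {e (x \<oplus>\<^bsub>M\<^esub> x', y) \<ominus>\<^bsub>F\<^esub> (e (x, y) \<oplus>\<^bsub>F\<^esub> e (x', y)) | x x' y.
         x \<in> carrier M \<and> x' \<in> carrier M \<and> y \<in> carrier N}
    \<union> {e (x, y \<oplus>\<^bsub>N\<^esub> y') \<ominus>\<^bsub>F\<^esub> (e (x, y) \<oplus>\<^bsub>F\<^esub> e (x, y')) | x y y'.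
         x \<in> carrier M \<and> y \<in> carrier N \<and> y' \<in> carrier N}
    \<union> {e (r \<odot>\<^bsub>M\<^esub> x, y) \<ominus>\<^bsub>F\<^esub> r \<odot>\<^bsub>F\<^esub> e (x, y) | r x y.
         r \<in> carrier K \<and> x \<in> carrier M \<and> y \<in> carrier N}
    \<union> {e (x, r \<odot>\<^bsub>N\<^esub> y) \<ominus>\<^bsub>F\<^esub> r \<odot>\<^bsub>F\<^esub> e (x, y) | r x y.
         r \<in> carrier K \<and> x \<in> carrier M \<and> y \<in> carrier N})"

definition tensor_kernel ::
  "('k, 'm) ring_scheme \<Rightarrow> ('k, 'a, 'p) module_scheme \<Rightarrow> ('k, 'b, 'q) module_scheme \<Rightarrow>
    ('a \<times> 'b \<Rightarrow> 'k) set"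
  where "tensor_kernel K M N = span K (free_on_pairs K M N) (bilinear_relations K M N)"

definition tensor_module ::
  "('k, 'm) ring_scheme \<Rightarrow> ('k, 'a, 'p) module_scheme \<Rightarrow> ('k, 'b, 'q) module_scheme \<Rightarrow>
    ('k, ('a \<times> 'b \<Rightarrow> 'k) set) module"
  where "tensor_module K M N = quotient_module (free_on_pairs K M N) (tensor_kernel K M N)"

definition pure_tensor ::
  "('k, 'm) ring_scheme \<Rightarrow> ('k, 'a, 'p) module_scheme \<Rightarrow> ('k, 'b, 'q) module_scheme \<Rightarrow>
    'a \<Rightarrow> 'b \<Rightarrow> ('a \<times> 'b \<Rightarrow> 'k) set"
  where "pure_tensor K M N x y = tensor_kernel K M N +>\<^bsub>free_on_pairs K M N\<^esub> free_gen K (x, y)"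

text \<open>
  The linear map out of a tensor product induced by a bilinear map \<open>\<beta>\<close>, that is,
  \<open>x \<otimes> y \<mapsto> \<beta> x y\<close>. An element of the tensor product is a coset, and \<open>\<phi>\<close> runs over its
  representatives.
\<close>

definition tensor_lift ::
  "('k, 'm) ring_scheme \<Rightarrow> ('k, 'c, 'p) module_scheme \<Rightarrow> ('a \<Rightarrow> 'b \<Rightarrow> 'c) \<Rightarrow>
    ('a \<times> 'b \<Rightarrow> 'k) set \<Rightarrow> 'c"
  where "tensor_lift K P \<beta> =
    common_value (\<lambda>\<phi>. \<Oplus>\<^bsub>P\<^esub>p \<in> {p. \<phi> p \<noteq> \<zero>\<^bsub>K\<^esub>}. \<phi> p \<odot>\<^bsub>P\<^esub> \<beta> (fst p) (snd p))"

text \<open>The map \<open>f \<otimes> g\<close> with values in \<open>M \<otimes> N\<close>.\<close>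

definition tensor_map ::
  "('k, 'm) ring_scheme \<Rightarrow> ('k, 'c, 'p) module_scheme \<Rightarrow> ('k, 'd, 'q) module_scheme \<Rightarrow>
    ('a \<Rightarrow> 'c) \<Rightarrow> ('b \<Rightarrow> 'd) \<Rightarrow> ('a \<times> 'b \<Rightarrow> 'k) set \<Rightarrow> ('c \<times> 'd \<Rightarrow> 'k) set"
  where "tensor_map K M N f g =
    tensor_lift K (tensor_module K M N) (\<lambda>x y. pure_tensor K M N (f x) (g y))"

text \<open>The canonical map from \<open>(L \<otimes> M) \<otimes> N\<close> to \<open>L \<otimes> (M \<otimes> N)\<close>.\<close>

definition tensor_assoc ::
  "('k, 'm) ring_scheme \<Rightarrow> ('k, 'a, 'p) module_scheme \<Rightarrow> ('k, 'b, 'q) module_scheme \<Rightarrow>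
    ('k, 'c, 'r) module_scheme \<Rightarrow>
    (('a \<times> 'b \<Rightarrow> 'k) set \<times> 'c \<Rightarrow> 'k) set \<Rightarrow> ('a \<times> ('b \<times> 'c \<Rightarrow> 'k) set \<Rightarrow> 'k) set"
  where "tensor_assoc K L M N =
    (let MN = tensor_module K M N; T = tensor_module K L MN in
      tensor_lift K T (\<lambda>X z.
        tensor_lift K T (\<lambda>x y. pure_tensor K L MN x (pure_tensor K M N y z)) X))"

text \<open>The algebra structure \<open>(a \<otimes> b) (c \<otimes> d) = ac \<otimes> bd\<close> on the tensor product of two algebras.\<close>

definition tensor_algebra ::
  "('k, 'm) ring_scheme \<Rightarrow> ('k, 'a, 'p) module_scheme \<Rightarrow> ('k, 'b, 'q) module_scheme \<Rightarrow>
    ('k, ('a \<times> 'b \<Rightarrow> 'k) set) module"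
  where "tensor_algebra K A B = (let T = tensor_module K A B in
    T\<lparr>mult := (\<lambda>X Y. tensor_lift K T (\<lambda>a b.
                tensor_lift K T (\<lambda>c d. pure_tensor K A B (a \<otimes>\<^bsub>A\<^esub> c) (b \<otimes>\<^bsub>B\<^esub> d)) Y) X),
      one := pure_tensor K A B \<one>\<^bsub>A\<^esub> \<one>\<^bsub>B\<^esub>\<rparr>)"


section \<open>Hopf algebras\<close>

record ('k, 'a) hopf = "('k, 'a) module" +
  comult :: "'a \<Rightarrow> ('a \<times> 'a \<Rightarrow> 'k) set"
  counit :: "'a \<Rightarrow> 'k"
  antipode :: "'a \<Rightarrow> 'a"

text \<open>Unlike the locale \<open>algebra\<close>, multiplication need not be commutative.\<close>

locale unital_algebra = field K + module K A + A?: ring A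
  for K (structure) and A (structure) +
  assumes smult_mult_left:
      "\<lbrakk>r \<in> carrier K; x \<in> carrier A; y \<in> carrier A\<rbrakk> \<Longrightarrow>
        (r \<odot>\<^bsub>A\<^esub> x) \<otimes>\<^bsub>A\<^esub> y = r \<odot>\<^bsub>A\<^esub> (x \<otimes>\<^bsub>A\<^esub> y)"
    and smult_mult_right:
      "\<lbrakk>r \<in> carrier K; x \<in> carrier A; y \<in> carrier A\<rbrakk> \<Longrightarrow>
        x \<otimes>\<^bsub>A\<^esub> (r \<odot>\<^bsub>A\<^esub> y) = r \<odot>\<^bsub>A\<^esub> (x \<otimes>\<^bsub>A\<^esub> y)"

locale bialgebra = unital_algebra K A
  for K :: "('k, 'm) ring_scheme" (structure) and A :: "('k, 'a, 'p) hopf_scheme" (structure) +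
  assumes comult_linear: "comult A \<in> linear_maps K A (tensor_module K A A)"
    and counit_linear: "counit A \<in> linear_maps K A (scalar_module K)"
    and coassociative: "x \<in> carrier A \<Longrightarrow>
      tensor_assoc K A A A (tensor_map K (tensor_module K A A) A (comult A) id (comult A x)) =
      tensor_map K A (tensor_module K A A) id (comult A) (comult A x)"
    and counit_left: "x \<in> carrier A \<Longrightarrow>
      tensor_lift K A (\<lambda>y z. counit A y \<odot>\<^bsub>A\<^esub> z) (comult A x) = x"
    and counit_right: "x \<in> carrier A \<Longrightarrow>
      tensor_lift K A (\<lambda>y z. counit A z \<odot>\<^bsub>A\<^esub> y) (comult A x) = x"
    and comult_hom: "comult A \<in> ring_hom A (tensor_algebra K A A)"
    and counit_hom: "counit A \<in> ring_hom A K"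

locale hopf_algebra = bialgebra K A
  for K :: "('k, 'm) ring_scheme" (structure) and A :: "('k, 'a, 'p) hopf_scheme" (structure) +
  assumes antipode_linear: "antipode A \<in> linear_maps K A A"
    and antipode_left: "x \<in> carrier A \<Longrightarrow>
      tensor_lift K A (\<lambda>y z. antipode A y \<otimes>\<^bsub>A\<^esub> z) (comult A x) = counit A x \<odot>\<^bsub>A\<^esub> \<one>\<^bsub>A\<^esub>"
    and antipode_right: "x \<in> carrier A \<Longrightarrow>
      tensor_lift K A (\<lambda>y z. y \<otimes>\<^bsub>A\<^esub> antipode A z) (comult A x) = counit A x \<odot>\<^bsub>A\<^esub> \<one>\<^bsub>A\<^esub>"

definition hopf_homs ::
  "('k, 'm) ring_scheme \<Rightarrow> ('k, 'a, 'p) hopf_scheme \<Rightarrow> ('k, 'b, 'q) hopf_scheme \<Rightarrow> ('a \<Rightarrow> 'b) set"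
  where "hopf_homs K A B =
    {h. h \<in> ring_hom A B \<and> h \<in> linear_maps K A B
      \<and> (\<forall>x \<in> carrier A. comult B (h x) = tensor_map K B B h h (comult A x))
      \<and> (\<forall>x \<in> carrier A. counit B (h x) = counit A x)
      \<and> (\<forall>x \<in> carrier A. antipode B (h x) = h (antipode A x))}"


section \<open>Hopf ideals and quotients\<close>

text \<open>
  For submodules \<open>U\<close>, \<open>V\<close> of \<open>M\<close>, \<open>N\<close>, the image of \<open>U \<otimes> V\<close> in \<open>M \<otimes> N\<close>; over a field it is
  isomorphic to \<open>U \<otimes> V\<close>.
\<close>

definition tensor_image ::
  "('k, 'm) ring_scheme \<Rightarrow> ('k, 'a, 'p) module_scheme \<Rightarrow> ('k, 'b, 'q) module_scheme \<Rightarrow>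
    'a set \<Rightarrow> 'b set \<Rightarrow> ('a \<times> 'b \<Rightarrow> 'k) set set"
  where "tensor_image K M N U V =
    span K (tensor_module K M N) {pure_tensor K M N u v | u v. u \<in> U \<and> v \<in> V}"

definition coideal ::
  "('k, 'm) ring_scheme \<Rightarrow> ('k, 'a, 'p) hopf_scheme \<Rightarrow> 'a set \<Rightarrow> bool"
  where "coideal K A I \<longleftrightarrow> submodule I K A
    \<and> comult A ` I \<subseteq>
        tensor_image K A A I (carrier A) <+>\<^bsub>tensor_module K A A\<^esub> tensor_image K A A (carrier A) I
    \<and> (\<forall>x \<in> I. counit A x = \<zero>\<^bsub>K\<^esub>)"

definition hopf_ideal ::
  "('k, 'm) ring_scheme \<Rightarrow> ('k, 'a, 'p) hopf_scheme \<Rightarrow> 'a set \<Rightarrow> bool"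
  where "hopf_ideal K A I \<longleftrightarrow> ideal I A \<and> coideal K A I \<and> antipode A ` I \<subseteq> I"

definition quotient_hopf ::
  "('k, 'm) ring_scheme \<Rightarrow> ('k, 'a, 'p) hopf_scheme \<Rightarrow> 'a set \<Rightarrow> ('k, 'a set) hopf"
  where "quotient_hopf K A I = (let Q = quotient_module A I; \<pi> = (\<lambda>x. I +>\<^bsub>A\<^esub> x) in
    \<lparr>carrier = carrier Q, mult = mult Q, one = one Q, zero = zero Q, add = add Q, smult = smult Q,
     comult = common_value (\<lambda>x. tensor_map K Q Q \<pi> \<pi> (comult A x)),
     counit = common_value (counit A),
     antipode = common_value (\<lambda>x. \<pi> (antipode A x))\<rparr>)"


section \<open>Coequalizers\<close>

text \<open>
  The pair \<open>(Q, p)\<close> is a coequalizer of \<open>f, g : B \<rightarrow> A\<close> in the category of Hopf algebras over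
  \<open>K\<close>. The type \<open>'c\<close> in which the test objects \<open>C\<close> live is a parameter; a statement that is
  polymorphic in \<open>'c\<close> covers all Hopf algebras. A morphism is determined only by its values on
  the carrier, hence uniqueness is stated among extensional functions.
\<close>

definition hopf_coequalizer ::
  "'c itself \<Rightarrow> ('k, 'm) ring_scheme \<Rightarrow> ('k, 'b) hopf \<Rightarrow> ('k, 'a) hopf \<Rightarrow> ('b \<Rightarrow> 'a) \<Rightarrow> ('b \<Rightarrow> 'a) \<Rightarrow>
    ('k, 'q) hopf \<Rightarrow> ('a \<Rightarrow> 'q) \<Rightarrow> bool"
  where "hopf_coequalizer TYPE('c) K B A f g Q p \<longleftrightarrow>
    hopf_algebra K Q \<and> p \<in> hopf_homs K A Q
    \<and> (\<forall>b \<in> carrier B. p (f b) = p (g b))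
    \<and> (\<forall>(C :: ('k, 'c) hopf) h.
          hopf_algebra K C \<and> h \<in> hopf_homs K A C \<and> (\<forall>b \<in> carrier B. h (f b) = h (g b)) \<longrightarrow>
          (\<exists>!u. u \<in> hopf_homs K Q C \<and> u \<in> extensional (carrier Q)
               \<and> (\<forall>a \<in> carrier A. u (p a) = h a)))"

end

theory Submission
  imports Defs
begin

text \<open>
  Writing \<open>f x \<otimes> f y - g x \<otimes> g y = (f x - g x) \<otimes> f y + g x \<otimes> (f y - g y)\<close> shows that \<open>\<Delta>\<close> sends
  the generators of \<open>I\<close> into \<open>J = I \<otimes> A + A \<otimes> I\<close>. Since \<open>J\<close> absorbs products and \<open>\<Delta>\<close> is
  multiplicative, the preimage of \<open>J\<close> is an ideal and hence contains \<open>I\<close>. In the same way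
  \<open>\<epsilon>\<close> vanishes on \<open>I\<close>, and the antipode preserves \<open>I\<close> because it is an anti-homomorphism. The
  structure maps then descend along the projection; every map out of \<open>A\<close> that equalizes \<open>f\<close> and
  \<open>g\<close> kills \<open>I\<close> and factors uniquely through the quotient.
\<close>

text \<open>Tensors are cosets of finitely supported functions and come with no preferred expression
  as a sum of pure tensors. A Sweedler sum is therefore written as a lift of a bilinear map applied
  to \<open>comult A a\<close>, and a law becomes an equality of linear maps out of a tensor
  product, checked on pure tensors. The price is a bilinearity obligation for every integrand; much
  of the material on linear maps serves to discharge these mechanically. Anti-multiplicativity of
  the antipode is not among the axioms of \<open>hopf_algebra\<close>. Its proof is the longest
  calculation: it needs triply nested sums, coassociativity and an interchange of two sums. The
  comultiplication descends because J lies in the kernel of \<pi> \<otimes> \<pi>, an inclusion that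
  is visible on the pure tensors spanning the two summands. The coalgebra and antipode laws of A/I
  are then images under \<pi> of the laws of A.\<close>

section \<open>Linear maps and quotient modules\<close>

lemma (in abelian_group) minus_eq_zeroD:
  assumes "x \<in> carrier G" "y \<in> carrier G" "x \<ominus> y = \<zero>"
  shows "x = y"
proof -
  have "x = (x \<ominus> y) \<oplus> y"
    using assms(1,2) by (simp add: minus_eq a_assoc l_neg)
  then show ?thesis
    using assms by simp
qed

section \<open>Linear maps, kernels and preimages\<close>

lemma linear_mapsI:
  assumes "\<And>x. x \<in> carrier M \<Longrightarrow> h x \<in> carrier N"
    and "\<And>x y. x \<in> carrier M \<Longrightarrow> y \<in> carrier M \<Longrightarrow> h (x \<oplus>\<^bsub>M\<^esub> y) = h x \<oplus>\<^bsub>N\<^esub> h y"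
    and "\<And>r x. r \<in> carrier K \<Longrightarrow> x \<in> carrier M \<Longrightarrow> h (r \<odot>\<^bsub>M\<^esub> x) = r \<odot>\<^bsub>N\<^esub> h x"
  shows "h \<in> linear_maps K M N"
  using assms unfolding linear_maps_def by auto

lemma linear_maps_closed: "h \<in> linear_maps K M N \<Longrightarrow> x \<in> carrier M \<Longrightarrow> h x \<in> carrier N"
  unfolding linear_maps_def by auto

lemma linear_maps_add:
  "h \<in> linear_maps K M N \<Longrightarrow> x \<in> carrier M \<Longrightarrow> y \<in> carrier M \<Longrightarrow> h (x \<oplus>\<^bsub>M\<^esub> y) = h x \<oplus>\<^bsub>N\<^esub> h y"
  unfolding linear_maps_def by auto

lemma linear_maps_smult:
  "h \<in> linear_maps K M N \<Longrightarrow> r \<in> carrier K \<Longrightarrow> x \<in> carrier M \<Longrightarrow> h (r \<odot>\<^bsub>M\<^esub> x) = r \<odot>\<^bsub>N\<^esub> h x"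
  unfolding linear_maps_def by auto

lemma linear_maps_zero:
  assumes "module K M" "module K N" "h \<in> linear_maps K M N"
  shows "h \<zero>\<^bsub>M\<^esub> = \<zero>\<^bsub>N\<^esub>"
proof -
  interpret M: module K M by fact
  interpret N: module K N by fact
  have "h (\<zero>\<^bsub>K\<^esub> \<odot>\<^bsub>M\<^esub> \<zero>\<^bsub>M\<^esub>) = \<zero>\<^bsub>K\<^esub> \<odot>\<^bsub>N\<^esub> h \<zero>\<^bsub>M\<^esub>"
    using assms(3) by (intro linear_maps_smult) auto
  then show ?thesis
    using linear_maps_closed[OF assms(3)] by simp
qed

lemma linear_maps_minus:
  assumes "module K M" "module K N" "h \<in> linear_maps K M N" "x \<in> carrier M" "y \<in> carrier M"
  shows "h (x \<ominus>\<^bsub>M\<^esub> y) = h x \<ominus>\<^bsub>N\<^esub> h y"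
proof -
  interpret M: module K M by fact
  interpret N: module K N by fact
  have "h ((x \<ominus>\<^bsub>M\<^esub> y) \<oplus>\<^bsub>M\<^esub> y) = h (x \<ominus>\<^bsub>M\<^esub> y) \<oplus>\<^bsub>N\<^esub> h y"
    using assms by (intro linear_maps_add) auto
  moreover have "(x \<ominus>\<^bsub>M\<^esub> y) \<oplus>\<^bsub>M\<^esub> y = x"
    using assms by (simp add: M.M.minus_eq M.M.add.m_assoc M.M.l_neg)
  ultimately show ?thesis
    using assms linear_maps_closed[OF assms(3)]
    by (simp add: N.M.minus_eq N.M.add.m_assoc N.M.r_neg)
qed

lemma linear_maps_id: "(\<lambda>x. x) \<in> linear_maps K M M"
  unfolding linear_maps_def by auto

lemma linear_maps_comp:
  "g \<in> linear_maps K N P \<Longrightarrow> h \<in> linear_maps K M N \<Longrightarrow> (\<lambda>x. g (h x)) \<in> linear_maps K M P"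
  unfolding linear_maps_def by (auto simp: Pi_iff)

text \<open>Functions are total, but linearity speaks only of the carrier, so agreement there
  suffices. Sums and multiples stay in the carrier because \<open>M\<close> is a module.\<close>

lemma linear_maps_cong:
  assumes "h \<in> linear_maps K M N" "module K M" "\<And>x. x \<in> carrier M \<Longrightarrow> h x = h' x"
  shows "h' \<in> linear_maps K M N"
proof -
  interpret M: module K M by fact
  show ?thesis
  proof (rule linear_mapsI)
    show "h' x \<in> carrier N" if "x \<in> carrier M" for x
      using that assms(3)[OF that] linear_maps_closed[OF assms(1)] by metis
    show "h' (x \<oplus>\<^bsub>M\<^esub> y) = h' x \<oplus>\<^bsub>N\<^esub> h' y" if "x \<in> carrier M" "y \<in> carrier M" for x y
      using that assms(3) linear_maps_add[OF assms(1)] by (metis M.M.add.m_closed)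
    show "h' (r \<odot>\<^bsub>M\<^esub> x) = r \<odot>\<^bsub>N\<^esub> h' x" if "r \<in> carrier K" "x \<in> carrier M" for r x
      using that assms(3) linear_maps_smult[OF assms(1)] by (metis M.smult_closed)
  qed
qed

lemma linear_maps_kernel:
  assumes "module K M" "module K N" "h \<in> linear_maps K M N"
  shows "submodule {x \<in> carrier M. h x = \<zero>\<^bsub>N\<^esub>} K M"
proof -
  interpret M: module K M by fact
  interpret N: module K N by fact
  have minus: "h (\<ominus>\<^bsub>M\<^esub> a) = \<ominus>\<^bsub>N\<^esub> (h a)" if "a \<in> carrier M" for a
    using linear_maps_minus[OF assms M.M.zero_closed that] that linear_maps_zero[OF assms]
      linear_maps_closed[OF assms(3) that]
    by (simp add: M.M.minus_eq N.M.minus_eq)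
  show ?thesis
    using linear_maps_zero[OF assms] minus
    by (intro M.submoduleI) (auto simp: linear_maps_add[OF assms(3)] linear_maps_smult[OF assms(3)])
qed

text \<open>Combined with minimality of a span or of a generated ideal, this reduces an inclusion of
  images to a check on generators.\<close>

lemma linear_maps_vimage:
  assumes "module K M" "module K N" "h \<in> linear_maps K M N" "submodule H K N"
  shows "submodule {x \<in> carrier M. h x \<in> H} K M"
proof -
  interpret M: module K M by fact
  interpret N: module K N by fact
  note H = N.submoduleE[OF assms(4)]
  have minus: "h (\<ominus>\<^bsub>M\<^esub> a) = \<ominus>\<^bsub>N\<^esub> (h a)" if "a \<in> carrier M" for a
    using linear_maps_minus[OF assms(1-3) M.M.zero_closed that] that linear_maps_zero[OF assms(1-3)]
      linear_maps_closed[OF assms(3) that]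
    by (simp add: M.M.minus_eq N.M.minus_eq)
  have "\<zero>\<^bsub>N\<^esub> \<in> H"
    using H(2,3,5) by (metis H(1) N.M.r_neg ex_in_conv subsetD)
  then show ?thesis
    using linear_maps_zero[OF assms(1-3)] minus H
    by (intro M.submoduleI)
      (auto simp: linear_maps_add[OF assms(3)] linear_maps_smult[OF assms(3)])
qed

section \<open>Spans\<close>

lemma span_minimal: "submodule H K M \<Longrightarrow> S \<subseteq> H \<Longrightarrow> span K M S \<subseteq> H"
  unfolding span_def by auto

lemma span_superset: "S \<subseteq> span K M S"
  unfolding span_def by auto

lemma span_submodule:
  assumes "module K M" "S \<subseteq> carrier M"
  shows "submodule (span K M S) K M"
proof -
  interpret M: module K M by fact
  \<comment> \<open>\<open>carrier M\<close> itself belongs to the intersected family, which is why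
    the intersection stays inside the carrier.\<close>
  have carr: "submodule (carrier M) K M \<and> S \<subseteq> carrier M"
    using M.carrier_is_submodule assms(2) by simp
  have zero: "\<zero>\<^bsub>M\<^esub> \<in> H" if "submodule H K M" for H
    using M.submoduleE[OF that] by (metis M.M.r_neg ex_in_conv subsetD)
  show ?thesis
  proof (rule M.submoduleI)
    show "span K M S \<subseteq> carrier M"
      using carr unfolding span_def by auto
  qed (auto simp: span_def zero M.submoduleE)
qed

section \<open>Cosets of a submodule and the quotient module\<close>

context
  fixes K :: "('k, 'm) ring_scheme" and M :: "('k, 'a, 'p) module_scheme" and H
  assumes M: "module K M" and H: "submodule H K M"
begin

interpretation M: module K M by (fact M)

text \<open>Gives access to the theory of additive cosets for \<open>H\<close>.\<close>

lemma submodule_abelian_subgroup: "abelian_subgroup H M"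
  using M.M.abelian_group_axioms submodule.axioms(1)[OF H]
  by (simp add: abelian_subgroupI3 additive_subgroup_def)

interpretation H: abelian_subgroup H M by (fact submodule_abelian_subgroup)

lemma coset_eq_iff:
  assumes "x \<in> carrier M" "y \<in> carrier M"
  shows "H +>\<^bsub>M\<^esub> x = H +>\<^bsub>M\<^esub> y \<longleftrightarrow> x \<ominus>\<^bsub>M\<^esub> y \<in> H"
proof
  assume "H +>\<^bsub>M\<^esub> x = H +>\<^bsub>M\<^esub> y"
  then show "x \<ominus>\<^bsub>M\<^esub> y \<in> H"
    using assms H.a_rcos_self[OF assms(1)] H.a_rcos_module_imp M.M.minus_eq by metis
next
  assume "x \<ominus>\<^bsub>M\<^esub> y \<in> H"
  then have "x \<in> H +>\<^bsub>M\<^esub> y"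
    using assms H.a_rcos_module_rev M.M.minus_eq by metis
  then show "H +>\<^bsub>M\<^esub> x = H +>\<^bsub>M\<^esub> y"
    using H.a_repr_independence'[OF _ assms(2)] by simp
qed

lemma coset_eq_zero_iff: "x \<in> carrier M \<Longrightarrow> H +>\<^bsub>M\<^esub> x = H \<longleftrightarrow> x \<in> H"
  using coset_eq_iff[of x "\<zero>\<^bsub>M\<^esub>"] M.M.a_coset_add_zero[OF H.a_subset]
    M.M.minus_equality[OF M.M.r_zero[OF M.M.zero_closed]]
  by (simp add: M.M.minus_eq)

text \<open>All representatives of a coset have multiples in one and the same coset, since
  \<open>H\<close> is closed under scalars. The coset is nonempty, so the union of this constant
  family is that common value.\<close>

lemma coset_smult:
  assumes "r \<in> carrier K" "x \<in> carrier M"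
  shows "(\<Union>y \<in> H +>\<^bsub>M\<^esub> x. H +>\<^bsub>M\<^esub> (r \<odot>\<^bsub>M\<^esub> y)) = H +>\<^bsub>M\<^esub> (r \<odot>\<^bsub>M\<^esub> x)"
proof -
  have "H +>\<^bsub>M\<^esub> (r \<odot>\<^bsub>M\<^esub> y) = H +>\<^bsub>M\<^esub> (r \<odot>\<^bsub>M\<^esub> x)" if "y \<in> H +>\<^bsub>M\<^esub> x" for y
  proof -
    have y: "y \<in> carrier M" "y \<ominus>\<^bsub>M\<^esub> x \<in> H"
      using that assms H.a_elemrcos_carrier H.a_rcos_module_imp M.M.minus_eq by metis+
    then have "r \<odot>\<^bsub>M\<^esub> (y \<ominus>\<^bsub>M\<^esub> x) \<in> H"
      using assms M.submoduleE(4)[OF H] by auto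
    then show ?thesis
      using y assms by (subst coset_eq_iff)
        (auto simp: M.M.minus_eq M.smult_r_distr M.smult_r_minus)
  qed
  then have "(\<Union>y \<in> H +>\<^bsub>M\<^esub> x. H +>\<^bsub>M\<^esub> (r \<odot>\<^bsub>M\<^esub> y)) =
      (\<Union>y \<in> H +>\<^bsub>M\<^esub> x. H +>\<^bsub>M\<^esub> (r \<odot>\<^bsub>M\<^esub> x))"
    by (rule SUP_cong[OF refl])
  moreover have "H +>\<^bsub>M\<^esub> x \<noteq> {}"
    using H.a_rcos_self[OF assms(2)] by blast
  ultimately show ?thesis
    by simp
qed

lemma carrier_quotient_module: "carrier (quotient_module M H) = {H +>\<^bsub>M\<^esub> x | x. x \<in> carrier M}"
  unfolding quotient_module_def FactRing_def A_RCOSETS_def RCOSETS_def a_r_coset_def by auto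

lemma coset_closed: "x \<in> carrier M \<Longrightarrow> H +>\<^bsub>M\<^esub> x \<in> carrier (quotient_module M H)"
  unfolding carrier_quotient_module by blast

lemma quotient_module_cases:
  assumes "X \<in> carrier (quotient_module M H)"
  obtains x where "x \<in> carrier M" "X = H +>\<^bsub>M\<^esub> x"
  using assms unfolding carrier_quotient_module by blast

lemma zero_quotient_module: "\<zero>\<^bsub>quotient_module M H\<^esub> = H"
  unfolding quotient_module_def FactRing_def by simp

lemma add_quotient_module:
  "x \<in> carrier M \<Longrightarrow> y \<in> carrier M \<Longrightarrow>
    (H +>\<^bsub>M\<^esub> x) \<oplus>\<^bsub>quotient_module M H\<^esub> (H +>\<^bsub>M\<^esub> y) = H +>\<^bsub>M\<^esub> (x \<oplus>\<^bsub>M\<^esub> y)"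
  unfolding quotient_module_def FactRing_def by (simp add: H.a_rcos_sum)

lemma smult_quotient_module:
  "r \<in> carrier K \<Longrightarrow> x \<in> carrier M \<Longrightarrow>
    r \<odot>\<^bsub>quotient_module M H\<^esub> (H +>\<^bsub>M\<^esub> x) = H +>\<^bsub>M\<^esub> (r \<odot>\<^bsub>M\<^esub> x)"
  unfolding quotient_module_def by (simp add: coset_smult)

lemma quotient_module_is_module: "module K (quotient_module M H)"
proof (rule moduleI)
  let ?Q = "quotient_module M H"
  have zero: "\<zero>\<^bsub>?Q\<^esub> = H +>\<^bsub>M\<^esub> \<zero>\<^bsub>M\<^esub>"
    using zero_quotient_module coset_eq_zero_iff[of "\<zero>\<^bsub>M\<^esub>"] by simp
  show "abelian_group ?Q"
  proof (rule abelian_groupI)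
    show "\<zero>\<^bsub>?Q\<^esub> \<in> carrier ?Q"
      unfolding zero by (simp add: coset_closed)
    fix x assume "x \<in> carrier ?Q"
    then obtain a where a: "a \<in> carrier M" "x = H +>\<^bsub>M\<^esub> a"
      by (rule quotient_module_cases)
    then show "\<zero>\<^bsub>?Q\<^esub> \<oplus>\<^bsub>?Q\<^esub> x = x"
      by (simp add: zero add_quotient_module)
    have "(H +>\<^bsub>M\<^esub> \<ominus>\<^bsub>M\<^esub> a) \<oplus>\<^bsub>?Q\<^esub> x = \<zero>\<^bsub>?Q\<^esub>"
      using a by (simp add: add_quotient_module zero M.M.l_neg)
    then show "\<exists>y \<in> carrier ?Q. y \<oplus>\<^bsub>?Q\<^esub> x = \<zero>\<^bsub>?Q\<^esub>"
      using coset_closed[OF M.M.a_inv_closed[OF a(1)]] by blast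
    fix y assume "y \<in> carrier ?Q"
    then obtain b where b: "b \<in> carrier M" "y = H +>\<^bsub>M\<^esub> b"
      by (rule quotient_module_cases)
    show "x \<oplus>\<^bsub>?Q\<^esub> y \<in> carrier ?Q"
      using a b by (simp add: add_quotient_module coset_closed)
    show "x \<oplus>\<^bsub>?Q\<^esub> y = y \<oplus>\<^bsub>?Q\<^esub> x"
      using a b by (simp add: add_quotient_module M.M.a_comm)
    fix z assume "z \<in> carrier ?Q"
    then obtain c where "c \<in> carrier M" "z = H +>\<^bsub>M\<^esub> c"
      by (rule quotient_module_cases)
    with a b show "x \<oplus>\<^bsub>?Q\<^esub> y \<oplus>\<^bsub>?Q\<^esub> z = x \<oplus>\<^bsub>?Q\<^esub> (y \<oplus>\<^bsub>?Q\<^esub> z)"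
      by (simp add: add_quotient_module M.M.a_assoc)
  qed
  fix x assume "x \<in> carrier ?Q"
  then obtain a where a: "a \<in> carrier M" "x = H +>\<^bsub>M\<^esub> a"
    by (rule quotient_module_cases)
  then show "\<one>\<^bsub>K\<^esub> \<odot>\<^bsub>?Q\<^esub> x = x"
    by (simp add: smult_quotient_module)
  fix r assume r: "r \<in> carrier K"
  with a show "r \<odot>\<^bsub>?Q\<^esub> x \<in> carrier ?Q"
    by (simp add: smult_quotient_module coset_closed)
  {
    fix s assume "s \<in> carrier K"
    with a r show "(r \<oplus>\<^bsub>K\<^esub> s) \<odot>\<^bsub>?Q\<^esub> x = r \<odot>\<^bsub>?Q\<^esub> x \<oplus>\<^bsub>?Q\<^esub> s \<odot>\<^bsub>?Q\<^esub> x"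
      and "(r \<otimes>\<^bsub>K\<^esub> s) \<odot>\<^bsub>?Q\<^esub> x = r \<odot>\<^bsub>?Q\<^esub> (s \<odot>\<^bsub>?Q\<^esub> x)"
      by (simp_all add: add_quotient_module smult_quotient_module M.smult_l_distr M.smult_assoc1)
  }
  fix y assume "y \<in> carrier ?Q"
  then obtain b where "b \<in> carrier M" "y = H +>\<^bsub>M\<^esub> b"
    by (rule quotient_module_cases)
  with a r show "r \<odot>\<^bsub>?Q\<^esub> (x \<oplus>\<^bsub>?Q\<^esub> y) = r \<odot>\<^bsub>?Q\<^esub> x \<oplus>\<^bsub>?Q\<^esub> r \<odot>\<^bsub>?Q\<^esub> y"
    by (simp add: add_quotient_module smult_quotient_module M.smult_r_distr)
qed (rule M.R.is_cring)

lemma coset_linear: "(\<lambda>x. H +>\<^bsub>M\<^esub> x) \<in> linear_maps K M (quotient_module M H)"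
  by (rule linear_mapsI) (simp_all add: coset_closed add_quotient_module smult_quotient_module)

lemma common_value_coset:
  assumes "\<And>y. y \<in> carrier M \<Longrightarrow> y \<ominus>\<^bsub>M\<^esub> x \<in> H \<Longrightarrow> F y = F x" "x \<in> carrier M"
  shows "common_value F (H +>\<^bsub>M\<^esub> x) = F x"
proof -
  have "F y = F x" if "y \<in> H +>\<^bsub>M\<^esub> x" for y
  proof (rule assms(1))
    show "y \<in> carrier M"
      using H.a_elemrcos_carrier[OF assms(2) that] .
    show "y \<ominus>\<^bsub>M\<^esub> x \<in> H"
      using H.a_rcos_module_imp[OF assms(2) that] by (simp add: M.M.minus_eq)
  qed
  with H.a_rcos_self[OF assms(2)] have "F ` (H +>\<^bsub>M\<^esub> x) = {F x}"
    by blast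
  then show ?thesis
    unfolding common_value_def by simp
qed

text \<open>A linear map that kills \<open>H\<close> is constant on each coset. This one
  factorization produces the lifts out of tensor products, the structure maps of the quotient Hopf
  algebra and the comparison map of the coequalizer.\<close>

lemma common_value_linear_coset:
  assumes "module K P" "F \<in> linear_maps K M P" "\<And>x. x \<in> H \<Longrightarrow> F x = \<zero>\<^bsub>P\<^esub>" "x \<in> carrier M"
  shows "common_value F (H +>\<^bsub>M\<^esub> x) = F x"
proof -
  interpret P: module K P by fact
  show ?thesis
  proof (rule common_value_coset)
    fix y assume y: "y \<in> carrier M" "y \<ominus>\<^bsub>M\<^esub> x \<in> H"
    then have "F y \<ominus>\<^bsub>P\<^esub> F x = \<zero>\<^bsub>P\<^esub>"
      using assms(3)[OF y(2)] linear_maps_minus[OF M assms(1,2) y(1) assms(4)] by simp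
    then show "F y = F x"
      by (rule P.M.minus_eq_zeroD[OF linear_maps_closed[OF assms(2) y(1)]
            linear_maps_closed[OF assms(2,4)]])
  qed fact
qed

lemma common_value_linear:
  assumes "module K P" "F \<in> linear_maps K M P" "\<And>x. x \<in> H \<Longrightarrow> F x = \<zero>\<^bsub>P\<^esub>"
  shows "common_value F \<in> linear_maps K (quotient_module M H) P"
proof (rule linear_mapsI)
  let ?Q = "quotient_module M H"
  note F = common_value_linear_coset[OF assms]
  fix x assume "x \<in> carrier ?Q"
  then obtain a where a: "a \<in> carrier M" "x = H +>\<^bsub>M\<^esub> a"
    by (rule quotient_module_cases)
  then show "common_value F x \<in> carrier P"
    using linear_maps_closed[OF assms(2)] by (simp add: F)
  show "common_value F (r \<odot>\<^bsub>?Q\<^esub> x) = r \<odot>\<^bsub>P\<^esub> common_value F x" if "r \<in> carrier K" for r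
    using that a linear_maps_smult[OF assms(2)] by (simp add: F smult_quotient_module)
  fix y assume "y \<in> carrier ?Q"
  then obtain b where "b \<in> carrier M" "y = H +>\<^bsub>M\<^esub> b"
    by (rule quotient_module_cases)
  then show "common_value F (x \<oplus>\<^bsub>?Q\<^esub> y) = common_value F x \<oplus>\<^bsub>P\<^esub> common_value F y"
    using a linear_maps_add[OF assms(2)] by (simp add: F add_quotient_module)
qed

end

text \<open>Makes the counit a linear map between modules, so that the lemmas on kernels and
  factorizations apply to it.\<close>

lemma scalar_module_is_module:
  assumes "cring K"
  shows "module K (scalar_module K)"
proof -
  interpret cring K by fact
  have inv: "\<exists>y \<in> carrier K. y \<oplus>\<^bsub>K\<^esub> x = \<zero>\<^bsub>K\<^esub>" if "x \<in> carrier K" for x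
    using that l_neg[OF that] by blast
  show ?thesis
  proof (rule moduleI)
    show "abelian_group (scalar_module K)"
      by (rule abelian_groupI) (simp_all add: scalar_module_def a_ac inv)
  qed (simp_all add: scalar_module_def is_cring l_distr r_distr m_assoc)
qed

section \<open>Free modules\<close>

lemma free_module_is_module:
  fixes K (structure)
  assumes "cring K"
  shows "module K (free_module K S)"
proof -
  interpret cring K by fact
  have fin: "finite {p. \<phi> p \<oplus> \<psi> p \<noteq> \<zero>}"
    if "finite {p. \<phi> p \<noteq> \<zero>}" "finite {p. \<psi> p \<noteq> \<zero>}" for \<phi> \<psi> :: "'c \<Rightarrow> 'a"
    by (rule finite_subset[OF _ finite_UnI[OF that]]) auto
  have fin': "finite {p. r \<otimes> \<phi> p \<noteq> \<zero>}"
    if "finite {p. \<phi> p \<noteq> \<zero>}" "r \<in> carrier K" for r and \<phi> :: "'c \<Rightarrow> 'a"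
    by (rule finite_subset[OF _ that(1)]) (use that in auto)
  have fin'': "finite {p. \<ominus> \<phi> p \<noteq> \<zero>}"
    if "finite {p. \<phi> p \<noteq> \<zero>}" for \<phi> :: "'c \<Rightarrow> 'a"
    by (rule finite_subset[OF _ that(1)]) (use that in auto)
  \<comment> \<open>Needed at every \<open>p\<close>, also outside \<open>S\<close>, where the value
    is zero: the module laws are equations between total functions.\<close>
  have closed: "\<phi> p \<in> carrier K" if "\<phi> \<in> carrier (free_module K S)" for \<phi> p
    using that by (cases "p \<in> S") (auto simp: free_module_def)
  show ?thesis
  proof (rule moduleI)
    show "abelian_group (free_module K S)"
    proof (rule abelian_groupI)
      fix x assume x: "x \<in> carrier (free_module K S)"
      show "\<exists>y \<in> carrier (free_module K S). y \<oplus>\<^bsub>free_module K S\<^esub> x = \<zero>\<^bsub>free_module K S\<^esub>"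
        by (rule bexI[of _ "\<lambda>p. \<ominus> x p"])
          (use x closed[OF x] in \<open>auto simp: free_module_def l_neg intro!: fin''\<close>)
    next
      fix x y z
      assume "x \<in> carrier (free_module K S)" "y \<in> carrier (free_module K S)"
        "z \<in> carrier (free_module K S)"
      from this[THEN closed] show "x \<oplus>\<^bsub>free_module K S\<^esub> y \<oplus>\<^bsub>free_module K S\<^esub> z =
          x \<oplus>\<^bsub>free_module K S\<^esub> (y \<oplus>\<^bsub>free_module K S\<^esub> z)"
        by (auto simp: free_module_def a_ac)
    next
      fix x y
      assume "x \<in> carrier (free_module K S)" "y \<in> carrier (free_module K S)"
      from this[THEN closed] show "x \<oplus>\<^bsub>free_module K S\<^esub> y = y \<oplus>\<^bsub>free_module K S\<^esub> x"
        by (auto simp: free_module_def a_ac)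
    next
      fix x assume "x \<in> carrier (free_module K S)"
      from this[THEN closed] show "\<zero>\<^bsub>free_module K S\<^esub> \<oplus>\<^bsub>free_module K S\<^esub> x = x"
        by (auto simp: free_module_def)
    qed (auto simp: free_module_def fin)
  next
    fix a b x assume "a \<in> carrier K" "b \<in> carrier K" "x \<in> carrier (free_module K S)"
    with closed[OF this(3)] show
      "(a \<oplus> b) \<odot>\<^bsub>free_module K S\<^esub> x = a \<odot>\<^bsub>free_module K S\<^esub> x \<oplus>\<^bsub>free_module K S\<^esub> b \<odot>\<^bsub>free_module K S\<^esub> x"
      "a \<otimes> b \<odot>\<^bsub>free_module K S\<^esub> x = a \<odot>\<^bsub>free_module K S\<^esub> (b \<odot>\<^bsub>free_module K S\<^esub> x)"
      by (auto simp: free_module_def l_distr m_assoc)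
  next
    fix a x y
    assume "a \<in> carrier K" "x \<in> carrier (free_module K S)" "y \<in> carrier (free_module K S)"
    with closed[OF this(2)] closed[OF this(3)] show
      "a \<odot>\<^bsub>free_module K S\<^esub> (x \<oplus>\<^bsub>free_module K S\<^esub> y) =
        a \<odot>\<^bsub>free_module K S\<^esub> x \<oplus>\<^bsub>free_module K S\<^esub> a \<odot>\<^bsub>free_module K S\<^esub> y"
      by (auto simp: free_module_def r_distr)
  next
    fix x assume "x \<in> carrier (free_module K S)"
    from this[THEN closed] show "\<one> \<odot>\<^bsub>free_module K S\<^esub> x = x"
      by (auto simp: free_module_def)
  qed (auto simp: free_module_def fin' is_cring)
qed

lemma free_gen_closed:
  fixes K (structure)
  assumes "cring K" and p: "p \<in> S"
  shows "free_gen K p \<in> carrier (free_module K S)"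
proof -
  interpret cring K by fact
  have "finite {q. free_gen K p q \<noteq> \<zero>}"
    by (rule finite_subset[of _ "{p}"]) (auto simp: free_gen_def)
  then show ?thesis
    using p by (auto simp: free_module_def free_gen_def)
qed

lemma free_module_induct [consumes 2, case_names zero gen add]:
  fixes K (structure)
  assumes "cring K" "\<phi> \<in> carrier (free_module K S)"
    and zero: "P \<zero>\<^bsub>free_module K S\<^esub>"
    and gen: "\<And>r p. r \<in> carrier K \<Longrightarrow> p \<in> S \<Longrightarrow> P (r \<odot>\<^bsub>free_module K S\<^esub> free_gen K p)"
    and add: "\<And>\<phi> \<psi>. \<phi> \<in> carrier (free_module K S) \<Longrightarrow> \<psi> \<in> carrier (free_module K S) \<Longrightarrow>
      P \<phi> \<Longrightarrow> P \<psi> \<Longrightarrow> P (\<phi> \<oplus>\<^bsub>free_module K S\<^esub> \<psi>)"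
  shows "P \<phi>"
proof -
  interpret cring K by fact
  interpret F: module K "free_module K S" by (rule free_module_is_module) fact
  have "finite {p. \<phi> p \<noteq> \<zero>}"
    using assms(2) by (simp add: free_module_def)
  \<comment> \<open>The induction is over a finite superset of the support, so that the step need
    not know whether the value at the removed point vanishes.\<close>
  moreover have "P \<phi>" if "finite U" "{p. \<phi> p \<noteq> \<zero>} \<subseteq> U" "\<phi> \<in> carrier (free_module K S)" for U \<phi>
    using that
  proof (induction U arbitrary: \<phi>)
    case empty
    then have "\<phi> = \<zero>\<^bsub>free_module K S\<^esub>"
      by (auto simp: free_module_def)
    then show ?case
      using zero by simp
  next
    case (insert p U)
    show ?case
    proof (cases "p \<in> S")
      case True
      \<comment> \<open>Zeroing the value at \<open>p\<close> moves the support into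
        \<open>U\<close>; what is lost is one multiple of the generator at \<open>p\<close>.\<close>
      let ?\<psi> = "\<phi>(p := \<zero>)"
      have "finite {q. ?\<psi> q \<noteq> \<zero>}"
        by (rule finite_subset[of _ "insert p U"]) (use insert in auto)
      then have \<psi>: "?\<psi> \<in> carrier (free_module K S)"
        using insert.prems by (auto simp: free_module_def)
      then have "P ?\<psi>"
        by (rule insert.IH[rotated]) (use insert.prems in auto)
      moreover have p: "\<phi> p \<in> carrier K"
        using insert.prems True by (simp add: free_module_def)
      moreover have "\<phi> = \<phi> p \<odot>\<^bsub>free_module K S\<^esub> free_gen K p \<oplus>\<^bsub>free_module K S\<^esub> ?\<psi>"
      proof
        fix q
        have "\<phi> q \<in> carrier K"
          using insert.prems by (cases "q \<in> S") (auto simp: free_module_def)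
        then show "\<phi> q = (\<phi> p \<odot>\<^bsub>free_module K S\<^esub> free_gen K p \<oplus>\<^bsub>free_module K S\<^esub> ?\<psi>) q"
          using p by (auto simp: free_module_def free_gen_def)
      qed
      ultimately show ?thesis
        using add[OF F.smult_closed[OF p free_gen_closed[OF assms(1) True]] \<psi> gen[OF p True]]
        by simp
    next
      case False
      then have "\<phi> p = \<zero>"
        using insert.prems by (simp add: free_module_def)
      then show ?thesis
        by (intro insert.IH) (use insert.prems in auto)
    qed
  qed
  ultimately show ?thesis
    using assms(2) by blast
qed

text \<open>The linear extension of \<open>b\<close> from the generators. The sum over the support
  has the same shape as in \<open>tensor_lift\<close>, so a tensor lift is the common value of such
  a map by mere unfolding.\<close>

definition free_lift ::
  "('k, 'm) ring_scheme \<Rightarrow> ('k, 'c, 'p) module_scheme \<Rightarrow> ('x \<Rightarrow> 'c) \<Rightarrow> ('x \<Rightarrow> 'k) \<Rightarrow> 'c"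
  where "free_lift K P b \<phi> = (\<Oplus>\<^bsub>P\<^esub>p \<in> {p. \<phi> p \<noteq> \<zero>\<^bsub>K\<^esub>}. \<phi> p \<odot>\<^bsub>P\<^esub> b p)"

context
  fixes K :: "('k, 'm) ring_scheme" and P :: "('k, 'c, 'p) module_scheme" and b and S :: "'x set"
  assumes P: "module K P" and b: "b \<in> S \<rightarrow> carrier P"
begin

interpretation P: module K P by (fact P)

text \<open>Linearity compares sums over different supports. Enlarging them to a common finite set
  adds only zero terms.\<close>

lemma free_lift_superset:
  assumes "\<phi> \<in> carrier (free_module K S)" "finite U" "U \<subseteq> S" "{p. \<phi> p \<noteq> \<zero>\<^bsub>K\<^esub>} \<subseteq> U"
  shows "free_lift K P b \<phi> = (\<Oplus>\<^bsub>P\<^esub>p \<in> U. \<phi> p \<odot>\<^bsub>P\<^esub> b p)"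
  unfolding free_lift_def
  by (rule P.M.add.finprod_mono_neutral_cong_left)
    (use assms b in \<open>auto simp: free_module_def Pi_iff intro!: P.smult_l_null\<close>)

lemma free_lift_linear: "free_lift K P b \<in> linear_maps K (free_module K S) P"
proof (rule linear_mapsI)
  interpret F: module K "free_module K S"
    by (rule free_module_is_module) (rule P.R.is_cring)
  let ?supp = "\<lambda>\<phi>. {p. \<phi> p \<noteq> \<zero>\<^bsub>K\<^esub>}"
  have supp: "finite (?supp \<phi>)" "?supp \<phi> \<subseteq> S" if "\<phi> \<in> carrier (free_module K S)" for \<phi>
    using that by (auto simp: free_module_def)
  have closed: "\<phi> p \<in> carrier K" if "\<phi> \<in> carrier (free_module K S)" "p \<in> S" for \<phi> p
    using that by (simp add: free_module_def)
  show "free_lift K P b \<phi> \<in> carrier P" if "\<phi> \<in> carrier (free_module K S)" for \<phi>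
    unfolding free_lift_def using that supp[OF that] b
    by (intro P.M.finsum_closed) (auto simp: closed Pi_iff subset_iff intro!: P.smult_closed)
  show "free_lift K P b (\<phi> \<oplus>\<^bsub>free_module K S\<^esub> \<psi>) = free_lift K P b \<phi> \<oplus>\<^bsub>P\<^esub> free_lift K P b \<psi>"
    if \<phi>: "\<phi> \<in> carrier (free_module K S)" and \<psi>: "\<psi> \<in> carrier (free_module K S)" for \<phi> \<psi>
  proof -
    \<comment> \<open>The support of the sum may be a proper subset of this union, because values
      can cancel.\<close>
    let ?U = "?supp \<phi> \<union> ?supp \<psi>"
    have U: "finite ?U" "?U \<subseteq> S"
      using supp[OF \<phi>] supp[OF \<psi>] by auto
    have "free_lift K P b (\<phi> \<oplus>\<^bsub>free_module K S\<^esub> \<psi>) =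
        (\<Oplus>\<^bsub>P\<^esub>p \<in> ?U. (\<phi> \<oplus>\<^bsub>free_module K S\<^esub> \<psi>) p \<odot>\<^bsub>P\<^esub> b p)"
      using \<phi> \<psi> by (intro free_lift_superset U F.M.add.m_closed) (auto simp: free_module_def)
    also have "\<dots> = (\<Oplus>\<^bsub>P\<^esub>p \<in> ?U. \<phi> p \<odot>\<^bsub>P\<^esub> b p \<oplus>\<^bsub>P\<^esub> \<psi> p \<odot>\<^bsub>P\<^esub> b p)"
      using U \<phi> \<psi> b
      by (intro P.M.finsum_cong')
        (auto simp: free_module_def Pi_iff subset_iff P.smult_l_distr)
    also have "\<dots> = (\<Oplus>\<^bsub>P\<^esub>p \<in> ?U. \<phi> p \<odot>\<^bsub>P\<^esub> b p) \<oplus>\<^bsub>P\<^esub> (\<Oplus>\<^bsub>P\<^esub>p \<in> ?U. \<psi> p \<odot>\<^bsub>P\<^esub> b p)"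
      using U \<phi> \<psi> b
      by (intro P.M.finsum_addf) (auto simp: closed Pi_iff subset_iff intro!: P.smult_closed)
    also have "(\<Oplus>\<^bsub>P\<^esub>p \<in> ?U. \<phi> p \<odot>\<^bsub>P\<^esub> b p) = free_lift K P b \<phi>"
      by (rule free_lift_superset[symmetric]) (use U \<phi> in auto)
    also have "(\<Oplus>\<^bsub>P\<^esub>p \<in> ?U. \<psi> p \<odot>\<^bsub>P\<^esub> b p) = free_lift K P b \<psi>"
      by (rule free_lift_superset[symmetric]) (use U \<psi> in auto)
    finally show ?thesis .
  qed
  show "free_lift K P b (r \<odot>\<^bsub>free_module K S\<^esub> \<phi>) = r \<odot>\<^bsub>P\<^esub> free_lift K P b \<phi>"
    if r: "r \<in> carrier K" and \<phi>: "\<phi> \<in> carrier (free_module K S)" for r \<phi>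
  proof -
    \<comment> \<open>Here too the support can shrink, for instance for zero
      \<open>r\<close>.\<close>
    have "free_lift K P b (r \<odot>\<^bsub>free_module K S\<^esub> \<phi>) =
        (\<Oplus>\<^bsub>P\<^esub>p \<in> ?supp \<phi>. (r \<odot>\<^bsub>free_module K S\<^esub> \<phi>) p \<odot>\<^bsub>P\<^esub> b p)"
      by (intro free_lift_superset supp[OF \<phi>] F.smult_closed r \<phi>)
        (use r in \<open>auto simp: free_module_def\<close>)
    also have "\<dots> = (\<Oplus>\<^bsub>P\<^esub>p \<in> ?supp \<phi>. r \<odot>\<^bsub>P\<^esub> (\<phi> p \<odot>\<^bsub>P\<^esub> b p))"
      using supp[OF \<phi>] \<phi> b r
      by (intro P.M.finsum_cong')
        (auto simp: free_module_def Pi_iff subset_iff P.smult_assoc1)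
    also have "\<dots> = r \<odot>\<^bsub>P\<^esub> free_lift K P b \<phi>"
      unfolding free_lift_def using supp[OF \<phi>] \<phi> b r
      by (intro P.finsum_smult_ldistr[symmetric])
        (auto simp: closed Pi_iff subset_iff intro!: P.smult_closed)
    finally show ?thesis .
  qed
qed

lemma free_lift_gen:
  assumes "p \<in> S"
  shows "free_lift K P b (free_gen K p) = b p"
proof -
  \<comment> \<open>Summing over the singleton avoids a case distinction: over the zero ring the
    support of the generator is empty.\<close>
  have "free_lift K P b (free_gen K p) = (\<Oplus>\<^bsub>P\<^esub>q \<in> {p}. free_gen K p q \<odot>\<^bsub>P\<^esub> b q)"
    by (rule free_lift_superset)
      (use assms free_gen_closed[OF P.R.is_cring] in \<open>auto simp: free_gen_def\<close>)
  then show ?thesis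
    using b assms by (simp add: free_gen_def Pi_iff)
qed

end

section \<open>Tensor products\<close>

text \<open>Encoded as two families of linear maps, so that every closure lemma for linear maps can
  be used in either argument.\<close>

definition bilinear_maps ::
  "('k, 'm) ring_scheme \<Rightarrow> ('k, 'a, 'p) module_scheme \<Rightarrow> ('k, 'b, 'q) module_scheme \<Rightarrow>
    ('k, 'c, 'r) module_scheme \<Rightarrow> ('a \<Rightarrow> 'b \<Rightarrow> 'c) set"
  where "bilinear_maps K M N P =
    {\<beta>. (\<forall>x \<in> carrier M. (\<lambda>y. \<beta> x y) \<in> linear_maps K N P)
      \<and> (\<forall>y \<in> carrier N. (\<lambda>x. \<beta> x y) \<in> linear_maps K M P)}"

lemma bilinear_mapsI:
  assumes "\<And>x. x \<in> carrier M \<Longrightarrow> (\<lambda>y. \<beta> x y) \<in> linear_maps K N P"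
    and "\<And>y. y \<in> carrier N \<Longrightarrow> (\<lambda>x. \<beta> x y) \<in> linear_maps K M P"
  shows "\<beta> \<in> bilinear_maps K M N P"
  using assms unfolding bilinear_maps_def by simp

lemma bilinear_mapsD:
  assumes "\<beta> \<in> bilinear_maps K M N P"
  shows "x \<in> carrier M \<Longrightarrow> (\<lambda>y. \<beta> x y) \<in> linear_maps K N P"
    and "y \<in> carrier N \<Longrightarrow> (\<lambda>x. \<beta> x y) \<in> linear_maps K M P"
  using assms unfolding bilinear_maps_def by simp_all

lemma bilinear_maps_closed:
  "\<beta> \<in> bilinear_maps K M N P \<Longrightarrow> x \<in> carrier M \<Longrightarrow> y \<in> carrier N \<Longrightarrow> \<beta> x y \<in> carrier P"
  using bilinear_mapsD(1) linear_maps_closed by metis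

section \<open>Pure tensors and induction over tensors\<close>

context
  fixes K :: "('k, 'm) ring_scheme"
    and M :: "('k, 'a, 'p) module_scheme" and N :: "('k, 'b, 'q) module_scheme"
  assumes M: "module K M" and N: "module K N"
begin

interpretation M: module K M by (fact M)
interpretation N: module K N by (fact N)

lemma free_on_pairs_module: "module K (free_on_pairs K M N)"
  by (rule free_module_is_module) (rule M.R.is_cring)

interpretation F: module K "free_on_pairs K M N" by (fact free_on_pairs_module)

lemma free_gen_pair_closed:
  "x \<in> carrier M \<Longrightarrow> y \<in> carrier N \<Longrightarrow> free_gen K (x, y) \<in> carrier (free_on_pairs K M N)"
  by (rule free_gen_closed) (simp_all add: M.R.is_cring)

lemma bilinear_relations_closed: "bilinear_relations K M N \<subseteq> carrier (free_on_pairs K M N)"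
  unfolding bilinear_relations_def Let_def
  by (auto intro!: F.M.minus_closed F.M.add.m_closed F.smult_closed free_gen_pair_closed)

lemma tensor_kernel_submodule: "submodule (tensor_kernel K M N) K (free_on_pairs K M N)"
  unfolding tensor_kernel_def
  by (rule span_submodule) (rule free_on_pairs_module bilinear_relations_closed)+

lemma tensor_module_is_module: "module K (tensor_module K M N)"
  unfolding tensor_module_def
  by (rule quotient_module_is_module) (rule free_on_pairs_module tensor_kernel_submodule)+

text \<open>For each law of bilinearity, the difference of the two sides is one of the relations,
  hence lies in \<open>tensor_kernel\<close>, and the cosets coincide.\<close>

lemma pure_tensor_bilinear: "pure_tensor K M N \<in> bilinear_maps K M N (tensor_module K M N)"
proof -
  let ?F = "free_on_pairs K M N"
  let ?e = "free_gen K" and ?H = "tensor_kernel K M N"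
  note coset = free_on_pairs_module tensor_kernel_submodule
  note add = add_quotient_module[OF coset, symmetric]
    and smult = smult_quotient_module[OF coset, symmetric]
    and closed = coset_closed[OF coset]
  have eq: "?H +>\<^bsub>?F\<^esub> u = ?H +>\<^bsub>?F\<^esub> v"
    if "u \<ominus>\<^bsub>?F\<^esub> v \<in> bilinear_relations K M N"
      "u \<in> carrier ?F" "v \<in> carrier ?F" for u v
    using that span_superset[of "bilinear_relations K M N" K "?F"]
    by (subst coset_eq_iff[OF coset]) (auto simp: tensor_kernel_def)
  show ?thesis
    unfolding tensor_module_def pure_tensor_def
  proof (rule bilinear_mapsI; rule linear_mapsI)
    fix x y y' r assume x: "x \<in> carrier M" and y: "y \<in> carrier N"
    then show "?H +>\<^bsub>?F\<^esub> ?e (x, y) \<in> carrier (quotient_module ?F ?H)"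
      by (intro closed free_gen_pair_closed)
    {
      assume y': "y' \<in> carrier N"
      have "?H +>\<^bsub>?F\<^esub> ?e (x, y \<oplus>\<^bsub>N\<^esub> y') = ?H +>\<^bsub>?F\<^esub> (?e (x, y) \<oplus>\<^bsub>?F\<^esub> ?e (x, y'))"
        using x y y' by (intro eq F.M.add.m_closed free_gen_pair_closed N.M.add.m_closed)
          (unfold bilinear_relations_def Let_def, blast)
      then show "?H +>\<^bsub>?F\<^esub> ?e (x, y \<oplus>\<^bsub>N\<^esub> y') =
          (?H +>\<^bsub>?F\<^esub> ?e (x, y)) \<oplus>\<^bsub>quotient_module ?F ?H\<^esub> (?H +>\<^bsub>?F\<^esub> ?e (x, y'))"
        using x y y' by (simp only: add free_gen_pair_closed)
    }
    assume r: "r \<in> carrier K"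
    have "?H +>\<^bsub>?F\<^esub> ?e (x, r \<odot>\<^bsub>N\<^esub> y) = ?H +>\<^bsub>?F\<^esub> (r \<odot>\<^bsub>?F\<^esub> ?e (x, y))"
      using x y r by (intro eq F.smult_closed free_gen_pair_closed N.smult_closed)
        (unfold bilinear_relations_def Let_def, blast)
    then show "?H +>\<^bsub>?F\<^esub> ?e (x, r \<odot>\<^bsub>N\<^esub> y) = r \<odot>\<^bsub>quotient_module ?F ?H\<^esub> (?H +>\<^bsub>?F\<^esub> ?e (x, y))"
      using x y r by (simp only: smult free_gen_pair_closed)
  next
    fix x x' y r assume y: "y \<in> carrier N" and x: "x \<in> carrier M"
    then show "?H +>\<^bsub>?F\<^esub> ?e (x, y) \<in> carrier (quotient_module ?F ?H)"
      by (intro closed free_gen_pair_closed)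
    {
      assume x': "x' \<in> carrier M"
      have "?H +>\<^bsub>?F\<^esub> ?e (x \<oplus>\<^bsub>M\<^esub> x', y) = ?H +>\<^bsub>?F\<^esub> (?e (x, y) \<oplus>\<^bsub>?F\<^esub> ?e (x', y))"
        using x y x' by (intro eq F.M.add.m_closed free_gen_pair_closed M.M.add.m_closed)
          (unfold bilinear_relations_def Let_def, blast)
      then show "?H +>\<^bsub>?F\<^esub> ?e (x \<oplus>\<^bsub>M\<^esub> x', y) =
          (?H +>\<^bsub>?F\<^esub> ?e (x, y)) \<oplus>\<^bsub>quotient_module ?F ?H\<^esub> (?H +>\<^bsub>?F\<^esub> ?e (x', y))"
        using x y x' by (simp only: add free_gen_pair_closed)
    }
    assume r: "r \<in> carrier K"
    have "?H +>\<^bsub>?F\<^esub> ?e (r \<odot>\<^bsub>M\<^esub> x, y) = ?H +>\<^bsub>?F\<^esub> (r \<odot>\<^bsub>?F\<^esub> ?e (x, y))"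
      using x y r by (intro eq F.smult_closed free_gen_pair_closed M.smult_closed)
        (unfold bilinear_relations_def Let_def, blast)
    then show "?H +>\<^bsub>?F\<^esub> ?e (r \<odot>\<^bsub>M\<^esub> x, y) = r \<odot>\<^bsub>quotient_module ?F ?H\<^esub> (?H +>\<^bsub>?F\<^esub> ?e (x, y))"
      using x y r by (simp only: smult free_gen_pair_closed)
  qed
qed

lemma pure_tensor_closed:
  "x \<in> carrier M \<Longrightarrow> y \<in> carrier N \<Longrightarrow> pure_tensor K M N x y \<in> carrier (tensor_module K M N)"
  by (rule bilinear_maps_closed[OF pure_tensor_bilinear])

text \<open>The free module is generated by multiples of pairs, but neither zero nor multiples need
  a case of their own: 0 = 0 \<otimes> 0 and r (x \<otimes> y) = (r x) \<otimes> y.\<close>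

lemma tensor_induct [consumes 1, case_names pure add]:
  assumes "X \<in> carrier (tensor_module K M N)"
    and pure: "\<And>x y. x \<in> carrier M \<Longrightarrow> y \<in> carrier N \<Longrightarrow> P (pure_tensor K M N x y)"
    and add: "\<And>X Y. X \<in> carrier (tensor_module K M N) \<Longrightarrow> Y \<in> carrier (tensor_module K M N) \<Longrightarrow>
      P X \<Longrightarrow> P Y \<Longrightarrow> P (X \<oplus>\<^bsub>tensor_module K M N\<^esub> Y)"
  shows "P X"
proof -
  let ?F = "free_on_pairs K M N"
  let ?H = "tensor_kernel K M N"
  note coset = free_on_pairs_module tensor_kernel_submodule
  note lin = coset_linear[OF coset, folded tensor_module_def]
  have smult: "P (r \<odot>\<^bsub>tensor_module K M N\<^esub> pure_tensor K M N x y)"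
    if "r \<in> carrier K" "x \<in> carrier M" "y \<in> carrier N" for r x y
    using that linear_maps_smult[OF bilinear_mapsD(2)[OF pure_tensor_bilinear that(3)] that(1,2)]
      pure[OF M.smult_closed[OF that(1,2)] that(3)] by simp
  obtain \<phi> where "\<phi> \<in> carrier ?F" "X = ?H +>\<^bsub>?F\<^esub> \<phi>"
    using assms(1) quotient_module_cases[OF coset] unfolding tensor_module_def by metis
  moreover have "P (?H +>\<^bsub>?F\<^esub> \<phi>)" if "\<phi> \<in> carrier ?F" for \<phi>
    using M.R.is_cring that
  proof (induction rule: free_module_induct)
    case zero
    have "?H +>\<^bsub>?F\<^esub> \<zero>\<^bsub>?F\<^esub> = \<zero>\<^bsub>tensor_module K M N\<^esub>"
      by (rule linear_maps_zero[OF free_on_pairs_module tensor_module_is_module lin])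
    also have "\<dots> = pure_tensor K M N \<zero>\<^bsub>M\<^esub> \<zero>\<^bsub>N\<^esub>"
      by (rule linear_maps_zero[OF M tensor_module_is_module
            bilinear_mapsD(2)[OF pure_tensor_bilinear N.M.zero_closed], symmetric])
    finally show ?case
      using pure by simp
  next
    case (gen r p)
    then obtain x y where p: "p = (x, y)" "x \<in> carrier M" "y \<in> carrier N"
      by blast
    then have "?H +>\<^bsub>?F\<^esub> (r \<odot>\<^bsub>?F\<^esub> free_gen K p) =
        r \<odot>\<^bsub>tensor_module K M N\<^esub> pure_tensor K M N x y"
      using linear_maps_smult[OF lin gen(1) free_gen_pair_closed] by (simp add: pure_tensor_def)
    then show ?case
      using smult gen(1) p by simp
  next
    case (add \<phi> \<psi>)
    then show ?case
      using assms(3) linear_maps_add[OF lin] linear_maps_closed[OF lin] by simp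
  qed
  ultimately show ?thesis
    by simp
qed

text \<open>The standard way to prove an identity of tensors below: exhibit both sides as linear in
  one tensor and compare them on pure tensors.\<close>

lemma tensor_linear_eqI:
  assumes "h \<in> linear_maps K (tensor_module K M N) P" "h' \<in> linear_maps K (tensor_module K M N) P"
    and "\<And>x y. x \<in> carrier M \<Longrightarrow> y \<in> carrier N \<Longrightarrow>
      h (pure_tensor K M N x y) = h' (pure_tensor K M N x y)"
    and "X \<in> carrier (tensor_module K M N)"
  shows "h X = h' X"
  using assms(4)
  by (induction rule: tensor_induct)
    (simp_all add: assms(3) linear_maps_add[OF assms(1)] linear_maps_add[OF assms(2)])

section \<open>Universal property of the tensor product\<close>

context
  fixes P :: "('k, 'c, 'r) module_scheme" and \<beta>
  assumes P: "module K P" and \<beta>: "\<beta> \<in> bilinear_maps K M N P"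
begin

interpretation P: module K P by (fact P)

text \<open>The linear extension of \<beta> to the free module kills each relation, exactly because
  \<beta> is bilinear. Its kernel is a submodule, hence contains their span, and the map descends to
  cosets.\<close>

lemma
  shows tensor_lift_linear: "tensor_lift K P \<beta> \<in> linear_maps K (tensor_module K M N) P"
    and tensor_lift_coset: "\<phi> \<in> carrier (free_on_pairs K M N) \<Longrightarrow>
      tensor_lift K P \<beta> (tensor_kernel K M N +>\<^bsub>free_on_pairs K M N\<^esub> \<phi>) =
      free_lift K P (\<lambda>p. \<beta> (fst p) (snd p)) \<phi>"
proof -
  let ?F = "free_on_pairs K M N"
  let ?L = "free_lift K P (\<lambda>p. \<beta> (fst p) (snd p))"
  have b: "(\<lambda>p. \<beta> (fst p) (snd p)) \<in> carrier M \<times> carrier N \<rightarrow> carrier P"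
    using bilinear_maps_closed[OF \<beta>] by auto
  note L = free_lift_linear[OF P b]
  note L_minus = linear_maps_minus[OF free_on_pairs_module P L]
    and L_add = linear_maps_add[OF L] and L_smult = linear_maps_smult[OF L]
    and \<beta>_closed = bilinear_maps_closed[OF \<beta>]
  have gen: "?L (free_gen K (x, y)) = \<beta> x y" if "x \<in> carrier M" "y \<in> carrier N" for x y
    using free_lift_gen[OF P b, of "(x, y)"] that by simp
  have "?L r = \<zero>\<^bsub>P\<^esub>" if "r \<in> bilinear_relations K M N" for r
    using that unfolding bilinear_relations_def Let_def
    by (auto simp: L_minus L_add L_smult gen free_gen_pair_closed F.M.add.m_closed F.smult_closed
        linear_maps_add[OF bilinear_mapsD(1)[OF \<beta>]] linear_maps_add[OF bilinear_mapsD(2)[OF \<beta>]]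
        linear_maps_smult[OF bilinear_mapsD(1)[OF \<beta>]] linear_maps_smult[OF bilinear_mapsD(2)[OF \<beta>]]
        \<beta>_closed P.M.minus_eq P.M.r_neg)
  then have "tensor_kernel K M N \<subseteq> {\<phi> \<in> carrier ?F. ?L \<phi> = \<zero>\<^bsub>P\<^esub>}"
    unfolding tensor_kernel_def using bilinear_relations_closed
    by (intro span_minimal linear_maps_kernel[OF free_on_pairs_module P L]) auto
  then have kernel: "?L \<phi> = \<zero>\<^bsub>P\<^esub>" if "\<phi> \<in> tensor_kernel K M N" for \<phi>
    using that by blast
  have lift: "tensor_lift K P \<beta> = common_value ?L"
    unfolding tensor_lift_def free_lift_def ..
  note coset = free_on_pairs_module tensor_kernel_submodule
  show "tensor_lift K P \<beta> \<in> linear_maps K (tensor_module K M N) P"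
    unfolding lift tensor_module_def by (rule common_value_linear[OF coset P L kernel])
  show "tensor_lift K P \<beta> (tensor_kernel K M N +>\<^bsub>?F\<^esub> \<phi>) = ?L \<phi>" if "\<phi> \<in> carrier ?F"
    unfolding lift by (rule common_value_linear_coset[OF coset P L kernel that])
qed

lemma tensor_lift_pure:
  assumes "x \<in> carrier M" "y \<in> carrier N"
  shows "tensor_lift K P \<beta> (pure_tensor K M N x y) = \<beta> x y"
proof -
  have "(\<lambda>p. \<beta> (fst p) (snd p)) \<in> carrier M \<times> carrier N \<rightarrow> carrier P"
    using bilinear_maps_closed[OF \<beta>] by auto
  from free_lift_gen[OF P this, of "(x, y)"] show ?thesis
    unfolding pure_tensor_def using assms
    by (simp add: tensor_lift_coset[OF free_gen_pair_closed])
qed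

end

end

text \<open>Composition on both sides in one rule; most later uses take the identity for some of the
  three maps.\<close>

lemma bilinear_maps_comp:
  assumes "\<beta> \<in> bilinear_maps K M' N' P" "h \<in> linear_maps K P Q"
    "f \<in> linear_maps K M M'" "g \<in> linear_maps K N N'"
  shows "(\<lambda>x y. h (\<beta> (f x) (g y))) \<in> bilinear_maps K M N Q"
proof (rule bilinear_mapsI)
  show "(\<lambda>y. h (\<beta> (f x) (g y))) \<in> linear_maps K N Q" if "x \<in> carrier M" for x
    by (intro linear_maps_comp[OF assms(2)]
        linear_maps_comp[OF bilinear_mapsD(1)[OF assms(1)] assms(4)] linear_maps_closed[OF assms(3) that])
  show "(\<lambda>x. h (\<beta> (f x) (g y))) \<in> linear_maps K M Q" if "y \<in> carrier N" for y
    by (intro linear_maps_comp[OF assms(2)]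
        linear_maps_comp[OF bilinear_mapsD(2)[OF assms(1)] assms(3)] linear_maps_closed[OF assms(4) that])
qed

lemma bilinear_maps_cong:
  assumes "\<beta> \<in> bilinear_maps K M N P" "module K M" "module K N"
    and "\<And>x y. x \<in> carrier M \<Longrightarrow> y \<in> carrier N \<Longrightarrow> \<beta> x y = \<beta>' x y"
  shows "\<beta>' \<in> bilinear_maps K M N P"
  using assms by (intro bilinear_mapsI)
    (auto intro: linear_maps_cong[OF bilinear_mapsD(1)] linear_maps_cong[OF bilinear_mapsD(2)])

text \<open>Rewriting under a Sweedler sum. The integrands need to agree only on the carriers, and
  bilinearity has to be shown only for the first of them.\<close>

lemma tensor_lift_cong:
  assumes "module K M" "module K N" "module K P" "\<beta> \<in> bilinear_maps K M N P"
    and "\<And>x y. x \<in> carrier M \<Longrightarrow> y \<in> carrier N \<Longrightarrow> \<beta> x y = \<beta>' x y"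
    and "X \<in> carrier (tensor_module K M N)"
  shows "tensor_lift K P \<beta> X = tensor_lift K P \<beta>' X"
proof -
  have \<beta>': "\<beta>' \<in> bilinear_maps K M N P"
    by (rule bilinear_maps_cong[OF assms(4,1,2,5)])
  show ?thesis
    by (rule tensor_linear_eqI[OF assms(1,2) tensor_lift_linear[OF assms(1-4)]
          tensor_lift_linear[OF assms(1-3) \<beta>'] _ assms(6)])
      (simp add: tensor_lift_pure[OF assms(1-4)] tensor_lift_pure[OF assms(1-3) \<beta>'] assms(5))
qed

text \<open>Moves a linear map under a Sweedler sum, or out of it when read backwards.\<close>

lemma linear_map_tensor_lift:
  assumes "module K M" "module K N" "module K P" "module K Q"
    "\<beta> \<in> bilinear_maps K M N P" "h \<in> linear_maps K P Q" "X \<in> carrier (tensor_module K M N)"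
  shows "h (tensor_lift K P \<beta> X) = tensor_lift K Q (\<lambda>x y. h (\<beta> x y)) X"
proof -
  have \<beta>: "(\<lambda>x y. h (\<beta> x y)) \<in> bilinear_maps K M N Q"
    by (rule bilinear_maps_comp[OF assms(5,6) linear_maps_id linear_maps_id])
  show ?thesis
    by (rule tensor_linear_eqI[OF assms(1,2) linear_maps_comp[OF assms(6)
            tensor_lift_linear[OF assms(1-3,5)]] tensor_lift_linear[OF assms(1,2,4) \<beta>] _ assms(7)])
      (simp add: tensor_lift_pure[OF assms(1,2,4) \<beta>] tensor_lift_pure[OF assms(1-3,5)])
qed

section \<open>Functoriality of the tensor product\<close>

context
  fixes K :: "('k, 'm) ring_scheme"
    and M :: "('k, 'a, 'p) module_scheme" and N :: "('k, 'b, 'q) module_scheme"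
    and M' :: "('k, 'c, 'p1) module_scheme" and N' :: "('k, 'd, 'q1) module_scheme" and f g
  assumes modules: "module K M" "module K N" "module K M'" "module K N'"
    and f: "f \<in> linear_maps K M M'" and g: "g \<in> linear_maps K N N'"
begin

lemma tensor_map_bilinear:
  "(\<lambda>x y. pure_tensor K M' N' (f x) (g y)) \<in> bilinear_maps K M N (tensor_module K M' N')"
  by (rule bilinear_maps_comp[OF pure_tensor_bilinear[OF modules(3,4)] linear_maps_id f g])

lemma tensor_map_linear:
  "tensor_map K M' N' f g \<in> linear_maps K (tensor_module K M N) (tensor_module K M' N')"
  unfolding tensor_map_def
  by (rule tensor_lift_linear[OF modules(1,2) tensor_module_is_module[OF modules(3,4)] tensor_map_bilinear])

lemma tensor_map_pure:
  "x \<in> carrier M \<Longrightarrow> y \<in> carrier N \<Longrightarrow>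
    tensor_map K M' N' f g (pure_tensor K M N x y) = pure_tensor K M' N' (f x) (g y)"
  unfolding tensor_map_def
  by (rule tensor_lift_pure[OF modules(1,2) tensor_module_is_module[OF modules(3,4)] tensor_map_bilinear])

text \<open>Change of variables in a Sweedler sum: the lift is linear, so it moves under the sum
  that defines f \<otimes> g and meets only pure tensors.\<close>

lemma tensor_lift_tensor_map:
  assumes "module K P" "\<beta> \<in> bilinear_maps K M' N' P" "X \<in> carrier (tensor_module K M N)"
  shows "tensor_lift K P \<beta> (tensor_map K M' N' f g X) = tensor_lift K P (\<lambda>x y. \<beta> (f x) (g y)) X"
proof -
  have "tensor_lift K P \<beta> (tensor_map K M' N' f g X) =
      tensor_lift K P (\<lambda>x y. tensor_lift K P \<beta> (pure_tensor K M' N' (f x) (g y))) X"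
    unfolding tensor_map_def
    by (rule linear_map_tensor_lift[OF modules(1,2) tensor_module_is_module[OF modules(3,4)] assms(1)
          tensor_map_bilinear tensor_lift_linear[OF modules(3,4) assms(1,2)] assms(3)])
  also have "\<dots> = tensor_lift K P (\<lambda>x y. \<beta> (f x) (g y)) X"
    by (rule tensor_lift_cong[OF modules(1,2) assms(1)
          bilinear_maps_comp[OF assms(2) linear_maps_id f g] _ assms(3), symmetric])
      (simp add: tensor_lift_pure[OF modules(3,4) assms(1,2)] linear_maps_closed[OF f]
        linear_maps_closed[OF g])
  finally show ?thesis .
qed

end

text \<open>In nested Sweedler sums the inner sum must depend linearly on the outer variables.
  Induction on \<open>X\<close> shows this: on a pure tensor the lift evaluates to \<beta>, and sums
  of linear maps are linear.\<close>

lemma tensor_lift_param_linear: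
  assumes "module K M" "module K N" "module K P" "module K L"
    and "\<And>z. z \<in> carrier L \<Longrightarrow> \<beta> z \<in> bilinear_maps K M N P"
    and "\<And>x y. x \<in> carrier M \<Longrightarrow> y \<in> carrier N \<Longrightarrow> (\<lambda>z. \<beta> z x y) \<in> linear_maps K L P"
    and "X \<in> carrier (tensor_module K M N)"
  shows "(\<lambda>z. tensor_lift K P (\<beta> z) X) \<in> linear_maps K L P"
proof -
  interpret P: module K P by fact
  interpret L: module K L by fact
  note lin = tensor_lift_linear[OF assms(1-3,5)]
  note lin_closed = linear_maps_closed[OF lin] and lin_add = linear_maps_add[OF lin]
  from assms(7) show ?thesis
  proof (induction rule: tensor_induct[OF assms(1,2), consumes 1, case_names pure add])
    case (pure x y)
    then show ?case
      using linear_maps_cong[OF assms(6)[OF pure] assms(4),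
          of "\<lambda>z. tensor_lift K P (\<beta> z) (pure_tensor K M N x y)"]
      by (simp add: tensor_lift_pure[OF assms(1-3,5)])
  next
    case (add X Y)
    note X = add(1,3) and Y = add(2,4)
    have eq: "tensor_lift K P (\<beta> z) (X \<oplus>\<^bsub>tensor_module K M N\<^esub> Y) =
        tensor_lift K P (\<beta> z) X \<oplus>\<^bsub>P\<^esub> tensor_lift K P (\<beta> z) Y" if "z \<in> carrier L" for z
      using that lin_add add by blast
    show ?case
    proof (rule linear_mapsI)
      show "tensor_lift K P (\<beta> z) (X \<oplus>\<^bsub>tensor_module K M N\<^esub> Y) \<in> carrier P"
        if "z \<in> carrier L" for z
        using that X Y by (simp add: eq lin_closed)
      show "tensor_lift K P (\<beta> (z \<oplus>\<^bsub>L\<^esub> w)) (X \<oplus>\<^bsub>tensor_module K M N\<^esub> Y) =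
          tensor_lift K P (\<beta> z) (X \<oplus>\<^bsub>tensor_module K M N\<^esub> Y) \<oplus>\<^bsub>P\<^esub>
          tensor_lift K P (\<beta> w) (X \<oplus>\<^bsub>tensor_module K M N\<^esub> Y)"
        if "z \<in> carrier L" "w \<in> carrier L" for z w
        using that X Y linear_maps_add[OF X(2) that] linear_maps_add[OF Y(2) that]
        by (simp add: eq lin_closed P.M.add.m_ac)
      show "tensor_lift K P (\<beta> (r \<odot>\<^bsub>L\<^esub> z)) (X \<oplus>\<^bsub>tensor_module K M N\<^esub> Y) =
          r \<odot>\<^bsub>P\<^esub> tensor_lift K P (\<beta> z) (X \<oplus>\<^bsub>tensor_module K M N\<^esub> Y)"
        if "r \<in> carrier K" "z \<in> carrier L" for r z
        using that X Y linear_maps_smult[OF X(2) that] linear_maps_smult[OF Y(2) that]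
        by (simp add: eq lin_closed P.smult_r_distr)
    qed
  qed
qed

lemma tensor_lift_bilinear_linear:
  assumes "module K M" "module K N" "module K P" "module K L" "module K L'"
    and "\<And>z w. z \<in> carrier L \<Longrightarrow> w \<in> carrier L' \<Longrightarrow> \<beta> z w \<in> bilinear_maps K M N P"
    and "\<And>x y. x \<in> carrier M \<Longrightarrow> y \<in> carrier N \<Longrightarrow> (\<lambda>z w. \<beta> z w x y) \<in> bilinear_maps K L L' P"
    and "X \<in> carrier (tensor_module K M N)"
  shows "(\<lambda>z w. tensor_lift K P (\<beta> z w) X) \<in> bilinear_maps K L L' P"
  using assms by (intro bilinear_mapsI tensor_lift_param_linear) (blast dest: bilinear_mapsD)+

text \<open>Fubini for Sweedler sums. Both sides are linear in \<open>X\<close>, the right one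
  because \<open>X\<close> enters it as a parameter of the outer lift; on a pure \<open>X\<close>
  the lift over \<open>X\<close> becomes an evaluation.\<close>

lemma tensor_lift_swap:
  assumes "module K M" "module K N" "module K P" "module K M'" "module K N'"
    and \<Phi>: "\<And>x y. x \<in> carrier M \<Longrightarrow> y \<in> carrier N \<Longrightarrow> \<Phi> x y \<in> bilinear_maps K M' N' P"
      "\<And>u v. u \<in> carrier M' \<Longrightarrow> v \<in> carrier N' \<Longrightarrow> (\<lambda>x y. \<Phi> x y u v) \<in> bilinear_maps K M N P"
    and X: "X \<in> carrier (tensor_module K M N)" and Y: "Y \<in> carrier (tensor_module K M' N')"
  shows "tensor_lift K P (\<lambda>x y. tensor_lift K P (\<Phi> x y) Y) X =
    tensor_lift K P (\<lambda>u v. tensor_lift K P (\<lambda>x y. \<Phi> x y u v) X) Y"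
proof (rule tensor_linear_eqI[OF assms(1,2) _ _ _ X])
  note inner = tensor_lift_bilinear_linear[OF assms(4,5,3,1,2) \<Phi> Y]
  show "tensor_lift K P (\<lambda>x y. tensor_lift K P (\<Phi> x y) Y) \<in> linear_maps K (tensor_module K M N) P"
    by (rule tensor_lift_linear[OF assms(1-3) inner])
  show "(\<lambda>X. tensor_lift K P (\<lambda>u v. tensor_lift K P (\<lambda>x y. \<Phi> x y u v) X) Y)
      \<in> linear_maps K (tensor_module K M N) P"
    by (rule tensor_lift_param_linear[OF assms(4,5,3) tensor_module_is_module[OF assms(1,2)] _ _ Y])
      (auto intro: tensor_lift_linear[OF assms(1-3)] \<Phi>
        tensor_lift_bilinear_linear[OF assms(1,2,3,4,5)])
  fix x y assume xy: "x \<in> carrier M" "y \<in> carrier N"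
  have "tensor_lift K P (\<Phi> x y) Y =
      tensor_lift K P (\<lambda>u v. tensor_lift K P (\<lambda>x y. \<Phi> x y u v) (pure_tensor K M N x y)) Y"
    by (rule tensor_lift_cong[OF assms(4,5,3) \<Phi>(1)[OF xy] _ Y])
      (simp add: tensor_lift_pure[OF assms(1-3) \<Phi>(2)] xy)
  then show "tensor_lift K P (\<lambda>x y. tensor_lift K P (\<Phi> x y) Y) (pure_tensor K M N x y) =
      tensor_lift K P (\<lambda>u v. tensor_lift K P (\<lambda>x y. \<Phi> x y u v) (pure_tensor K M N x y)) Y"
    by (simp add: tensor_lift_pure[OF assms(1-3) inner] xy)
qed

section \<open>Tensor products of algebras\<close>

text \<open>Stated for \<open>f x\<close> instead of \<open>x\<close> so that nested products can be
  proved linear by backward chaining, without writing compositions.\<close>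

lemma (in unital_algebra) mult_left_linear:
  "f \<in> linear_maps K M A \<Longrightarrow> c \<in> carrier A \<Longrightarrow> (\<lambda>x. f x \<otimes>\<^bsub>A\<^esub> c) \<in> linear_maps K M A"
  by (rule linear_mapsI)
    (auto simp: linear_maps_closed linear_maps_add linear_maps_smult A.l_distr smult_mult_left)

lemma (in unital_algebra) mult_right_linear:
  "f \<in> linear_maps K M A \<Longrightarrow> c \<in> carrier A \<Longrightarrow> (\<lambda>x. c \<otimes>\<^bsub>A\<^esub> f x) \<in> linear_maps K M A"
  by (rule linear_mapsI)
    (auto simp: linear_maps_closed linear_maps_add linear_maps_smult A.r_distr smult_mult_right)

lemma (in module) scalar_linear:
  assumes "f \<in> linear_maps R N (scalar_module R)" "c \<in> carrier M"
  shows "(\<lambda>x. f x \<odot>\<^bsub>M\<^esub> c) \<in> linear_maps R N M"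
proof (rule linear_mapsI)
  have closed: "f x \<in> carrier R" if "x \<in> carrier N" for x
    using linear_maps_closed[OF assms(1) that] by (simp add: scalar_module_def)
  then show "f x \<odot>\<^bsub>M\<^esub> c \<in> carrier M" if "x \<in> carrier N" for x
    using that assms(2) by simp
  show "f (x \<oplus>\<^bsub>N\<^esub> y) \<odot>\<^bsub>M\<^esub> c = f x \<odot>\<^bsub>M\<^esub> c \<oplus>\<^bsub>M\<^esub> f y \<odot>\<^bsub>M\<^esub> c"
    if "x \<in> carrier N" "y \<in> carrier N" for x y
    using that closed assms(2) linear_maps_add[OF assms(1) that]
    by (simp add: scalar_module_def smult_l_distr)
  show "f (r \<odot>\<^bsub>N\<^esub> x) \<odot>\<^bsub>M\<^esub> c = r \<odot>\<^bsub>M\<^esub> (f x \<odot>\<^bsub>M\<^esub> c)"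
    if "r \<in> carrier R" "x \<in> carrier N" for r x
    using that closed assms(2) linear_maps_smult[OF assms(1) that]
    by (simp add: scalar_module_def smult_assoc1)
qed

lemma (in module) smult_linear:
  assumes "f \<in> linear_maps R N M" "r \<in> carrier R"
  shows "(\<lambda>x. r \<odot>\<^bsub>M\<^esub> f x) \<in> linear_maps R N M"
proof (rule linear_mapsI)
  note closed = linear_maps_closed[OF assms(1)]
  then show "r \<odot>\<^bsub>M\<^esub> f x \<in> carrier M" if "x \<in> carrier N" for x
    using that assms(2) by simp
  show "r \<odot>\<^bsub>M\<^esub> f (x \<oplus>\<^bsub>N\<^esub> y) = r \<odot>\<^bsub>M\<^esub> f x \<oplus>\<^bsub>M\<^esub> r \<odot>\<^bsub>M\<^esub> f y"
    if "x \<in> carrier N" "y \<in> carrier N" for x y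
    using that closed assms(2) linear_maps_add[OF assms(1) that] by (simp add: smult_r_distr)
  \<comment> \<open>Commutativity of the scalars enters here.\<close>
  show "r \<odot>\<^bsub>M\<^esub> f (s \<odot>\<^bsub>N\<^esub> x) = s \<odot>\<^bsub>M\<^esub> (r \<odot>\<^bsub>M\<^esub> f x)"
    if "s \<in> carrier R" "x \<in> carrier N" for s x
    using that closed assms(2) linear_maps_smult[OF assms(1) that]
    by (simp add: smult_assoc1[symmetric] R.m_comm)
qed

lemma tensor_algebra_simps:
  "carrier (tensor_algebra K A B) = carrier (tensor_module K A B)"
  "add (tensor_algebra K A B) = add (tensor_module K A B)"
  "one (tensor_algebra K A B) = pure_tensor K A B \<one>\<^bsub>A\<^esub> \<one>\<^bsub>B\<^esub>"
  "X \<otimes>\<^bsub>tensor_algebra K A B\<^esub> Y =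
    tensor_lift K (tensor_module K A B) (\<lambda>a b. tensor_lift K (tensor_module K A B)
      (\<lambda>c d. pure_tensor K A B (a \<otimes>\<^bsub>A\<^esub> c) (b \<otimes>\<^bsub>B\<^esub> d)) Y) X"
  unfolding tensor_algebra_def Let_def by simp_all

section \<open>Multiplication on a tensor product of algebras\<close>

context
  fixes K :: "('k, 'm) ring_scheme"
    and A :: "('k, 'a, 'p) module_scheme" and B :: "('k, 'b, 'q) module_scheme"
  assumes A: "unital_algebra K A" and B: "unital_algebra K B"
begin

interpretation A: unital_algebra K A by (fact A)
interpretation B: unital_algebra K B by (fact B)

lemmas alg_modules = A.module_axioms B.module_axioms
lemmas alg_tensor_module = tensor_module_is_module[OF alg_modules]

text \<open>The product is a lift inside a lift. Bilinearity in the right factors makes the inner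
  lift meaningful, bilinearity in the left factors makes its value a bilinear integrand for the
  outer one.\<close>

lemma tensor_mult_inner:
  "a \<in> carrier A \<Longrightarrow> b \<in> carrier B \<Longrightarrow>
    (\<lambda>c d. pure_tensor K A B (a \<otimes>\<^bsub>A\<^esub> c) (b \<otimes>\<^bsub>B\<^esub> d)) \<in> bilinear_maps K A B (tensor_module K A B)"
  "c \<in> carrier A \<Longrightarrow> d \<in> carrier B \<Longrightarrow>
    (\<lambda>a b. pure_tensor K A B (a \<otimes>\<^bsub>A\<^esub> c) (b \<otimes>\<^bsub>B\<^esub> d)) \<in> bilinear_maps K A B (tensor_module K A B)"
  by (intro bilinear_maps_comp[OF pure_tensor_bilinear[OF alg_modules] linear_maps_id]
      A.mult_right_linear B.mult_right_linear A.mult_left_linear B.mult_left_linear linear_maps_id;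
    assumption)+

lemma tensor_mult_outer:
  "Y \<in> carrier (tensor_module K A B) \<Longrightarrow> (\<lambda>a b. tensor_lift K (tensor_module K A B)
      (\<lambda>c d. pure_tensor K A B (a \<otimes>\<^bsub>A\<^esub> c) (b \<otimes>\<^bsub>B\<^esub> d)) Y) \<in> bilinear_maps K A B (tensor_module K A B)"
  by (rule tensor_lift_bilinear_linear[OF alg_modules alg_tensor_module alg_modules tensor_mult_inner])

text \<open>The left factor is the argument of the outer lift, while the right factor enters it only
  as a parameter; hence the two different arguments for linearity.\<close>

lemma tensor_mult_bilinear: "(\<lambda>X Y. X \<otimes>\<^bsub>tensor_algebra K A B\<^esub> Y) \<in> bilinear_maps K (tensor_module K A B) (tensor_module K A B) (tensor_module K A B)"
proof (rule bilinear_mapsI)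
  show "(\<lambda>X. X \<otimes>\<^bsub>tensor_algebra K A B\<^esub> Y) \<in> linear_maps K (tensor_module K A B) (tensor_module K A B)" if "Y \<in> carrier (tensor_module K A B)" for Y
    unfolding tensor_algebra_simps
    by (rule tensor_lift_linear[OF alg_modules alg_tensor_module tensor_mult_outer[OF that]])
  show "(\<lambda>Y. X \<otimes>\<^bsub>tensor_algebra K A B\<^esub> Y) \<in> linear_maps K (tensor_module K A B) (tensor_module K A B)" if "X \<in> carrier (tensor_module K A B)" for X
    unfolding tensor_algebra_simps
    by (rule tensor_lift_param_linear[OF alg_modules alg_tensor_module alg_tensor_module
          tensor_mult_outer tensor_lift_linear[OF alg_modules alg_tensor_module
            tensor_mult_inner(1)] that])
qed

lemma tensor_mult_pure:
  assumes "a \<in> carrier A" "b \<in> carrier B" "c \<in> carrier A" "d \<in> carrier B"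
  shows "pure_tensor K A B a b \<otimes>\<^bsub>tensor_algebra K A B\<^esub> pure_tensor K A B c d =
    pure_tensor K A B (a \<otimes>\<^bsub>A\<^esub> c) (b \<otimes>\<^bsub>B\<^esub> d)"
  unfolding tensor_algebra_simps using assms
  by (simp add: tensor_lift_pure[OF alg_modules alg_tensor_module tensor_mult_outer]
      tensor_lift_pure[OF alg_modules alg_tensor_module tensor_mult_inner(1)]
      pure_tensor_closed[OF alg_modules])

text \<open>Applied later with a lift in place of \<open>h\<close>, which turns a product of tensors
  into a double Sweedler sum.\<close>

lemma linear_map_tensor_mult:
  assumes "module K P" "h \<in> linear_maps K (tensor_module K A B) P" "X \<in> carrier (tensor_module K A B)" "Y \<in> carrier (tensor_module K A B)"
  shows "h (X \<otimes>\<^bsub>tensor_algebra K A B\<^esub> Y) =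
    tensor_lift K P (\<lambda>a b. tensor_lift K P
      (\<lambda>c d. h (pure_tensor K A B (a \<otimes>\<^bsub>A\<^esub> c) (b \<otimes>\<^bsub>B\<^esub> d))) Y) X"
proof -
  have "h (X \<otimes>\<^bsub>tensor_algebra K A B\<^esub> Y) =
      tensor_lift K P (\<lambda>a b. h (tensor_lift K (tensor_module K A B)
        (\<lambda>c d. pure_tensor K A B (a \<otimes>\<^bsub>A\<^esub> c) (b \<otimes>\<^bsub>B\<^esub> d)) Y)) X"
    unfolding tensor_algebra_simps
    by (rule linear_map_tensor_lift[OF alg_modules alg_tensor_module assms(1)
          tensor_mult_outer[OF assms(4)] assms(2,3)])
  also have "\<dots> = tensor_lift K P (\<lambda>a b. tensor_lift K P
      (\<lambda>c d. h (pure_tensor K A B (a \<otimes>\<^bsub>A\<^esub> c) (b \<otimes>\<^bsub>B\<^esub> d))) Y) X"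
    by (rule tensor_lift_cong[OF alg_modules assms(1) bilinear_maps_comp[OF
            tensor_mult_outer[OF assms(4)] assms(2) linear_maps_id linear_maps_id] _ assms(3)])
      (rule linear_map_tensor_lift[OF alg_modules alg_tensor_module assms(1)
          tensor_mult_inner(1) assms(2,4)])
  finally show ?thesis .
qed

end

lemma tensor_map_mult:
  assumes alg: "unital_algebra K A" "unital_algebra K B" "unital_algebra K A'" "unital_algebra K B'"
    and f: "f \<in> ring_hom A A'" "f \<in> linear_maps K A A'"
    and g: "g \<in> ring_hom B B'" "g \<in> linear_maps K B B'"
    and X: "X \<in> carrier (tensor_module K A B)" and Y: "Y \<in> carrier (tensor_module K A B)"
  shows "tensor_map K A' B' f g (X \<otimes>\<^bsub>tensor_algebra K A B\<^esub> Y) =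
    tensor_map K A' B' f g X \<otimes>\<^bsub>tensor_algebra K A' B'\<^esub> tensor_map K A' B' f g Y"
proof -
  interpret A: unital_algebra K A by fact
  interpret B: unital_algebra K B by fact
  interpret A': unital_algebra K A' by fact
  interpret B': unital_algebra K B' by fact
  note modules = A.module_axioms B.module_axioms A'.module_axioms B'.module_axioms
  note lin = tensor_map_linear[OF modules f(2) g(2)] and pure = tensor_map_pure[OF modules f(2) g(2)]
  note bil = tensor_mult_bilinear[OF alg(1,2)] and bil' = tensor_mult_bilinear[OF alg(3,4)]
  note eqI = tensor_linear_eqI[OF modules(1,2)]
  note closed = linear_maps_closed[OF f(2)] linear_maps_closed[OF g(2)]
    and pure_closed = pure_tensor_closed[OF modules(1,2)] pure_tensor_closed[OF modules(3,4)]
  let ?h = "tensor_map K A' B' f g"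
  \<comment> \<open>The left factor is pure at first and the right one arbitrary; the general case
    then follows by linearity in the left factor.\<close>
  have "?h (pure_tensor K A B a b \<otimes>\<^bsub>tensor_algebra K A B\<^esub> Y) =
      ?h (pure_tensor K A B a b) \<otimes>\<^bsub>tensor_algebra K A' B'\<^esub> ?h Y"
    if ab: "a \<in> carrier A" "b \<in> carrier B" for a b
    by (rule eqI[OF linear_maps_comp[OF lin bilinear_mapsD(1)[OF bil]]
          linear_maps_comp[OF bilinear_mapsD(1)[OF bil'] lin] _ Y])
      (use ab in \<open>simp_all add: tensor_mult_pure[OF alg(1,2)] tensor_mult_pure[OF alg(3,4)] pure
        pure_closed closed linear_maps_closed[OF lin] ring_hom_mult[OF f(1)] ring_hom_mult[OF g(1)]\<close>)
  then show ?thesis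
    using X Y by (intro eqI[OF linear_maps_comp[OF lin bilinear_mapsD(2)[OF bil]]
          linear_maps_comp[OF bilinear_mapsD(2)[OF bil'] lin] _ X])
      (simp_all add: linear_maps_closed[OF lin])
qed

section \<open>Bialgebras and the antipode\<close>

text \<open>These are the integrands of the two nested lifts in \<open>tensor_assoc\<close>; with
  their bilinearity the associator can be evaluated.\<close>

lemma tensor_assoc_bilinear:
  assumes "module K L" "module K M" "module K N"
  defines "T \<equiv> tensor_module K L (tensor_module K M N)"
  shows "z \<in> carrier N \<Longrightarrow>
      (\<lambda>x y. pure_tensor K L (tensor_module K M N) x (pure_tensor K M N y z)) \<in> bilinear_maps K L M T"
    and "(\<lambda>X z. tensor_lift K T (\<lambda>x y. pure_tensor K L (tensor_module K M N) x (pure_tensor K M N y z)) X)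
      \<in> bilinear_maps K (tensor_module K L M) N T"
proof -
  note MN = tensor_module_is_module[OF assms(2,3)]
  note T = tensor_module_is_module[OF assms(1) MN, folded T_def]
  note pure = pure_tensor_bilinear[OF assms(1) MN, folded T_def]
    and pure' = pure_tensor_bilinear[OF assms(2,3)]
  have inner: "(\<lambda>x y. pure_tensor K L (tensor_module K M N) x (pure_tensor K M N y z))
      \<in> bilinear_maps K L M T" if "z \<in> carrier N" for z
    using bilinear_maps_comp[OF pure linear_maps_id linear_maps_id bilinear_mapsD(2)[OF pure' that]] .
  have inner': "(\<lambda>z. pure_tensor K L (tensor_module K M N) x (pure_tensor K M N y z))
      \<in> linear_maps K N T" if "x \<in> carrier L" "y \<in> carrier M" for x y
    using linear_maps_comp[OF bilinear_mapsD(1)[OF pure that(1)] bilinear_mapsD(1)[OF pure' that(2)]] .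
  show "z \<in> carrier N \<Longrightarrow>
      (\<lambda>x y. pure_tensor K L (tensor_module K M N) x (pure_tensor K M N y z)) \<in> bilinear_maps K L M T"
    by (rule inner)
  show "(\<lambda>X z. tensor_lift K T (\<lambda>x y. pure_tensor K L (tensor_module K M N) x (pure_tensor K M N y z)) X)
      \<in> bilinear_maps K (tensor_module K L M) N T"
    by (rule bilinear_mapsI)
      (rule tensor_lift_param_linear[OF assms(1,2) T assms(3) inner inner']
        tensor_lift_linear[OF assms(1,2) T inner]; assumption)+
qed

section \<open>Sweedler calculus in a bialgebra\<close>

context bialgebra
begin

abbreviation (input) "AA \<equiv> tensor_module K A A"

lemma AA_module: "module K AA"
  by (rule tensor_module_is_module[OF module_axioms module_axioms])

lemma comult_closed: "x \<in> carrier A \<Longrightarrow> comult A x \<in> carrier AA"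
  by (rule linear_maps_closed[OF comult_linear])

lemma counit_closed: "x \<in> carrier A \<Longrightarrow> counit A x \<in> carrier K"
  using linear_maps_closed[OF counit_linear] by (simp add: scalar_module_def)

lemma lift_comult_linear:
  assumes "module K P" "\<Phi> \<in> bilinear_maps K A A P" "f \<in> linear_maps K M A"
  shows "(\<lambda>x. tensor_lift K P \<Phi> (comult A (f x))) \<in> linear_maps K M P"
  by (rule linear_maps_comp[OF tensor_lift_linear[OF module_axioms module_axioms assms(1,2)]
        linear_maps_comp[OF comult_linear assms(3)]])

text \<open>Multiplicativity of \<open>comult\<close> in Sweedler form. The lift of \<Phi> is a
  linear map applied to the product of \<open>comult A a\<close> and \<open>comult A b\<close>, and
  moves under both sums of that product.\<close>

lemma lift_comult_mult:
  assumes "module K P" "\<Phi> \<in> bilinear_maps K A A P" "a \<in> carrier A" "b \<in> carrier A"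
  shows "tensor_lift K P \<Phi> (comult A (a \<otimes>\<^bsub>A\<^esub> b)) =
    tensor_lift K P (\<lambda>a\<^sub>1 a\<^sub>2. tensor_lift K P
      (\<lambda>b\<^sub>1 b\<^sub>2. \<Phi> (a\<^sub>1 \<otimes>\<^bsub>A\<^esub> b\<^sub>1) (a\<^sub>2 \<otimes>\<^bsub>A\<^esub> b\<^sub>2)) (comult A b)) (comult A a)"
proof -
  note A = module_axioms
  let ?L = "tensor_lift K P \<Phi>"
  have L: "?L \<in> linear_maps K AA P"
    by (rule tensor_lift_linear[OF A A assms(1,2)])
  note pure = tensor_lift_pure[OF A A assms(1,2)]
  have "?L (comult A (a \<otimes>\<^bsub>A\<^esub> b)) =
      ?L (comult A a \<otimes>\<^bsub>tensor_algebra K A A\<^esub> comult A b)"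
    using ring_hom_mult[OF comult_hom assms(3,4)] by simp
  also have "\<dots> = tensor_lift K P (\<lambda>a\<^sub>1 a\<^sub>2. tensor_lift K P
      (\<lambda>b\<^sub>1 b\<^sub>2. ?L (pure_tensor K A A (a\<^sub>1 \<otimes>\<^bsub>A\<^esub> b\<^sub>1) (a\<^sub>2 \<otimes>\<^bsub>A\<^esub> b\<^sub>2))) (comult A b)) (comult A a)"
    by (rule linear_map_tensor_mult[OF unital_algebra_axioms unital_algebra_axioms assms(1) L
          comult_closed[OF assms(3)] comult_closed[OF assms(4)]])
  also have "\<dots> = tensor_lift K P (\<lambda>a\<^sub>1 a\<^sub>2. tensor_lift K P
      (\<lambda>b\<^sub>1 b\<^sub>2. \<Phi> (a\<^sub>1 \<otimes>\<^bsub>A\<^esub> b\<^sub>1) (a\<^sub>2 \<otimes>\<^bsub>A\<^esub> b\<^sub>2)) (comult A b)) (comult A a)"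
  proof -
    have inner: "(\<lambda>b\<^sub>1 b\<^sub>2. \<Phi> (a\<^sub>1 \<otimes>\<^bsub>A\<^esub> b\<^sub>1) (a\<^sub>2 \<otimes>\<^bsub>A\<^esub> b\<^sub>2)) \<in> bilinear_maps K A A P"
      if "a\<^sub>1 \<in> carrier A" "a\<^sub>2 \<in> carrier A" for a\<^sub>1 a\<^sub>2
      by (rule bilinear_maps_comp[OF assms(2) linear_maps_id
            mult_right_linear[OF linear_maps_id that(1)] mult_right_linear[OF linear_maps_id that(2)]])
    have inner': "(\<lambda>a\<^sub>1 a\<^sub>2. \<Phi> (a\<^sub>1 \<otimes>\<^bsub>A\<^esub> b\<^sub>1) (a\<^sub>2 \<otimes>\<^bsub>A\<^esub> b\<^sub>2)) \<in> bilinear_maps K A A P"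
      if "b\<^sub>1 \<in> carrier A" "b\<^sub>2 \<in> carrier A" for b\<^sub>1 b\<^sub>2
      by (rule bilinear_maps_comp[OF assms(2) linear_maps_id
            mult_left_linear[OF linear_maps_id that(1)] mult_left_linear[OF linear_maps_id that(2)]])
    have outer: "(\<lambda>a\<^sub>1 a\<^sub>2. tensor_lift K P
        (\<lambda>b\<^sub>1 b\<^sub>2. \<Phi> (a\<^sub>1 \<otimes>\<^bsub>A\<^esub> b\<^sub>1) (a\<^sub>2 \<otimes>\<^bsub>A\<^esub> b\<^sub>2)) (comult A b)) \<in> bilinear_maps K A A P"
      by (rule tensor_lift_bilinear_linear[OF A A assms(1) A A inner inner' comult_closed[OF assms(4)]])
    show ?thesis
      by (rule tensor_lift_cong[OF A A assms(1) outer _ comult_closed[OF assms(3)], symmetric],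
          rule tensor_lift_cong[OF A A assms(1) inner _ comult_closed[OF assms(4)]])
        (simp_all add: pure)
  qed
  finally show ?thesis .
qed

text \<open>Coassociativity for a trilinear integrand \<Phi>. Trilinearity yields a linear map from
  A \<otimes> (A \<otimes> A) to \<open>P\<close>, and applying it to both sides of the axiom gives
  the two nested sums.\<close>

lemma lift_coassociative:
  assumes P: "module K P" and a: "a \<in> carrier A"
    and \<Phi>: "\<And>x. x \<in> carrier A \<Longrightarrow> \<Phi> x \<in> bilinear_maps K A A P"
      "\<And>y z. y \<in> carrier A \<Longrightarrow> z \<in> carrier A \<Longrightarrow> (\<lambda>x. \<Phi> x y z) \<in> linear_maps K A P"
  shows "tensor_lift K P (\<lambda>x z. tensor_lift K P (\<lambda>p q. \<Phi> p q z) (comult A x)) (comult A a) =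
    tensor_lift K P (\<lambda>x y. tensor_lift K P (\<lambda>p q. \<Phi> x p q) (comult A y)) (comult A a)"
proof -
  note A = module_axioms and AA = AA_module
  let ?T = "tensor_module K A AA"
  have T: "module K ?T"
    by (rule tensor_module_is_module[OF A AA])
  note \<Delta>a = comult_closed[OF a]
  let ?\<Psi> = "\<lambda>x Y. tensor_lift K P (\<Phi> x) Y"
  have \<Psi>: "?\<Psi> \<in> bilinear_maps K A AA P"
    by (rule bilinear_mapsI)
      (rule tensor_lift_linear[OF A A P \<Phi>(1)] tensor_lift_param_linear[OF A A P A \<Phi>]; assumption)+
  have L: "tensor_lift K P ?\<Psi> \<in> linear_maps K ?T P"
    by (rule tensor_lift_linear[OF A AA P \<Psi>])
  have L_pure: "tensor_lift K P ?\<Psi> (pure_tensor K A AA x (pure_tensor K A A y z)) = \<Phi> x y z"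
    if "x \<in> carrier A" "y \<in> carrier A" "z \<in> carrier A" for x y z
    using that by (simp add: tensor_lift_pure[OF A AA P \<Psi>] tensor_lift_pure[OF A A P \<Phi>(1)]
        pure_tensor_closed[OF A A])
  let ?assoc = "\<lambda>X z. tensor_lift K ?T (\<lambda>x y. pure_tensor K A AA x (pure_tensor K A A y z)) X"
  note assoc = tensor_assoc_bilinear[OF A A A]
  \<comment> \<open>The axioms use the constant \<open>id\<close>, whereas the composition lemmas
    use an abstraction.\<close>
  note id = linear_maps_id[of K A, folded id_def]
  \<comment> \<open>Kept general in \<open>h\<close> because it serves both for the identity and for
    the lift of \<open>?\<Psi>\<close>.\<close>
  have comult_id: "(\<lambda>x z. h (?assoc (comult A x) z)) \<in> bilinear_maps K A A Q"
    if "h \<in> linear_maps K ?T Q" for h :: "_ \<Rightarrow> 'z" and Q :: "('k, 'z, 'y) module_scheme"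
    by (rule bilinear_maps_comp[OF assoc(2) that comult_linear linear_maps_id])
  have "tensor_lift K P ?\<Psi>
      (tensor_assoc K A A A (tensor_map K AA A (comult A) id (comult A a))) =
      tensor_lift K P ?\<Psi> (tensor_lift K ?T (\<lambda>x z. ?assoc (comult A x) z) (comult A a))"
    unfolding tensor_assoc_def Let_def
    by (subst tensor_lift_tensor_map[OF A A AA A comult_linear id T assoc(2) \<Delta>a]) simp
  also have "\<dots> = tensor_lift K P (\<lambda>x z. tensor_lift K P ?\<Psi> (?assoc (comult A x) z)) (comult A a)"
    by (rule linear_map_tensor_lift[OF A A T P comult_id[OF linear_maps_id] L \<Delta>a])
  also have "\<dots> = tensor_lift K P (\<lambda>x z. tensor_lift K P (\<lambda>p q. \<Phi> p q z) (comult A x)) (comult A a)"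
  proof (rule tensor_lift_cong[OF A A P comult_id[OF L] _ \<Delta>a])
    fix x z assume x: "x \<in> carrier A" and z: "z \<in> carrier A"
    have "tensor_lift K P ?\<Psi> (?assoc (comult A x) z) =
      tensor_lift K P (\<lambda>p q. tensor_lift K P ?\<Psi> (pure_tensor K A AA p (pure_tensor K A A q z))) (comult A x)"
      by (rule linear_map_tensor_lift[OF A A T P assoc(1)[OF z] L comult_closed[OF x]])
    also have "\<dots> = tensor_lift K P (\<lambda>p q. \<Phi> p q z) (comult A x)"
      by (rule tensor_lift_cong[OF A A P bilinear_maps_comp[OF assoc(1)[OF z] L linear_maps_id
              linear_maps_id] _ comult_closed[OF x]])
        (simp add: L_pure z)
    finally show "tensor_lift K P ?\<Psi> (?assoc (comult A x) z) =
      tensor_lift K P (\<lambda>p q. \<Phi> p q z) (comult A x)" .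
  qed
  finally have lhs: "tensor_lift K P ?\<Psi>
      (tensor_assoc K A A A (tensor_map K AA A (comult A) id (comult A a))) =
      tensor_lift K P (\<lambda>x z. tensor_lift K P (\<lambda>p q. \<Phi> p q z) (comult A x)) (comult A a)" .
  have "tensor_lift K P ?\<Psi> (tensor_map K A AA id (comult A) (comult A a)) =
      tensor_lift K P (\<lambda>x y. tensor_lift K P (\<Phi> x) (comult A y)) (comult A a)"
    by (subst tensor_lift_tensor_map[OF A A A AA id comult_linear P \<Psi> \<Delta>a]) simp
  with lhs show ?thesis
    using coassociative[OF a] by simp
qed

end

section \<open>The antipode reverses products\<close>

context hopf_algebra
begin

lemma antipode_closed: "x \<in> carrier A \<Longrightarrow> antipode A x \<in> carrier A"
  by (rule linear_maps_closed[OF antipode_linear])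

text \<open>Backward rules that take an integrand apart symbol by symbol; they discharge the
  bilinearity obligations of all the calculations with the antipode.\<close>

lemmas A_linear_intros =
  linear_maps_id mult_left_linear mult_right_linear linear_maps_comp[OF antipode_linear]
  linear_maps_comp[OF counit_linear] scalar_linear smult_linear
  A.m_closed antipode_closed comult_closed counit_closed smult_closed

text \<open>
  In Sweedler notation, \<open>tensor_lift K P \<Phi> (comult A a)\<close> is the sum \<open>\<Phi> a\<^sub>1 a\<^sub>2\<close>. With it, the
  next proof reads \<open>S (a\<^sub>1 b) a\<^sub>2 = S (a\<^sub>1 b\<^sub>1) a\<^sub>2 b\<^sub>2 S b\<^sub>3 = \<epsilon> (a b\<^sub>1) S b\<^sub>2 = \<epsilon> a S b\<close>, and then
  \<open>S (a b) = S (a\<^sub>1 b) a\<^sub>2 S a\<^sub>3 = \<epsilon> a\<^sub>1 S b S a\<^sub>2 = S b S a\<close>.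
\<close>

lemma antipode_mult_contract:
  assumes "a \<in> carrier A" "b \<in> carrier A"
  shows "tensor_lift K A (\<lambda>u v. antipode A (u \<otimes>\<^bsub>A\<^esub> b) \<otimes>\<^bsub>A\<^esub> v) (comult A a) =
    counit A a \<odot>\<^bsub>A\<^esub> antipode A b"
proof -
  note A = module_axioms
  note lift_cong = tensor_lift_cong[OF A A A] and push = linear_map_tensor_lift[OF A A A A]
    and \<Delta>a = comult_closed[OF assms(1)] and \<Delta>b = comult_closed[OF assms(2)]
  let ?S = "antipode A" and ?\<Delta> = "comult A" and ?\<epsilon> = "counit A"
  note param = tensor_lift_param_linear[OF A A A A] and \<Delta>_lin = lift_comult_linear[OF A]
  let ?L = "tensor_lift K A"
  \<comment> \<open>The variables u, v stand for a1, a2 and x, p, q for b1, b2, b3. The factor b2 S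
    b3, whose sum is a scalar, is inserted behind v.\<close>
  have "?L (\<lambda>u v. ?S (u \<otimes>\<^bsub>A\<^esub> b) \<otimes>\<^bsub>A\<^esub> v) (?\<Delta> a) =
      ?L (\<lambda>u v. ?L (\<lambda>x y. ?L (\<lambda>p q. ?S (u \<otimes>\<^bsub>A\<^esub> x) \<otimes>\<^bsub>A\<^esub> ((v \<otimes>\<^bsub>A\<^esub> p) \<otimes>\<^bsub>A\<^esub> ?S q)) (?\<Delta> y)) (?\<Delta> b)) (?\<Delta> a)"
  proof (rule lift_cong[OF _ _ \<Delta>a])
    show "(\<lambda>u v. ?S (u \<otimes>\<^bsub>A\<^esub> b) \<otimes>\<^bsub>A\<^esub> v) \<in> bilinear_maps K A A A"
      using assms by (intro bilinear_mapsI A_linear_intros)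
    fix u v assume u: "u \<in> carrier A" and v: "v \<in> carrier A"
    have "?L (\<lambda>x y. ?L (\<lambda>p q. ?S (u \<otimes>\<^bsub>A\<^esub> x) \<otimes>\<^bsub>A\<^esub> ((v \<otimes>\<^bsub>A\<^esub> p) \<otimes>\<^bsub>A\<^esub> ?S q)) (?\<Delta> y)) (?\<Delta> b) =
        ?L (\<lambda>x y. (?S (u \<otimes>\<^bsub>A\<^esub> (?\<epsilon> y \<odot>\<^bsub>A\<^esub> x)) \<otimes>\<^bsub>A\<^esub> v)) (?\<Delta> b)"
    proof (rule lift_cong[OF _ _ \<Delta>b, symmetric])
      show "(\<lambda>x y. ?S (u \<otimes>\<^bsub>A\<^esub> (?\<epsilon> y \<odot>\<^bsub>A\<^esub> x)) \<otimes>\<^bsub>A\<^esub> v) \<in> bilinear_maps K A A A"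
        using u v by (intro bilinear_mapsI A_linear_intros)
      fix x y assume x: "x \<in> carrier A" and y: "y \<in> carrier A"
      have "?L (\<lambda>p q. ?S (u \<otimes>\<^bsub>A\<^esub> x) \<otimes>\<^bsub>A\<^esub> ((v \<otimes>\<^bsub>A\<^esub> p) \<otimes>\<^bsub>A\<^esub> ?S q)) (?\<Delta> y) =
          ?L (\<lambda>p q. ?S (u \<otimes>\<^bsub>A\<^esub> x) \<otimes>\<^bsub>A\<^esub> (v \<otimes>\<^bsub>A\<^esub> (p \<otimes>\<^bsub>A\<^esub> ?S q))) (?\<Delta> y)"
        using u v x y
        by (intro lift_cong bilinear_mapsI A_linear_intros) (simp_all add: A.m_assoc antipode_closed)
      also have "\<dots> = ?S (u \<otimes>\<^bsub>A\<^esub> x) \<otimes>\<^bsub>A\<^esub> (v \<otimes>\<^bsub>A\<^esub> ?L (\<lambda>p q. p \<otimes>\<^bsub>A\<^esub> ?S q) (?\<Delta> y))"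
        using u v x y
        by (intro push[where h = "\<lambda>w. ?S (u \<otimes>\<^bsub>A\<^esub> x) \<otimes>\<^bsub>A\<^esub> (v \<otimes>\<^bsub>A\<^esub> w)", symmetric]
            bilinear_mapsI A_linear_intros)
      \<comment> \<open>The scalar \<epsilon> y left by the antipode law is moved next to x, where
        the counit law absorbs it.\<close>
      also have "\<dots> = ?S (u \<otimes>\<^bsub>A\<^esub> (?\<epsilon> y \<odot>\<^bsub>A\<^esub> x)) \<otimes>\<^bsub>A\<^esub> v"
        using u v x y antipode_right[OF y]
        by (simp add: smult_mult_right smult_mult_left antipode_closed counit_closed
            linear_maps_smult[OF antipode_linear])
      finally show "?S (u \<otimes>\<^bsub>A\<^esub> (?\<epsilon> y \<odot>\<^bsub>A\<^esub> x)) \<otimes>\<^bsub>A\<^esub> v =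
          ?L (\<lambda>p q. ?S (u \<otimes>\<^bsub>A\<^esub> x) \<otimes>\<^bsub>A\<^esub> ((v \<otimes>\<^bsub>A\<^esub> p) \<otimes>\<^bsub>A\<^esub> ?S q)) (?\<Delta> y)"
        by simp
    qed
    also have "\<dots> = ?S (u \<otimes>\<^bsub>A\<^esub> ?L (\<lambda>x y. ?\<epsilon> y \<odot>\<^bsub>A\<^esub> x) (?\<Delta> b)) \<otimes>\<^bsub>A\<^esub> v"
      using u v assms(2)
      by (intro push[where h = "\<lambda>w. ?S (u \<otimes>\<^bsub>A\<^esub> w) \<otimes>\<^bsub>A\<^esub> v", symmetric]
          bilinear_mapsI A_linear_intros)
    finally show "?S (u \<otimes>\<^bsub>A\<^esub> b) \<otimes>\<^bsub>A\<^esub> v =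
        ?L (\<lambda>x y. ?L (\<lambda>p q. ?S (u \<otimes>\<^bsub>A\<^esub> x) \<otimes>\<^bsub>A\<^esub> ((v \<otimes>\<^bsub>A\<^esub> p) \<otimes>\<^bsub>A\<^esub> ?S q)) (?\<Delta> y)) (?\<Delta> b)"
      using counit_right[OF assms(2)] by simp
  qed
  \<comment> \<open>Coassociativity at \<open>b\<close> regroups b1, b2, b3 so that b1 and b2 are
    the two legs of one element x.\<close>
  also have "\<dots> =
      ?L (\<lambda>u v. ?L (\<lambda>x z. ?L (\<lambda>p q. ?S (u \<otimes>\<^bsub>A\<^esub> p) \<otimes>\<^bsub>A\<^esub> ((v \<otimes>\<^bsub>A\<^esub> q) \<otimes>\<^bsub>A\<^esub> ?S z)) (?\<Delta> x)) (?\<Delta> b)) (?\<Delta> a)"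
  proof (rule lift_cong[OF _ _ \<Delta>a])
    show "(\<lambda>u v. ?L (\<lambda>x y. ?L (\<lambda>p q. ?S (u \<otimes>\<^bsub>A\<^esub> x) \<otimes>\<^bsub>A\<^esub> ((v \<otimes>\<^bsub>A\<^esub> p) \<otimes>\<^bsub>A\<^esub> ?S q)) (?\<Delta> y)) (?\<Delta> b))
        \<in> bilinear_maps K A A A"
      using assms by (intro bilinear_mapsI param \<Delta>_lin A_linear_intros)
    fix u v assume "u \<in> carrier A" "v \<in> carrier A"
    then show "?L (\<lambda>x y. ?L (\<lambda>p q. ?S (u \<otimes>\<^bsub>A\<^esub> x) \<otimes>\<^bsub>A\<^esub> ((v \<otimes>\<^bsub>A\<^esub> p) \<otimes>\<^bsub>A\<^esub> ?S q)) (?\<Delta> y)) (?\<Delta> b) =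
        ?L (\<lambda>x z. ?L (\<lambda>p q. ?S (u \<otimes>\<^bsub>A\<^esub> p) \<otimes>\<^bsub>A\<^esub> ((v \<otimes>\<^bsub>A\<^esub> q) \<otimes>\<^bsub>A\<^esub> ?S z)) (?\<Delta> x)) (?\<Delta> b)"
      using assms(2)
      by (intro lift_coassociative[symmetric, where
            \<Phi> = "\<lambda>x p q. ?S (u \<otimes>\<^bsub>A\<^esub> x) \<otimes>\<^bsub>A\<^esub> ((v \<otimes>\<^bsub>A\<^esub> p) \<otimes>\<^bsub>A\<^esub> ?S q)"] A bilinear_mapsI A_linear_intros)
  qed
  \<comment> \<open>The sums over \<open>a\<close> and \<open>b\<close> change places: once x is
    fixed, the legs of \<open>a\<close> and of x can combine to those of the product of
    \<open>a\<close> and x.\<close>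
  also have "\<dots> =
      ?L (\<lambda>x z. ?L (\<lambda>u v. ?L (\<lambda>p q. ?S (u \<otimes>\<^bsub>A\<^esub> p) \<otimes>\<^bsub>A\<^esub> ((v \<otimes>\<^bsub>A\<^esub> q) \<otimes>\<^bsub>A\<^esub> ?S z)) (?\<Delta> x)) (?\<Delta> a)) (?\<Delta> b)"
    using assms
    by (intro tensor_lift_swap[OF A A A A A] bilinear_mapsI param \<Delta>_lin A_linear_intros)
  also have "\<dots> = ?L (\<lambda>x z. ?\<epsilon> a \<odot>\<^bsub>A\<^esub> ?S (?\<epsilon> x \<odot>\<^bsub>A\<^esub> z)) (?\<Delta> b)"
  proof (rule lift_cong[OF _ _ \<Delta>b, symmetric])
    show "(\<lambda>x z. ?\<epsilon> a \<odot>\<^bsub>A\<^esub> ?S (?\<epsilon> x \<odot>\<^bsub>A\<^esub> z)) \<in> bilinear_maps K A A A"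
      using assms by (intro bilinear_mapsI A_linear_intros)
    fix x z assume x: "x \<in> carrier A" and z: "z \<in> carrier A"
    let ?inner = "\<lambda>u v. ?L (\<lambda>p q. ?S (u \<otimes>\<^bsub>A\<^esub> p) \<otimes>\<^bsub>A\<^esub> (v \<otimes>\<^bsub>A\<^esub> q)) (?\<Delta> x)"
    have inner: "?inner \<in> bilinear_maps K A A A"
      using x by (intro bilinear_mapsI param A_linear_intros)
    have "?L (\<lambda>u v. ?L (\<lambda>p q. ?S (u \<otimes>\<^bsub>A\<^esub> p) \<otimes>\<^bsub>A\<^esub> ((v \<otimes>\<^bsub>A\<^esub> q) \<otimes>\<^bsub>A\<^esub> ?S z)) (?\<Delta> x)) (?\<Delta> a) =
        ?L (\<lambda>u v. ?inner u v \<otimes>\<^bsub>A\<^esub> ?S z) (?\<Delta> a)"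
    proof (rule lift_cong[OF _ _ \<Delta>a, symmetric])
      show "(\<lambda>u v. ?inner u v \<otimes>\<^bsub>A\<^esub> ?S z) \<in> bilinear_maps K A A A"
        using z by (intro bilinear_maps_comp[OF inner, where f = "\<lambda>x. x" and g = "\<lambda>x. x"] A_linear_intros)
      fix u v assume u: "u \<in> carrier A" and v: "v \<in> carrier A"
      have "?inner u v \<otimes>\<^bsub>A\<^esub> ?S z =
          ?L (\<lambda>p q. ?S (u \<otimes>\<^bsub>A\<^esub> p) \<otimes>\<^bsub>A\<^esub> (v \<otimes>\<^bsub>A\<^esub> q) \<otimes>\<^bsub>A\<^esub> ?S z) (?\<Delta> x)"
        using u v x z by (intro push[where h = "\<lambda>w. w \<otimes>\<^bsub>A\<^esub> ?S z"] bilinear_mapsI A_linear_intros)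
      also have "\<dots> = ?L (\<lambda>p q. ?S (u \<otimes>\<^bsub>A\<^esub> p) \<otimes>\<^bsub>A\<^esub> ((v \<otimes>\<^bsub>A\<^esub> q) \<otimes>\<^bsub>A\<^esub> ?S z)) (?\<Delta> x)"
        using u v x z
        by (intro lift_cong bilinear_mapsI A_linear_intros) (simp_all add: A.m_assoc antipode_closed)
      finally show "?inner u v \<otimes>\<^bsub>A\<^esub> ?S z =
          ?L (\<lambda>p q. ?S (u \<otimes>\<^bsub>A\<^esub> p) \<otimes>\<^bsub>A\<^esub> ((v \<otimes>\<^bsub>A\<^esub> q) \<otimes>\<^bsub>A\<^esub> ?S z)) (?\<Delta> x)" .
    qed
    also have "\<dots> = ?L ?inner (?\<Delta> a) \<otimes>\<^bsub>A\<^esub> ?S z"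
      using z assms(1) by (intro push[where h = "\<lambda>w. w \<otimes>\<^bsub>A\<^esub> ?S z", symmetric] inner A_linear_intros)
    \<comment> \<open>The double sum over the legs of \<open>a\<close> and x is a single sum over
      the legs of their product, to which the antipode law applies.\<close>
    also have "?L ?inner (?\<Delta> a) = ?L (\<lambda>y z. ?S y \<otimes>\<^bsub>A\<^esub> z) (?\<Delta> (a \<otimes>\<^bsub>A\<^esub> x))"
      using assms(1) x
      by (intro lift_comult_mult[where \<Phi> = "\<lambda>y z. ?S y \<otimes>\<^bsub>A\<^esub> z", symmetric] A bilinear_mapsI A_linear_intros)
    also have "\<dots> = (?\<epsilon> a \<otimes>\<^bsub>K\<^esub> ?\<epsilon> x) \<odot>\<^bsub>A\<^esub> \<one>\<^bsub>A\<^esub>"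
      using antipode_left[of "a \<otimes>\<^bsub>A\<^esub> x"] ring_hom_mult[OF counit_hom assms(1) x] assms(1) x by simp
    also have "\<dots> \<otimes>\<^bsub>A\<^esub> ?S z = ?\<epsilon> a \<odot>\<^bsub>A\<^esub> ?S (?\<epsilon> x \<odot>\<^bsub>A\<^esub> z)"
      using assms(1) x z by (simp add: smult_mult_left antipode_closed counit_closed
          linear_maps_smult[OF antipode_linear] smult_assoc1)
    finally show "?\<epsilon> a \<odot>\<^bsub>A\<^esub> ?S (?\<epsilon> x \<odot>\<^bsub>A\<^esub> z) =
        ?L (\<lambda>u v. ?L (\<lambda>p q. ?S (u \<otimes>\<^bsub>A\<^esub> p) \<otimes>\<^bsub>A\<^esub> ((v \<otimes>\<^bsub>A\<^esub> q) \<otimes>\<^bsub>A\<^esub> ?S z)) (?\<Delta> x)) (?\<Delta> a)"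
      by simp
  qed
  \<comment> \<open>Pulling out the linear map leaves \<epsilon> b1 b2, which is b.\<close>
  also have "\<dots> = ?\<epsilon> a \<odot>\<^bsub>A\<^esub> ?S (?L (\<lambda>x z. ?\<epsilon> x \<odot>\<^bsub>A\<^esub> z) (?\<Delta> b))"
    using assms by (intro push[where h = "\<lambda>w. ?\<epsilon> a \<odot>\<^bsub>A\<^esub> ?S w", symmetric] bilinear_mapsI A_linear_intros)
  also have "\<dots> = ?\<epsilon> a \<odot>\<^bsub>A\<^esub> ?S b"
    using counit_left[OF assms(2)] by simp
  finally show ?thesis .
qed

theorem antipode_mult:
  assumes "a \<in> carrier A" "b \<in> carrier A"
  shows "antipode A (a \<otimes>\<^bsub>A\<^esub> b) = antipode A b \<otimes>\<^bsub>A\<^esub> antipode A a"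
proof -
  note A = module_axioms
  note lift_cong = tensor_lift_cong[OF A A A] and push = linear_map_tensor_lift[OF A A A A]
    and \<Delta>a = comult_closed[OF assms(1)]
  let ?S = "antipode A" and ?\<Delta> = "comult A" and ?\<epsilon> = "counit A" and ?L = "tensor_lift K A"
  have "?S (a \<otimes>\<^bsub>A\<^esub> b) = ?S (?L (\<lambda>x y. ?\<epsilon> y \<odot>\<^bsub>A\<^esub> x) (?\<Delta> a) \<otimes>\<^bsub>A\<^esub> b)"
    using counit_right[OF assms(1)] by simp
  also have "\<dots> = ?L (\<lambda>x y. ?S ((?\<epsilon> y \<odot>\<^bsub>A\<^esub> x) \<otimes>\<^bsub>A\<^esub> b)) (?\<Delta> a)"
    using assms by (intro push[where h = "\<lambda>w. ?S (w \<otimes>\<^bsub>A\<^esub> b)"] bilinear_mapsI A_linear_intros)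
  \<comment> \<open>The scalar \<epsilon> a2 is expanded to a2 S a3. Bracketing to the left keeps S
    (a1 b) a2 together for the contraction that follows.\<close>
  also have "\<dots> = ?L (\<lambda>x y. ?L (\<lambda>p q. (?S (x \<otimes>\<^bsub>A\<^esub> b) \<otimes>\<^bsub>A\<^esub> p) \<otimes>\<^bsub>A\<^esub> ?S q) (?\<Delta> y)) (?\<Delta> a)"
  proof (rule lift_cong[OF _ _ \<Delta>a])
    show "(\<lambda>x y. ?S ((?\<epsilon> y \<odot>\<^bsub>A\<^esub> x) \<otimes>\<^bsub>A\<^esub> b)) \<in> bilinear_maps K A A A"
      using assms by (intro bilinear_mapsI A_linear_intros)
    fix x y assume x: "x \<in> carrier A" and y: "y \<in> carrier A"
    have "?L (\<lambda>p q. (?S (x \<otimes>\<^bsub>A\<^esub> b) \<otimes>\<^bsub>A\<^esub> p) \<otimes>\<^bsub>A\<^esub> ?S q) (?\<Delta> y) =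
        ?L (\<lambda>p q. ?S (x \<otimes>\<^bsub>A\<^esub> b) \<otimes>\<^bsub>A\<^esub> (p \<otimes>\<^bsub>A\<^esub> ?S q)) (?\<Delta> y)"
      using assms x y
      by (intro lift_cong bilinear_mapsI A_linear_intros) (simp_all add: A.m_assoc antipode_closed)
    also have "\<dots> = ?S (x \<otimes>\<^bsub>A\<^esub> b) \<otimes>\<^bsub>A\<^esub> ?L (\<lambda>p q. p \<otimes>\<^bsub>A\<^esub> ?S q) (?\<Delta> y)"
      using assms x y
      by (intro push[where h = "\<lambda>w. ?S (x \<otimes>\<^bsub>A\<^esub> b) \<otimes>\<^bsub>A\<^esub> w", symmetric] bilinear_mapsI A_linear_intros)
    also have "\<dots> = ?S ((?\<epsilon> y \<odot>\<^bsub>A\<^esub> x) \<otimes>\<^bsub>A\<^esub> b)"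
      using assms x y antipode_right[OF y]
      by (simp add: smult_mult_right smult_mult_left antipode_closed counit_closed
          linear_maps_smult[OF antipode_linear])
    finally show "?S ((?\<epsilon> y \<odot>\<^bsub>A\<^esub> x) \<otimes>\<^bsub>A\<^esub> b) =
        ?L (\<lambda>p q. (?S (x \<otimes>\<^bsub>A\<^esub> b) \<otimes>\<^bsub>A\<^esub> p) \<otimes>\<^bsub>A\<^esub> ?S q) (?\<Delta> y)"
      by simp
  qed
  also have "\<dots> = ?L (\<lambda>x z. ?L (\<lambda>p q. (?S (p \<otimes>\<^bsub>A\<^esub> b) \<otimes>\<^bsub>A\<^esub> q) \<otimes>\<^bsub>A\<^esub> ?S z) (?\<Delta> x)) (?\<Delta> a)"
    using assms
    by (intro lift_coassociative[symmetric, where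
          \<Phi> = "\<lambda>x p q. (?S (x \<otimes>\<^bsub>A\<^esub> b) \<otimes>\<^bsub>A\<^esub> p) \<otimes>\<^bsub>A\<^esub> ?S q"] A bilinear_mapsI A_linear_intros)
  \<comment> \<open>After regrouping, the inner sum runs over the legs of x and has the form treated
    in \<open>antipode_mult_contract\<close>.\<close>
  also have "\<dots> = ?L (\<lambda>x z. ?S b \<otimes>\<^bsub>A\<^esub> ?S (?\<epsilon> x \<odot>\<^bsub>A\<^esub> z)) (?\<Delta> a)"
  proof (rule lift_cong[OF _ _ \<Delta>a, symmetric])
    show "(\<lambda>x z. ?S b \<otimes>\<^bsub>A\<^esub> ?S (?\<epsilon> x \<odot>\<^bsub>A\<^esub> z)) \<in> bilinear_maps K A A A"
      using assms by (intro bilinear_mapsI A_linear_intros)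
    fix x z assume x: "x \<in> carrier A" and z: "z \<in> carrier A"
    have "?L (\<lambda>p q. (?S (p \<otimes>\<^bsub>A\<^esub> b) \<otimes>\<^bsub>A\<^esub> q) \<otimes>\<^bsub>A\<^esub> ?S z) (?\<Delta> x) =
        ?L (\<lambda>p q. ?S (p \<otimes>\<^bsub>A\<^esub> b) \<otimes>\<^bsub>A\<^esub> q) (?\<Delta> x) \<otimes>\<^bsub>A\<^esub> ?S z"
      using assms x z by (intro push[where h = "\<lambda>w. w \<otimes>\<^bsub>A\<^esub> ?S z", symmetric] bilinear_mapsI A_linear_intros)
    also have "\<dots> = ?S b \<otimes>\<^bsub>A\<^esub> ?S (?\<epsilon> x \<odot>\<^bsub>A\<^esub> z)"
      using assms x z by (simp add: antipode_mult_contract smult_mult_right smult_mult_left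
          antipode_closed counit_closed linear_maps_smult[OF antipode_linear])
    finally show "?S b \<otimes>\<^bsub>A\<^esub> ?S (?\<epsilon> x \<odot>\<^bsub>A\<^esub> z) =
        ?L (\<lambda>p q. (?S (p \<otimes>\<^bsub>A\<^esub> b) \<otimes>\<^bsub>A\<^esub> q) \<otimes>\<^bsub>A\<^esub> ?S z) (?\<Delta> x)"
      by simp
  qed
  also have "\<dots> = ?S b \<otimes>\<^bsub>A\<^esub> ?S (?L (\<lambda>x z. ?\<epsilon> x \<odot>\<^bsub>A\<^esub> z) (?\<Delta> a))"
    using assms by (intro push[where h = "\<lambda>w. ?S b \<otimes>\<^bsub>A\<^esub> ?S w", symmetric] bilinear_mapsI A_linear_intros)
  also have "\<dots> = ?S b \<otimes>\<^bsub>A\<^esub> ?S a"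
    using counit_left[OF assms(1)] by simp
  finally show ?thesis .
qed

end

section \<open>Quotients by Hopf ideals\<close>

lemma quotient_hopf_simps:
  "carrier (quotient_hopf K A I) = carrier (quotient_module A I)"
  "mult (quotient_hopf K A I) = mult (quotient_module A I)"
  "one (quotient_hopf K A I) = one (quotient_module A I)"
  "zero (quotient_hopf K A I) = zero (quotient_module A I)"
  "add (quotient_hopf K A I) = add (quotient_module A I)"
  "smult (quotient_hopf K A I) = smult (quotient_module A I)"
  unfolding quotient_hopf_def Let_def by simp_all

text \<open>The predicate takes a whole record, although its content involves only these fields.
  Needed because \<open>quotient_hopf\<close> copies them from \<open>quotient_module\<close> into a
  different record.\<close>

lemma module_cong:
  assumes "module K M" "carrier M' = carrier M" "add M' = add M" "zero M' = zero M"
    "smult M' = smult M"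
  shows "module K M'"
proof -
  interpret M: module K M by fact
  have inv: "\<exists>y \<in> carrier M. y \<oplus>\<^bsub>M\<^esub> x = \<zero>\<^bsub>M\<^esub>" if "x \<in> carrier M" for x
    using that M.M.l_neg[OF that] by blast
  have "abelian_group M'"
    by (rule abelian_groupI) (simp_all add: assms M.M.a_assoc M.M.a_comm M.M.a_lcomm inv)
  then show ?thesis
    by (rule moduleI[OF M.R.is_cring])
      (simp_all add: assms M.smult_l_distr M.smult_r_distr M.smult_assoc1)
qed

lemma linear_maps_quotient_hopf:
  "linear_maps K M (quotient_hopf K A I) = linear_maps K M (quotient_module A I)"
  "linear_maps K (quotient_hopf K A I) M = linear_maps K (quotient_module A I) M"
  unfolding linear_maps_def quotient_hopf_simps by simp_all

text \<open>The comultiplication of the quotient is defined with tensors over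
  \<open>quotient_module\<close>, since the Hopf algebra is still under construction there, but its
  laws speak of tensors over the Hopf algebra. The two agree because tensors see only the carrier,
  addition and scalars.\<close>

lemma tensor_quotient_hopf:
  fixes K :: "('k, 'm) ring_scheme" and A :: "('k, 'a, 'p) hopf_scheme" and I
  defines "Q \<equiv> quotient_hopf K A I" and "Q' \<equiv> quotient_module A I"
  shows "tensor_map K Q' Q' = tensor_map K Q Q"
proof -
  have rel: "bilinear_relations K Q' Q' = bilinear_relations K Q Q"
    unfolding bilinear_relations_def Q_def Q'_def quotient_hopf_simps ..
  have carrier: "carrier Q' = carrier Q"
    unfolding Q_def Q'_def quotient_hopf_simps ..
  have kernel: "tensor_kernel K Q' Q' = tensor_kernel K Q Q"
    unfolding tensor_kernel_def rel carrier ..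
  have "tensor_module K Q' Q' = tensor_module K Q Q" "pure_tensor K Q' Q' = pure_tensor K Q Q"
    unfolding tensor_module_def pure_tensor_def kernel carrier by (rule refl)+
  then show ?thesis
    unfolding tensor_map_def by simp
qed

section \<open>The quotient by a Hopf ideal and its universal property\<close>

context hopf_algebra
begin

context
  fixes I
  assumes hopf_ideal: "hopf_ideal K A I"
begin

interpretation I: ideal I A
  using hopf_ideal unfolding hopf_ideal_def by simp

lemma hopf_ideal_submodule: "submodule I K A"
  using hopf_ideal unfolding hopf_ideal_def coideal_def by simp

abbreviation (input) Q where "Q \<equiv> quotient_hopf K A I"

abbreviation (input) \<pi> where "\<pi> \<equiv> (\<lambda>x. I +>\<^bsub>A\<^esub> x)"

lemma quotient_hopf_module: "module K Q"
  by (rule module_cong[OF quotient_module_is_module[OF module_axioms hopf_ideal_submodule]])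
    (simp_all add: quotient_hopf_simps)

lemma quotient_hopf_ring: "ring Q"
proof -
  have "mult Q = mult (A Quot I)" "one Q = one (A Quot I)" "carrier Q = carrier (A Quot I)"
    "add Q = add (A Quot I)" "zero Q = zero (A Quot I)"
    unfolding quotient_hopf_simps quotient_module_def by simp_all
  then show ?thesis
    using I.quotient_is_ring module.axioms(2)[OF quotient_hopf_module]
    unfolding ring_def ring_axioms_def Group.monoid_def by simp
qed

lemma projection_linear: "\<pi> \<in> linear_maps K A Q"
  unfolding linear_maps_quotient_hopf by (rule coset_linear[OF module_axioms hopf_ideal_submodule])

lemma projection_ring_hom: "\<pi> \<in> ring_hom A Q"
  using I.rcos_ring_hom unfolding ring_hom_def quotient_hopf_simps quotient_module_def by simp

lemmas projection_closed = linear_maps_closed[OF projection_linear]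

lemma quotient_hopf_cases:
  assumes "X \<in> carrier Q"
  obtains x where "x \<in> carrier A" "X = \<pi> x"
  using assms unfolding quotient_hopf_simps
  by (rule quotient_module_cases[OF module_axioms hopf_ideal_submodule])

lemma projection_eq_iff:
  "x \<in> carrier A \<Longrightarrow> y \<in> carrier A \<Longrightarrow> \<pi> x = \<pi> y \<longleftrightarrow> x \<ominus>\<^bsub>A\<^esub> y \<in> I"
  by (rule coset_eq_iff[OF module_axioms hopf_ideal_submodule])

lemma projection_eq_zero: "x \<in> I \<Longrightarrow> \<pi> x = \<zero>\<^bsub>Q\<^esub>"
  using coset_eq_zero_iff[OF module_axioms hopf_ideal_submodule] I.a_subset
  by (auto simp: quotient_hopf_simps zero_quotient_module[OF module_axioms hopf_ideal_submodule])

lemmas induced_map = common_value_linear_coset[OF module_axioms hopf_ideal_submodule]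
lemma quotient_hopf_tensor_module: "module K (tensor_module K Q Q)"
  by (rule tensor_module_is_module[OF quotient_hopf_module quotient_hopf_module])

lemmas tensor_projection_linear = tensor_map_linear[OF module_axioms module_axioms
    quotient_hopf_module quotient_hopf_module projection_linear projection_linear]
lemmas tensor_projection_pure = tensor_map_pure[OF module_axioms module_axioms
    quotient_hopf_module quotient_hopf_module projection_linear projection_linear]
lemmas tensor_lift_projection = tensor_lift_tensor_map[OF module_axioms module_axioms
    quotient_hopf_module quotient_hopf_module projection_linear projection_linear]

lemma tensor_projection_comult_linear:
  "(\<lambda>x. tensor_map K Q Q \<pi> \<pi> (comult A x)) \<in> linear_maps K A (tensor_module K Q Q)"
  by (rule linear_maps_comp[OF tensor_projection_linear comult_linear])

text \<open>The projection kills \<open>I\<close>, so \<pi> \<otimes> \<pi> kills each pure tensor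
  with a factor in \<open>I\<close>; its kernel is a submodule and thus contains both summands of
  the coideal condition.\<close>

lemma tensor_projection_comult_ideal:
  assumes "x \<in> I"
  shows "tensor_map K Q Q \<pi> \<pi> (comult A x) = \<zero>\<^bsub>tensor_module K Q Q\<^esub>"
proof -
  interpret QQ: module K "tensor_module K Q Q"
    by (rule quotient_hopf_tensor_module)
  let ?h = "tensor_map K Q Q \<pi> \<pi>"
  let ?ker = "{X \<in> carrier (tensor_module K A A). ?h X = \<zero>\<^bsub>tensor_module K Q Q\<^esub>}"
  note pure_Q = pure_tensor_bilinear[OF quotient_hopf_module quotient_hopf_module]
  have ker: "submodule ?ker K (tensor_module K A A)"
    by (rule linear_maps_kernel[OF AA_module quotient_hopf_tensor_module tensor_projection_linear])
  have zero: "pure_tensor K Q Q \<zero>\<^bsub>Q\<^esub> y = \<zero>\<^bsub>tensor_module K Q Q\<^esub>"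
    "pure_tensor K Q Q y \<zero>\<^bsub>Q\<^esub> = \<zero>\<^bsub>tensor_module K Q Q\<^esub>" if "y \<in> carrier Q" for y
    using linear_maps_zero[OF quotient_hopf_module quotient_hopf_tensor_module
        bilinear_mapsD(1)[OF pure_Q that]]
      linear_maps_zero[OF quotient_hopf_module quotient_hopf_tensor_module
        bilinear_mapsD(2)[OF pure_Q that]] by simp_all
  have left: "tensor_image K A A I (carrier A) \<subseteq> ?ker"
    unfolding tensor_image_def using I.a_subset
    by (intro span_minimal[OF ker])
      (auto simp: tensor_projection_pure projection_eq_zero zero projection_closed
        intro!: pure_tensor_closed[OF module_axioms module_axioms])
  have right: "tensor_image K A A (carrier A) I \<subseteq> ?ker"
    unfolding tensor_image_def using I.a_subset
    by (intro span_minimal[OF ker])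
      (auto simp: tensor_projection_pure projection_eq_zero zero projection_closed
        intro!: pure_tensor_closed[OF module_axioms module_axioms])
  obtain U V where "U \<in> tensor_image K A A I (carrier A)" "V \<in> tensor_image K A A (carrier A) I"
    and sum: "comult A x = U \<oplus>\<^bsub>tensor_module K A A\<^esub> V"
    using hopf_ideal assms unfolding hopf_ideal_def coideal_def set_add_def' by auto
  then have "U \<in> ?ker" "V \<in> ?ker"
    using left right by blast+
  then show ?thesis
    unfolding sum by (simp add: linear_maps_add[OF tensor_projection_linear])
qed

lemma comult_quotient_hopf_def':
  "comult Q = common_value (\<lambda>x. tensor_map K Q Q \<pi> \<pi> (comult A x))"
  unfolding tensor_quotient_hopf[symmetric] by (simp add: quotient_hopf_def Let_def)

lemma comult_quotient_hopf:
  "x \<in> carrier A \<Longrightarrow> comult Q (\<pi> x) = tensor_map K Q Q \<pi> \<pi> (comult A x)"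
  unfolding comult_quotient_hopf_def'
  by (rule induced_map[OF quotient_hopf_tensor_module tensor_projection_comult_linear
        tensor_projection_comult_ideal])

lemma comult_quotient_hopf_linear: "comult Q \<in> linear_maps K Q (tensor_module K Q Q)"
  unfolding comult_quotient_hopf_def' linear_maps_quotient_hopf(2)
  by (rule common_value_linear[OF module_axioms hopf_ideal_submodule quotient_hopf_tensor_module
        tensor_projection_comult_linear tensor_projection_comult_ideal])

lemma counit_ideal: "x \<in> I \<Longrightarrow> counit A x = \<zero>\<^bsub>scalar_module K\<^esub>"
  using hopf_ideal unfolding hopf_ideal_def coideal_def by (simp add: scalar_module_def)

lemma scalars_module: "module K (scalar_module K)"
  by (rule scalar_module_is_module) (rule module.axioms(1)[OF module_axioms])

lemma counit_quotient_hopf: "x \<in> carrier A \<Longrightarrow> counit Q (\<pi> x) = counit A x"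
  using induced_map[OF scalars_module counit_linear counit_ideal]
  by (simp add: quotient_hopf_def Let_def)

lemma counit_quotient_hopf_linear: "counit Q \<in> linear_maps K Q (scalar_module K)"
  using common_value_linear[OF module_axioms hopf_ideal_submodule scalars_module counit_linear counit_ideal]
  unfolding linear_maps_quotient_hopf(2) by (simp add: quotient_hopf_def Let_def)

lemma projection_antipode_linear: "(\<lambda>x. \<pi> (antipode A x)) \<in> linear_maps K A Q"
  by (rule linear_maps_comp[OF projection_linear antipode_linear])

lemma projection_antipode_ideal: "x \<in> I \<Longrightarrow> \<pi> (antipode A x) = \<zero>\<^bsub>Q\<^esub>"
  using hopf_ideal unfolding hopf_ideal_def by (intro projection_eq_zero) auto

lemma antipode_quotient_hopf: "x \<in> carrier A \<Longrightarrow> antipode Q (\<pi> x) = \<pi> (antipode A x)"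
  using induced_map[OF quotient_hopf_module projection_antipode_linear projection_antipode_ideal]
  by (simp add: quotient_hopf_def Let_def)

lemma antipode_quotient_hopf_linear: "antipode Q \<in> linear_maps K Q Q"
  using common_value_linear[OF module_axioms hopf_ideal_submodule quotient_hopf_module
      projection_antipode_linear projection_antipode_ideal]
  unfolding linear_maps_quotient_hopf(2) by (simp add: quotient_hopf_def Let_def)

lemma quotient_hopf_unital_algebra: "unital_algebra K Q"
proof (intro unital_algebra.intro unital_algebra_axioms.intro)
  show "field K" ..
  show "module K Q" by (rule quotient_hopf_module)
  show "ring Q" by (rule quotient_hopf_ring)
  fix r X Y assume r: "r \<in> carrier K" and "X \<in> carrier Q" "Y \<in> carrier Q"
  then obtain x y where "x \<in> carrier A" "X = \<pi> x" "y \<in> carrier A" "Y = \<pi> y"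
    by (elim quotient_hopf_cases)
  then show "(r \<odot>\<^bsub>Q\<^esub> X) \<otimes>\<^bsub>Q\<^esub> Y = r \<odot>\<^bsub>Q\<^esub> (X \<otimes>\<^bsub>Q\<^esub> Y)"
    and "X \<otimes>\<^bsub>Q\<^esub> (r \<odot>\<^bsub>Q\<^esub> Y) = r \<odot>\<^bsub>Q\<^esub> (X \<otimes>\<^bsub>Q\<^esub> Y)"
    using r by (simp_all add: linear_maps_smult[OF projection_linear, symmetric]
        ring_hom_mult[OF projection_ring_hom, symmetric] smult_mult_left smult_mult_right)
qed

text \<open>Changing variables along \<pi> turns both sides into Sweedler sums over \<open>A\<close>
  with integrand \<pi> x \<otimes> (\<pi> y \<otimes> \<pi> z), where coassociativity of
  \<open>A\<close> applies.\<close>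

lemma quotient_hopf_coassociative:
  assumes a: "a \<in> carrier A"
  shows "tensor_assoc K Q Q Q (tensor_map K (tensor_module K Q Q) Q (comult Q) id (comult Q (\<pi> a))) =
    tensor_map K Q (tensor_module K Q Q) id (comult Q) (comult Q (\<pi> a))"
proof -
  note A = module_axioms and Q = quotient_hopf_module and QQ = quotient_hopf_tensor_module
  let ?QQ = "tensor_module K Q Q"
  let ?T = "tensor_module K Q ?QQ"
  let ?pure = "\<lambda>x y z. pure_tensor K Q ?QQ x (pure_tensor K Q Q y z)"
  have T: "module K ?T"
    by (rule tensor_module_is_module[OF Q QQ])
  note \<Delta>a = comult_closed[OF a] and \<Delta>_lin = comult_quotient_hopf_linear
  note \<pi>\<Delta>a = linear_maps_closed[OF tensor_projection_linear \<Delta>a]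
  note id = linear_maps_id[of K Q, folded id_def]
  note assoc = tensor_assoc_bilinear[OF Q Q Q]
  note pure = pure_tensor_bilinear[OF Q QQ] and pure' = pure_tensor_bilinear[OF Q Q]
  let ?assoc = "\<lambda>X z. tensor_lift K ?T (\<lambda>x y. ?pure x y z) X"
  have "tensor_assoc K Q Q Q (tensor_map K ?QQ Q (comult Q) id (comult Q (\<pi> a))) =
      tensor_lift K ?T ?assoc (tensor_map K ?QQ Q (comult Q) id (tensor_map K Q Q \<pi> \<pi> (comult A a)))"
    unfolding tensor_assoc_def Let_def comult_quotient_hopf[OF a] ..
  also have "\<dots> = tensor_lift K ?T (\<lambda>X z. ?assoc (comult Q X) z) (tensor_map K Q Q \<pi> \<pi> (comult A a))"
    by (subst tensor_lift_tensor_map[OF Q Q QQ Q \<Delta>_lin id T assoc(2) \<pi>\<Delta>a]) simp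
  also have "\<dots> = tensor_lift K ?T (\<lambda>x z. ?assoc (comult Q (\<pi> x)) (\<pi> z)) (comult A a)"
    by (rule tensor_lift_projection[OF T
          bilinear_maps_comp[OF assoc(2) linear_maps_id \<Delta>_lin linear_maps_id] \<Delta>a])
  also have "\<dots> = tensor_lift K ?T (\<lambda>x z. tensor_lift K ?T
      (\<lambda>p q. ?pure (\<pi> p) (\<pi> q) (\<pi> z)) (comult A x)) (comult A a)"
    by (rule tensor_lift_cong[OF A A T bilinear_maps_comp[OF assoc(2) linear_maps_id
            linear_maps_comp[OF \<Delta>_lin projection_linear] projection_linear] _ \<Delta>a])
      (simp add: comult_quotient_hopf tensor_lift_projection[OF T assoc(1)] projection_closed
        comult_closed)
  also have "\<dots> = tensor_lift K ?T (\<lambda>x y. tensor_lift K ?T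
      (\<lambda>p q. ?pure (\<pi> x) (\<pi> p) (\<pi> q)) (comult A y)) (comult A a)"
  proof (rule lift_coassociative[OF T a, where \<Phi> = "\<lambda>x y z. ?pure (\<pi> x) (\<pi> y) (\<pi> z)"])
    show "(\<lambda>y z. ?pure (\<pi> x) (\<pi> y) (\<pi> z)) \<in> bilinear_maps K A A ?T" if "x \<in> carrier A" for x
      by (rule bilinear_maps_comp[OF pure' bilinear_mapsD(1)[OF pure projection_closed[OF that]]
            projection_linear projection_linear])
    show "(\<lambda>x. ?pure (\<pi> x) (\<pi> y) (\<pi> z)) \<in> linear_maps K A ?T"
      if "y \<in> carrier A" "z \<in> carrier A" for y z
      by (rule linear_maps_comp[OF bilinear_mapsD(2)[OF pure bilinear_maps_closed[OF pure'
                projection_closed[OF that(1)] projection_closed[OF that(2)]]] projection_linear])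
  qed
  \<comment> \<open>From here on the rewriting is undone: the inner sum is folded back into the
    comultiplication of the quotient.\<close>
  also have "\<dots> = tensor_lift K ?T (\<lambda>x y. pure_tensor K Q ?QQ (\<pi> x) (comult Q (\<pi> y))) (comult A a)"
  proof (rule tensor_lift_cong[OF A A T bilinear_maps_comp[OF pure linear_maps_id projection_linear
            linear_maps_comp[OF \<Delta>_lin projection_linear]] _ \<Delta>a, symmetric])
    fix x y assume x: "x \<in> carrier A" and y: "y \<in> carrier A"
    show "pure_tensor K Q ?QQ (\<pi> x) (comult Q (\<pi> y)) =
        tensor_lift K ?T (\<lambda>p q. ?pure (\<pi> x) (\<pi> p) (\<pi> q)) (comult A y)"
      unfolding comult_quotient_hopf[OF y] tensor_map_def
      by (rule linear_map_tensor_lift[OF A A QQ T bilinear_maps_comp[OF pure' linear_maps_id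
              projection_linear projection_linear] bilinear_mapsD(1)[OF pure projection_closed[OF x]]
            comult_closed[OF y]])
  qed
  also have "\<dots> = tensor_lift K ?T (\<lambda>X Y. pure_tensor K Q ?QQ X (comult Q Y))
      (tensor_map K Q Q \<pi> \<pi> (comult A a))"
    by (rule tensor_lift_projection[OF T
          bilinear_maps_comp[OF pure linear_maps_id linear_maps_id \<Delta>_lin] \<Delta>a, symmetric])
  also have "\<dots> = tensor_map K Q ?QQ id (comult Q) (comult Q (\<pi> a))"
    unfolding tensor_map_def[of K Q ?QQ id] comult_quotient_hopf[OF a] by simp
  finally show ?thesis .
qed

text \<open>Common pattern of both counit laws and both antipode laws: if \<beta> on projections is
  the projection of \<gamma>, the Sweedler sum in the quotient is the projection of the one in
  \<open>A\<close>, where the law is known.\<close>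

lemma quotient_hopf_lift:
  assumes "\<beta> \<in> bilinear_maps K Q Q Q" "\<gamma> \<in> bilinear_maps K A A A"
    and "\<And>x y. x \<in> carrier A \<Longrightarrow> y \<in> carrier A \<Longrightarrow> \<beta> (\<pi> x) (\<pi> y) = \<pi> (\<gamma> x y)"
    and a: "a \<in> carrier A"
  shows "tensor_lift K Q \<beta> (comult Q (\<pi> a)) = \<pi> (tensor_lift K A \<gamma> (comult A a))"
proof -
  note A = module_axioms and Q = quotient_hopf_module and \<Delta>a = comult_closed[OF a]
  have "tensor_lift K Q \<beta> (comult Q (\<pi> a)) = tensor_lift K Q (\<lambda>x y. \<beta> (\<pi> x) (\<pi> y)) (comult A a)"
    unfolding comult_quotient_hopf[OF a] by (rule tensor_lift_projection[OF Q assms(1) \<Delta>a])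
  also have "\<dots> = tensor_lift K Q (\<lambda>x y. \<pi> (\<gamma> x y)) (comult A a)"
    by (rule tensor_lift_cong[OF A A Q bilinear_maps_comp[OF assms(1) linear_maps_id projection_linear
            projection_linear] assms(3) \<Delta>a])
  also have "\<dots> = \<pi> (tensor_lift K A \<gamma> (comult A a))"
    by (rule linear_map_tensor_lift[OF A A A Q assms(2) projection_linear \<Delta>a, symmetric])
  finally show ?thesis .
qed

theorem quotient_hopf_is_hopf_algebra: "hopf_algebra K Q"
proof -
  interpret Q: unital_algebra K Q by (rule quotient_hopf_unital_algebra)
  \<comment> \<open>Oriented so that an operation of the quotient on projections is rewritten to the
    projection of an operation in \<open>A\<close>.\<close>
  note smult = linear_maps_smult[OF projection_linear, symmetric]
    and mult = ring_hom_mult[OF projection_ring_hom, symmetric]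
    and one = ring_hom_one[OF projection_ring_hom, symmetric]
    and add = linear_maps_add[OF projection_linear, symmetric]
  note induced = counit_quotient_hopf antipode_quotient_hopf comult_quotient_hopf
  note lin = linear_maps_id Q.mult_left_linear Q.mult_right_linear Q.scalar_linear Q.smult_linear
    linear_maps_comp[OF counit_quotient_hopf_linear] linear_maps_comp[OF antipode_quotient_hopf_linear]
    linear_maps_closed[OF antipode_quotient_hopf_linear]
  have counit_Q_closed: "counit Q x \<in> carrier K" if "x \<in> carrier Q" for x
    using linear_maps_closed[OF counit_quotient_hopf_linear that] by (simp add: scalar_module_def)
  have bialgebra: "bialgebra K Q"
  proof (intro bialgebra.intro bialgebra_axioms.intro)
    show "unital_algebra K Q" ..
    show "comult Q \<in> linear_maps K Q (tensor_module K Q Q)" "counit Q \<in> linear_maps K Q (scalar_module K)"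
      by (fact comult_quotient_hopf_linear counit_quotient_hopf_linear)+
    show "counit Q \<in> ring_hom Q K"
    proof (rule ring_hom_memI)
      fix X Y assume "X \<in> carrier Q" "Y \<in> carrier Q"
      then obtain x y where "x \<in> carrier A" "X = \<pi> x" "y \<in> carrier A" "Y = \<pi> y"
        by (elim quotient_hopf_cases)
      then show "counit Q (X \<otimes>\<^bsub>Q\<^esub> Y) = counit Q X \<otimes>\<^bsub>K\<^esub> counit Q Y"
        and "counit Q (X \<oplus>\<^bsub>Q\<^esub> Y) = counit Q X \<oplus>\<^bsub>K\<^esub> counit Q Y"
        by (simp_all add: mult add induced ring_hom_mult[OF counit_hom] ring_hom_add[OF counit_hom])
    qed (simp_all add: counit_Q_closed one induced ring_hom_one[OF counit_hom])
    show "comult Q \<in> ring_hom Q (tensor_algebra K Q Q)"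
    proof (rule ring_hom_memI)
      fix X assume "X \<in> carrier Q"
      then show "comult Q X \<in> carrier (tensor_algebra K Q Q)"
        using linear_maps_closed[OF comult_quotient_hopf_linear] by (simp add: tensor_algebra_simps(1))
      fix Y assume "Y \<in> carrier Q"
      with \<open>X \<in> carrier Q\<close> show "comult Q (X \<oplus>\<^bsub>Q\<^esub> Y) = comult Q X \<oplus>\<^bsub>tensor_algebra K Q Q\<^esub> comult Q Y"
        using linear_maps_add[OF comult_quotient_hopf_linear] by (simp add: tensor_algebra_simps(2))
      obtain x y where "x \<in> carrier A" "X = \<pi> x" "y \<in> carrier A" "Y = \<pi> y"
        using \<open>X \<in> carrier Q\<close> \<open>Y \<in> carrier Q\<close> by (elim quotient_hopf_cases)
      \<comment> \<open>Both \<Delta> and \<pi> \<otimes> \<pi> are multiplicative, the latter by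
        \<open>tensor_map_mult\<close>.\<close>
      then show "comult Q (X \<otimes>\<^bsub>Q\<^esub> Y) = comult Q X \<otimes>\<^bsub>tensor_algebra K Q Q\<^esub> comult Q Y"
        by (simp add: mult induced ring_hom_mult[OF comult_hom] comult_closed
            tensor_map_mult[OF unital_algebra_axioms unital_algebra_axioms
              quotient_hopf_unital_algebra quotient_hopf_unital_algebra projection_ring_hom
              projection_linear projection_ring_hom projection_linear])
    next
      show "comult Q \<one>\<^bsub>Q\<^esub> = \<one>\<^bsub>tensor_algebra K Q Q\<^esub>"
        using ring_hom_one[OF comult_hom]
        by (simp add: one induced tensor_algebra_simps(3) tensor_projection_pure)
    qed
    fix X assume "X \<in> carrier Q"
    then obtain x where x: "x \<in> carrier A" "X = \<pi> x"
      by (rule quotient_hopf_cases)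
    show "tensor_assoc K Q Q Q (tensor_map K (tensor_module K Q Q) Q (comult Q) id (comult Q X)) =
        tensor_map K Q (tensor_module K Q Q) id (comult Q) (comult Q X)"
      unfolding x(2) by (rule quotient_hopf_coassociative[OF x(1)])
    have "tensor_lift K Q (\<lambda>y z. counit Q y \<odot>\<^bsub>Q\<^esub> z) (comult Q (\<pi> x)) =
        \<pi> (tensor_lift K A (\<lambda>y z. counit A y \<odot>\<^bsub>A\<^esub> z) (comult A x))"
      using x(1)
      by (intro quotient_hopf_lift bilinear_mapsI lin counit_Q_closed A_linear_intros)
        (simp_all add: induced smult counit_closed)
    then show "tensor_lift K Q (\<lambda>y z. counit Q y \<odot>\<^bsub>Q\<^esub> z) (comult Q X) = X"
      by (simp add: x counit_left)
    have "tensor_lift K Q (\<lambda>y z. counit Q z \<odot>\<^bsub>Q\<^esub> y) (comult Q (\<pi> x)) =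
        \<pi> (tensor_lift K A (\<lambda>y z. counit A z \<odot>\<^bsub>A\<^esub> y) (comult A x))"
      using x(1)
      by (intro quotient_hopf_lift bilinear_mapsI lin counit_Q_closed A_linear_intros)
        (simp_all add: induced smult counit_closed)
    then show "tensor_lift K Q (\<lambda>y z. counit Q z \<odot>\<^bsub>Q\<^esub> y) (comult Q X) = X"
      by (simp add: x counit_right)
  qed
  show ?thesis
  proof (intro hopf_algebra.intro hopf_algebra_axioms.intro)
    show "bialgebra K Q" by (fact bialgebra)
    show "antipode Q \<in> linear_maps K Q Q" by (fact antipode_quotient_hopf_linear)
    fix X assume "X \<in> carrier Q"
    then obtain x where x: "x \<in> carrier A" "X = \<pi> x"
      by (rule quotient_hopf_cases)
    have "tensor_lift K Q (\<lambda>y z. antipode Q y \<otimes>\<^bsub>Q\<^esub> z) (comult Q (\<pi> x)) =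
        \<pi> (tensor_lift K A (\<lambda>y z. antipode A y \<otimes>\<^bsub>A\<^esub> z) (comult A x))"
      using x(1)
      by (intro quotient_hopf_lift bilinear_mapsI lin A_linear_intros)
        (simp_all add: induced mult antipode_closed)
    then show "tensor_lift K Q (\<lambda>y z. antipode Q y \<otimes>\<^bsub>Q\<^esub> z) (comult Q X) = counit Q X \<odot>\<^bsub>Q\<^esub> \<one>\<^bsub>Q\<^esub>"
      by (simp add: x antipode_left induced one smult counit_closed)
    have "tensor_lift K Q (\<lambda>y z. y \<otimes>\<^bsub>Q\<^esub> antipode Q z) (comult Q (\<pi> x)) =
        \<pi> (tensor_lift K A (\<lambda>y z. y \<otimes>\<^bsub>A\<^esub> antipode A z) (comult A x))"
      using x(1)
      by (intro quotient_hopf_lift bilinear_mapsI lin A_linear_intros)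
        (simp_all add: induced mult antipode_closed)
    then show "tensor_lift K Q (\<lambda>y z. y \<otimes>\<^bsub>Q\<^esub> antipode Q z) (comult Q X) = counit Q X \<odot>\<^bsub>Q\<^esub> \<one>\<^bsub>Q\<^esub>"
      by (simp add: x antipode_right induced one smult counit_closed)
  qed
qed

theorem projection_hopf_hom: "\<pi> \<in> hopf_homs K A Q"
  unfolding hopf_homs_def
  by (simp add: projection_ring_hom projection_linear comult_quotient_hopf counit_quotient_hopf
      antipode_quotient_hopf)

text \<open>Since \<pi> is onto, each law for the induced map reduces to the same law for
  \<open>h\<close> on representatives, and the values on projections determine the map.\<close>

theorem quotient_hopf_universal:
  assumes C: "hopf_algebra K C" and h: "h \<in> hopf_homs K A C" and kernel: "\<And>x. x \<in> I \<Longrightarrow> h x = \<zero>\<^bsub>C\<^esub>"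
  shows "\<exists>!u. u \<in> hopf_homs K Q C \<and> u \<in> extensional (carrier Q) \<and> (\<forall>a \<in> carrier A. u (\<pi> a) = h a)"
proof
  interpret C: hopf_algebra K C by fact
  note A = module_axioms and Q = quotient_hopf_module
  have h_ring: "h \<in> ring_hom A C" and h_lin: "h \<in> linear_maps K A C"
    and h_comult: "\<And>x. x \<in> carrier A \<Longrightarrow> comult C (h x) = tensor_map K C C h h (comult A x)"
    and h_counit: "\<And>x. x \<in> carrier A \<Longrightarrow> counit C (h x) = counit A x"
    and h_antipode: "\<And>x. x \<in> carrier A \<Longrightarrow> antipode C (h x) = h (antipode A x)"
    using h unfolding hopf_homs_def by auto
  \<comment> \<open>The value of \<open>common_value\<close> off the carrier is unspecified; the
    restriction selects the extensional representative that uniqueness requires.\<close>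
  define u where "u = restrict (common_value h) (carrier Q)"
  have u: "u (\<pi> x) = h x" if "x \<in> carrier A" for x
    using that unfolding u_def by (simp add: projection_closed induced_map[OF C.module_axioms h_lin kernel])
  have u_lin: "u \<in> linear_maps K Q C"
  proof (rule linear_maps_cong[OF _ Q])
    show "common_value h \<in> linear_maps K Q C"
      unfolding linear_maps_quotient_hopf(2)
      by (rule common_value_linear[OF A hopf_ideal_submodule C.module_axioms h_lin kernel])
  qed (simp add: u_def)
  have "u \<in> hopf_homs K Q C"
    unfolding hopf_homs_def
  proof (intro CollectI conjI ballI)
    show "u \<in> linear_maps K Q C" by (fact u_lin)
    show "u \<in> ring_hom Q C"
    proof (rule ring_hom_memI)
      fix X assume X: "X \<in> carrier Q"
      show "u X \<in> carrier C"
        by (rule linear_maps_closed[OF u_lin X])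
      fix Y assume Y: "Y \<in> carrier Q"
      show "u (X \<oplus>\<^bsub>Q\<^esub> Y) = u X \<oplus>\<^bsub>C\<^esub> u Y"
        by (rule linear_maps_add[OF u_lin X Y])
      obtain x y where "x \<in> carrier A" "X = \<pi> x" "y \<in> carrier A" "Y = \<pi> y"
        using X Y by (elim quotient_hopf_cases)
      then show "u (X \<otimes>\<^bsub>Q\<^esub> Y) = u X \<otimes>\<^bsub>C\<^esub> u Y"
        by (simp add: u ring_hom_mult[OF projection_ring_hom, symmetric] ring_hom_mult[OF h_ring])
    next
      show "u \<one>\<^bsub>Q\<^esub> = \<one>\<^bsub>C\<^esub>"
        by (simp add: u ring_hom_one[OF projection_ring_hom, symmetric] ring_hom_one[OF h_ring])
    qed
    fix X assume "X \<in> carrier Q"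
    then obtain x where x: "x \<in> carrier A" "X = \<pi> x"
      by (rule quotient_hopf_cases)
    show "counit C (u X) = counit Q X" "antipode C (u X) = u (antipode Q X)"
      by (simp_all add: x u h_counit h_antipode counit_quotient_hopf antipode_quotient_hopf
          antipode_closed)
    note u_bil = tensor_map_bilinear[OF Q Q C.module_axioms C.module_axioms u_lin u_lin]
    \<comment> \<open>Compatibility with \<Delta> rests on the composite of u \<otimes> u with \<pi>
      \<otimes> \<pi> being h \<otimes> h.\<close>
    have "tensor_map K C C u u (comult Q (\<pi> x)) =
        tensor_lift K (tensor_module K C C) (\<lambda>x y. pure_tensor K C C (u (\<pi> x)) (u (\<pi> y))) (comult A x)"
      unfolding comult_quotient_hopf[OF x(1)] tensor_map_def[of K C C]
      by (rule tensor_lift_projection[OF C.AA_module u_bil comult_closed[OF x(1)]])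
    also have "\<dots> = tensor_map K C C h h (comult A x)"
      unfolding tensor_map_def
      by (rule tensor_lift_cong[OF A A C.AA_module bilinear_maps_comp[OF u_bil linear_maps_id
              projection_linear projection_linear] _ comult_closed[OF x(1)]])
        (simp add: u)
    finally show "comult C (u X) = tensor_map K C C u u (comult Q X)"
      by (simp add: x u h_comult)
  qed
  then show "u \<in> hopf_homs K Q C \<and> u \<in> extensional (carrier Q) \<and> (\<forall>a \<in> carrier A. u (\<pi> a) = h a)"
    by (simp add: u) (simp add: u_def)
  fix v assume v: "v \<in> hopf_homs K Q C \<and> v \<in> extensional (carrier Q) \<and> (\<forall>a \<in> carrier A. v (\<pi> a) = h a)"
  show "v = u"
  proof (rule extensionalityI)
    show "v \<in> extensional (carrier Q)" "u \<in> extensional (carrier Q)"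
      using v by (simp_all add: u_def)
    fix X assume "X \<in> carrier Q"
    then show "v X = u X"
      by (rule quotient_hopf_cases) (use v u in simp)
  qed
qed

end

end

section \<open>The Hopf ideal generated by the differences\<close>

lemma submodule_set_add:
  assumes "module K M" "submodule U K M" "submodule V K M"
  shows "submodule (U <+>\<^bsub>M\<^esub> V) K M"
proof -
  interpret M: module K M by fact
  note U = M.submoduleE[OF assms(2)] and V = M.submoduleE[OF assms(3)]
  interpret U: additive_subgroup U M
    using submodule.axioms(1)[OF assms(2)] by (rule additive_subgroup.intro)
  interpret V: additive_subgroup V M
    using submodule.axioms(1)[OF assms(3)] by (rule additive_subgroup.intro)
  interpret UV: additive_subgroup "U <+>\<^bsub>M\<^esub> V" M
    by (rule M.M.add_additive_subgroups) unfold_locales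
  show ?thesis
  proof (intro submodule.intro submodule_axioms.intro)
    show "subgroup (U <+>\<^bsub>M\<^esub> V) (add_monoid M)"
      by (rule UV.a_subgroup)
    fix r x assume r: "r \<in> carrier K" and "x \<in> U <+>\<^bsub>M\<^esub> V"
    then obtain u v where uv: "u \<in> U" "v \<in> V" "x = u \<oplus>\<^bsub>M\<^esub> v"
      unfolding set_add_def' by blast
    then have "r \<odot>\<^bsub>M\<^esub> x = r \<odot>\<^bsub>M\<^esub> u \<oplus>\<^bsub>M\<^esub> r \<odot>\<^bsub>M\<^esub> v"
      using r U(1) V(1) by (simp add: M.smult_r_distr subset_iff)
    moreover have "r \<odot>\<^bsub>M\<^esub> u \<in> U" "r \<odot>\<^bsub>M\<^esub> v \<in> V"
      using r uv U(4) V(4) by simp_all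
    ultimately show "r \<odot>\<^bsub>M\<^esub> x \<in> U <+>\<^bsub>M\<^esub> V"
      unfolding set_add_def' by blast
  qed
qed

text \<open>Ring ideals are stable under scalars because r x = (r 1) x.\<close>

lemma (in unital_algebra) ideal_submodule:
  assumes "ideal I A"
  shows "submodule I K A"
proof -
  interpret I: ideal I A by fact
  show ?thesis
  proof (intro submodule.intro submodule_axioms.intro)
    show "subgroup I (add_monoid A)"
      by (rule I.a_subgroup)
    fix r x assume r: "r \<in> carrier K" and x: "x \<in> I"
    have "r \<odot>\<^bsub>A\<^esub> x = (r \<odot>\<^bsub>A\<^esub> \<one>\<^bsub>A\<^esub>) \<otimes>\<^bsub>A\<^esub> x"
      using r I.a_Hcarr[OF x] by (simp add: smult_mult_left)
    then show "r \<odot>\<^bsub>A\<^esub> x \<in> I"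
      using r x I.I_l_closed by simp
  qed
qed

lemma (in unital_algebra) submodule_ideal:
  assumes "submodule I K A"
    and "\<And>a x. a \<in> carrier A \<Longrightarrow> x \<in> I \<Longrightarrow> a \<otimes>\<^bsub>A\<^esub> x \<in> I \<and> x \<otimes>\<^bsub>A\<^esub> a \<in> I"
  shows "ideal I A"
  using assms submodule.axioms(1)[OF assms(1)] by (intro idealI A.ring_axioms) auto

section \<open>Spans of pure tensors that absorb products\<close>

context
  fixes K :: "('k, 'm) ring_scheme"
    and A :: "('k, 'a, 'p) module_scheme" and B :: "('k, 'b, 'q) module_scheme" and U V
  assumes A: "unital_algebra K A" and B: "unital_algebra K B"
    and U: "U \<subseteq> carrier A" and V: "V \<subseteq> carrier B"
begin

interpretation A: unital_algebra K A by (fact A)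
interpretation B: unital_algebra K B by (fact B)

lemma tensor_image_submodule:
  "submodule (tensor_image K A B U V) K (tensor_module K A B)"
  unfolding tensor_image_def using U V
  by (intro span_submodule alg_tensor_module[OF A B])
    (auto intro: pure_tensor_closed[OF A.module_axioms B.module_axioms])

lemma pure_tensor_in_tensor_image:
  "u \<in> U \<Longrightarrow> v \<in> V \<Longrightarrow> pure_tensor K A B u v \<in> tensor_image K A B U V"
  unfolding tensor_image_def by (rule subsetD[OF span_superset]) blast

text \<open>Absorption in the two factors passes to the span. A general pair \<open>U\<close>,
  \<open>V\<close> covers both summands of J at once.\<close>

lemma tensor_image_mult_closed:
  assumes "\<And>a u. a \<in> carrier A \<Longrightarrow> u \<in> U \<Longrightarrow> a \<otimes>\<^bsub>A\<^esub> u \<in> U \<and> u \<otimes>\<^bsub>A\<^esub> a \<in> U"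
    and "\<And>b v. b \<in> carrier B \<Longrightarrow> v \<in> V \<Longrightarrow> b \<otimes>\<^bsub>B\<^esub> v \<in> V \<and> v \<otimes>\<^bsub>B\<^esub> b \<in> V"
    and X: "X \<in> carrier (tensor_module K A B)" and Y: "Y \<in> tensor_image K A B U V"
  shows "X \<otimes>\<^bsub>tensor_algebra K A B\<^esub> Y \<in> tensor_image K A B U V"
    and "Y \<otimes>\<^bsub>tensor_algebra K A B\<^esub> X \<in> tensor_image K A B U V"
proof -
  let ?T = "tensor_module K A B" and ?TA = "tensor_algebra K A B" and ?H = "tensor_image K A B U V"
  note T = alg_tensor_module[OF A B] and bil = tensor_mult_bilinear[OF A B]
  interpret T: module K ?T by (rule T)
  note H = tensor_image_submodule
  have pure: "pure_tensor K A B u v \<in> carrier ?T" if "u \<in> U" "v \<in> V" for u v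
    using that U V by (intro pure_tensor_closed[OF A.module_axioms B.module_axioms]) auto
  \<comment> \<open>First one spanning pure tensor is held fixed, and \<open>X\<close> is built up
    from pure tensors.\<close>
  have "X \<otimes>\<^bsub>?TA\<^esub> pure_tensor K A B u v \<in> ?H \<and> pure_tensor K A B u v \<otimes>\<^bsub>?TA\<^esub> X \<in> ?H"
    if uv: "u \<in> U" "v \<in> V" for u v
    using X
  proof (induction rule: tensor_induct[OF A.module_axioms B.module_axioms, consumes 1, case_names pure add])
    case (pure a b)
    have "u \<in> carrier A" "v \<in> carrier B"
      using uv U V by auto
    with pure uv assms(1,2) show ?case
      by (simp add: tensor_mult_pure[OF A B] pure_tensor_in_tensor_image)
  next
    case (add X Y)
    then show ?case
      using T.submoduleE(5)[OF H] linear_maps_add[OF bilinear_mapsD(1)[OF bil pure[OF uv]]]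
        linear_maps_add[OF bilinear_mapsD(2)[OF bil pure[OF uv]]] by simp
  qed
  \<comment> \<open>The tensors whose product with \<open>X\<close> stays in the span form a
    submodule, a preimage under a linear map; it contains the generators and hence the span.\<close>
  then have "?H \<subseteq> {Y \<in> carrier ?T. X \<otimes>\<^bsub>?TA\<^esub> Y \<in> ?H}" "?H \<subseteq> {Y \<in> carrier ?T. Y \<otimes>\<^bsub>?TA\<^esub> X \<in> ?H}"
    using pure
    by (subst (1) tensor_image_def,
        intro span_minimal linear_maps_vimage[OF T T _ H] bilinear_mapsD[OF bil X], blast)+
  then show "X \<otimes>\<^bsub>?TA\<^esub> Y \<in> ?H" "Y \<otimes>\<^bsub>?TA\<^esub> X \<in> ?H"
    using Y by blast+
qed

end

text \<open>Induction over a generated ideal, in the form used for kernels, \<Delta>, \<epsilon> and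
  the antipode.\<close>

lemma genideal_subset:
  assumes "ring R" "S \<subseteq> carrier R" "ideal {x \<in> carrier R. P x} R" "\<And>x. x \<in> S \<Longrightarrow> P x"
  shows "Idl\<^bsub>R\<^esub> S \<subseteq> {x \<in> carrier R. P x}"
  using assms by (intro ring.genideal_minimal) auto

section \<open>The ideal generated by the differences of f and g\<close>

context
  fixes K :: "('k, 'm) ring_scheme"
    and A :: "('k, 'a, 'p) hopf_scheme" and B :: "('k, 'b, 'q) hopf_scheme" and f g
  assumes A: "hopf_algebra K A" and B: "hopf_algebra K B"
    and f: "f \<in> hopf_homs K B A" and g: "g \<in> hopf_homs K B A"
begin

interpretation A: hopf_algebra K A by (fact A)
interpretation B: hopf_algebra K B by (fact B)

abbreviation (input) differences where "differences \<equiv> {f b \<ominus>\<^bsub>A\<^esub> g b | b. b \<in> carrier B}"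

lemma hopf_hom_linear: "f \<in> linear_maps K B A" "g \<in> linear_maps K B A"
  using f g unfolding hopf_homs_def by simp_all

lemmas hopf_hom_closed = hopf_hom_linear[THEN linear_maps_closed]

lemma differences_closed: "differences \<subseteq> carrier A"
  using hopf_hom_closed by auto

lemma differences_ideal: "ideal (Idl\<^bsub>A\<^esub> differences) A"
  by (rule A.A.genideal_ideal[OF differences_closed])

lemma differences_in_ideal: "b \<in> carrier B \<Longrightarrow> f b \<ominus>\<^bsub>A\<^esub> g b \<in> Idl\<^bsub>A\<^esub> differences"
  using A.A.genideal_self[OF differences_closed] by blast

text \<open>The kernel of \<open>h\<close> is an ideal containing the generators. This supplies the
  kernel condition in \<open>quotient_hopf_universal\<close>.\<close>

lemma kernel_contains_differences:
  assumes C: "unital_algebra K C" and h: "h \<in> ring_hom A C" "h \<in> linear_maps K A C"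
    and eq: "\<And>b. b \<in> carrier B \<Longrightarrow> h (f b) = h (g b)" and x: "x \<in> Idl\<^bsub>A\<^esub> differences"
  shows "h x = \<zero>\<^bsub>C\<^esub>"
proof -
  interpret C: unital_algebra K C by fact
  have "Idl\<^bsub>A\<^esub> differences \<subseteq> {x \<in> carrier A. h x = \<zero>\<^bsub>C\<^esub>}"
  proof (rule genideal_subset[OF A.A.ring_axioms differences_closed])
    show "ideal {x \<in> carrier A. h x = \<zero>\<^bsub>C\<^esub>} A"
      by (rule A.submodule_ideal[OF linear_maps_kernel[OF A.module_axioms C.module_axioms h(2)]])
        (simp add: ring_hom_mult[OF h(1)] linear_maps_closed[OF h(2)])
    fix x assume "x \<in> differences"
    then obtain b where "b \<in> carrier B" "x = f b \<ominus>\<^bsub>A\<^esub> g b"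
      by blast
    then show "h x = \<zero>\<^bsub>C\<^esub>"
      using linear_maps_minus[OF A.module_axioms C.module_axioms h(2)] eq
        linear_maps_closed[OF h(2)] hopf_hom_closed by (simp add: C.M.minus_eq C.M.r_neg)
  qed
  with x show ?thesis
    by blast
qed

lemma comult_differences:
  assumes x: "x \<in> Idl\<^bsub>A\<^esub> differences"
  defines "I \<equiv> Idl\<^bsub>A\<^esub> differences"
  shows "comult A x \<in> tensor_image K A A I (carrier A) <+>\<^bsub>tensor_module K A A\<^esub>
    tensor_image K A A (carrier A) I"
proof -
  let ?AA = "tensor_module K A A" and ?TA = "tensor_algebra K A A"
  let ?U = "tensor_image K A A I (carrier A)" and ?V = "tensor_image K A A (carrier A) I"
  let ?J = "?U <+>\<^bsub>?AA\<^esub> ?V"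
  note alg = A.unital_algebra_axioms and A' = A.module_axioms
  interpret AA: module K ?AA by (rule A.AA_module)
  interpret I: ideal I A unfolding I_def by (rule differences_ideal)
  note submodules = tensor_image_submodule[OF alg alg I.a_subset order_refl]
    tensor_image_submodule[OF alg alg order_refl I.a_subset]
  have J: "submodule ?J K ?AA"
    by (rule submodule_set_add[OF A.AA_module submodules])
  note JE = AA.submoduleE[OF J]
  \<comment> \<open>J is a two-sided ideal of the tensor algebra; this makes its preimage under
    \<Delta> an ideal of \<open>A\<close>.\<close>
  have mult_closed: "X \<otimes>\<^bsub>?TA\<^esub> Y \<in> ?J \<and> Y \<otimes>\<^bsub>?TA\<^esub> X \<in> ?J" if X: "X \<in> carrier ?AA" and "Y \<in> ?J" for X Y
  proof -
    obtain u v where uv: "u \<in> ?U" "v \<in> ?V" "Y = u \<oplus>\<^bsub>?AA\<^esub> v"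
      using \<open>Y \<in> ?J\<close> unfolding set_add_def' by blast
    have closed: "u \<in> carrier ?AA" "v \<in> carrier ?AA"
      using uv AA.submoduleE(1)[OF submodules(1)] AA.submoduleE(1)[OF submodules(2)] by blast+
    note bil = tensor_mult_bilinear[OF alg alg]
    have "X \<otimes>\<^bsub>?TA\<^esub> Y = X \<otimes>\<^bsub>?TA\<^esub> u \<oplus>\<^bsub>?AA\<^esub> X \<otimes>\<^bsub>?TA\<^esub> v"
      "Y \<otimes>\<^bsub>?TA\<^esub> X = u \<otimes>\<^bsub>?TA\<^esub> X \<oplus>\<^bsub>?AA\<^esub> v \<otimes>\<^bsub>?TA\<^esub> X"
      unfolding uv(3) by (rule linear_maps_add[OF bilinear_mapsD(1)[OF bil X] closed]
          linear_maps_add[OF bilinear_mapsD(2)[OF bil X] closed])+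
    moreover have "X \<otimes>\<^bsub>?TA\<^esub> u \<in> ?U" "u \<otimes>\<^bsub>?TA\<^esub> X \<in> ?U"
      by (rule tensor_image_mult_closed[OF alg alg I.a_subset order_refl _ _ X uv(1)];
          simp add: I.I_l_closed I.I_r_closed)+
    moreover have "X \<otimes>\<^bsub>?TA\<^esub> v \<in> ?V" "v \<otimes>\<^bsub>?TA\<^esub> X \<in> ?V"
      by (rule tensor_image_mult_closed[OF alg alg order_refl I.a_subset _ _ X uv(2)];
          simp add: I.I_l_closed I.I_r_closed)+
    ultimately show ?thesis
      unfolding set_add_def' by blast
  qed
  \<comment> \<open>Claimed for every tensor over \<open>B\<close>, not only for values of
    \<open>comult B\<close>: the induction splits a tensor into pure summands, which need not be
    such values.\<close>
  have diff: "tensor_map K A A f f W \<ominus>\<^bsub>?AA\<^esub> tensor_map K A A g g W \<in> ?J"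
    if "W \<in> carrier (tensor_module K B B)" for W
  proof -
    note B' = B.module_axioms
    note lin = tensor_map_linear[OF B' B' A' A' hopf_hom_linear(1) hopf_hom_linear(1)]
      tensor_map_linear[OF B' B' A' A' hopf_hom_linear(2) hopf_hom_linear(2)]
    note map_pure = tensor_map_pure[OF B' B' A' A' hopf_hom_linear(1) hopf_hom_linear(1)]
      tensor_map_pure[OF B' B' A' A' hopf_hom_linear(2) hopf_hom_linear(2)]
    from that show ?thesis
    proof (induction rule: tensor_induct[OF B' B', consumes 1, case_names pure add])
      case (pure x y)
      note closed = hopf_hom_closed(1)[OF pure(1)] hopf_hom_closed(2)[OF pure(1)]
        hopf_hom_closed(1)[OF pure(2)] hopf_hom_closed(2)[OF pure(2)]
      note pure_closed = pure_tensor_closed[OF A' A']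
      have "pure_tensor K A A (f x) (f y) \<ominus>\<^bsub>?AA\<^esub> pure_tensor K A A (g x) (g y) =
          pure_tensor K A A (f x \<ominus>\<^bsub>A\<^esub> g x) (f y) \<oplus>\<^bsub>?AA\<^esub> pure_tensor K A A (g x) (f y \<ominus>\<^bsub>A\<^esub> g y)"
        using closed pure_closed
          linear_maps_minus[OF A' A.AA_module bilinear_mapsD(1)[OF pure_tensor_bilinear[OF A' A']]]
          linear_maps_minus[OF A' A.AA_module bilinear_mapsD(2)[OF pure_tensor_bilinear[OF A' A']]]
        by (simp add: AA.M.minus_eq AA.M.a_assoc AA.M.r_neg1)
      moreover have "pure_tensor K A A (f x \<ominus>\<^bsub>A\<^esub> g x) (f y) \<in> ?U"
        by (rule pure_tensor_in_tensor_image[OF alg alg I.a_subset order_refl])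
          (simp_all add: I_def differences_in_ideal pure closed)
      moreover have "pure_tensor K A A (g x) (f y \<ominus>\<^bsub>A\<^esub> g y) \<in> ?V"
        by (rule pure_tensor_in_tensor_image[OF alg alg order_refl I.a_subset])
          (simp_all add: I_def differences_in_ideal pure closed)
      ultimately show ?case
        unfolding map_pure[OF pure] set_add_def' by blast
    next
      case (add X Y)
      note closed = linear_maps_closed[OF lin(1)] linear_maps_closed[OF lin(2)]
      have "tensor_map K A A f f (X \<oplus>\<^bsub>tensor_module K B B\<^esub> Y) \<ominus>\<^bsub>?AA\<^esub>
          tensor_map K A A g g (X \<oplus>\<^bsub>tensor_module K B B\<^esub> Y) =
          (tensor_map K A A f f X \<ominus>\<^bsub>?AA\<^esub> tensor_map K A A g g X) \<oplus>\<^bsub>?AA\<^esub>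
          (tensor_map K A A f f Y \<ominus>\<^bsub>?AA\<^esub> tensor_map K A A g g Y)"
        using add(1,2) closed
        by (simp add: linear_maps_add[OF lin(1)] linear_maps_add[OF lin(2)] AA.M.minus_eq
            AA.M.minus_add AA.M.a_ac)
      then show ?case
        using JE(5)[OF add(3,4)] by simp
    qed
  qed
  have "I \<subseteq> {x \<in> carrier A. comult A x \<in> ?J}"
    unfolding I_def
  proof (rule genideal_subset[OF A.A.ring_axioms differences_closed], fold I_def)
    show "ideal {x \<in> carrier A. comult A x \<in> ?J} A"
      by (rule A.submodule_ideal[OF linear_maps_vimage[OF A' A.AA_module A.comult_linear J]])
        (simp add: ring_hom_mult[OF A.comult_hom] mult_closed A.comult_closed)
    fix x assume "x \<in> differences"
    then obtain b where b: "b \<in> carrier B" "x = f b \<ominus>\<^bsub>A\<^esub> g b"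
      by blast
    \<comment> \<open>Both maps commute with \<Delta>, so a generator is sent to a difference of the
      kind just treated.\<close>
    have "comult A x = tensor_map K A A f f (comult B b) \<ominus>\<^bsub>?AA\<^esub> tensor_map K A A g g (comult B b)"
      using b f g linear_maps_minus[OF A' A.AA_module A.comult_linear] hopf_hom_closed
      by (simp add: hopf_homs_def)
    then show "comult A x \<in> ?J"
      using diff[OF B.comult_closed[OF b(1)]] by simp
  qed
  with x show ?thesis
    unfolding I_def by blast
qed

lemma counit_differences:
  assumes "x \<in> Idl\<^bsub>A\<^esub> differences"
  shows "counit A x = \<zero>\<^bsub>K\<^esub>"
proof -
  have K: "module K (scalar_module K)"
    by (rule scalar_module_is_module) (rule module.axioms(1)[OF A.module_axioms])
  interpret K: module K "scalar_module K" by (rule K)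
  have "Idl\<^bsub>A\<^esub> differences \<subseteq> {x \<in> carrier A. counit A x = \<zero>\<^bsub>scalar_module K\<^esub>}"
  proof (rule genideal_subset[OF A.A.ring_axioms differences_closed])
    show "ideal {x \<in> carrier A. counit A x = \<zero>\<^bsub>scalar_module K\<^esub>} A"
      by (rule A.submodule_ideal[OF linear_maps_kernel[OF A.module_axioms K A.counit_linear]])
        (simp add: ring_hom_mult[OF A.counit_hom] A.counit_closed scalar_module_def)
    fix x assume "x \<in> differences"
    then obtain b where b: "b \<in> carrier B" "x = f b \<ominus>\<^bsub>A\<^esub> g b"
      by blast
    then have "counit A x = counit A (f b) \<ominus>\<^bsub>scalar_module K\<^esub> counit A (g b)"
      using linear_maps_minus[OF A.module_axioms K A.counit_linear] hopf_hom_closed by simp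
    \<comment> \<open>Both maps preserve the counit, so the two terms coincide.\<close>
    also have "\<dots> = counit B b \<ominus>\<^bsub>scalar_module K\<^esub> counit B b"
      using b f g by (simp add: hopf_homs_def)
    also have "\<dots> = \<zero>\<^bsub>scalar_module K\<^esub>"
      using linear_maps_closed[OF B.counit_linear b(1)] by (simp add: K.M.minus_eq K.M.r_neg)
    finally show "counit A x = \<zero>\<^bsub>scalar_module K\<^esub>" .
  qed
  with assms show ?thesis
    by (auto simp: scalar_module_def)
qed

text \<open>The preimage of the ideal under the antipode is again two-sided: reversal of products
  merely exchanges left and right absorption. A generator at b goes to the generator at S b, as f
  and g commute with the antipodes.\<close>

lemma antipode_differences:
  assumes "x \<in> Idl\<^bsub>A\<^esub> differences"
  shows "antipode A x \<in> Idl\<^bsub>A\<^esub> differences"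
proof -
  interpret I: ideal "Idl\<^bsub>A\<^esub> differences" A by (rule differences_ideal)
  have "Idl\<^bsub>A\<^esub> differences \<subseteq> {x \<in> carrier A. antipode A x \<in> Idl\<^bsub>A\<^esub> differences}"
  proof (rule genideal_subset[OF A.A.ring_axioms differences_closed])
    show "ideal {x \<in> carrier A. antipode A x \<in> Idl\<^bsub>A\<^esub> differences} A"
      by (rule A.submodule_ideal[OF linear_maps_vimage[OF A.module_axioms A.module_axioms
              A.antipode_linear A.ideal_submodule[OF differences_ideal]]])
        (simp add: A.antipode_mult A.antipode_closed I.I_l_closed I.I_r_closed)
    fix x assume "x \<in> differences"
    then obtain b where b: "b \<in> carrier B" "x = f b \<ominus>\<^bsub>A\<^esub> g b"
      by blast
    then have "antipode A x = f (antipode B b) \<ominus>\<^bsub>A\<^esub> g (antipode B b)"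
      using f g linear_maps_minus[OF A.module_axioms A.module_axioms A.antipode_linear] hopf_hom_closed
      by (simp add: hopf_homs_def)
    then show "antipode A x \<in> Idl\<^bsub>A\<^esub> differences"
      using differences_in_ideal[OF B.antipode_closed[OF b(1)]] by simp
  qed
  with assms show ?thesis
    by blast
qed

theorem differences_hopf_ideal: "hopf_ideal K A (Idl\<^bsub>A\<^esub> differences)"
  unfolding hopf_ideal_def coideal_def
  using differences_ideal A.ideal_submodule[OF differences_ideal] comult_differences
    counit_differences antipode_differences
  by blast

end

theorem mainTheorem4:
  fixes K :: "('k, 'm) ring_scheme"
    and A :: "('k, 'a) hopf" and B :: "('k, 'b) hopf"
    and f g :: "'b \<Rightarrow> 'a" and I :: "'a set"
  assumes "field K"
    and "hopf_algebra K A" and "hopf_algebra K B"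
    and "f \<in> hopf_homs K B A" and "g \<in> hopf_homs K B A"
    and "I = Idl\<^bsub>A\<^esub> {f b \<ominus>\<^bsub>A\<^esub> g b | b. b \<in> carrier B}"
  shows "hopf_ideal K A I \<and>
    hopf_coequalizer TYPE('c) K B A f g (quotient_hopf K A I) (\<lambda>a. I +>\<^bsub>A\<^esub> a)"
proof
  interpret A: hopf_algebra K A by fact
  note homs = assms(2-5)
  show I: "hopf_ideal K A I"
    unfolding assms(6) by (rule differences_hopf_ideal[OF homs])
  \<comment> \<open>The projection equalizes the pair because f b - g b is a generator.\<close>
  have "I +>\<^bsub>A\<^esub> f b = I +>\<^bsub>A\<^esub> g b" if "b \<in> carrier B" for b
    using A.projection_eq_iff[OF I hopf_hom_closed(1)[OF homs that] hopf_hom_closed(2)[OF homs that]]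
      differences_in_ideal[OF homs that] unfolding assms(6) by simp
  \<comment> \<open>Every test map that equalizes the pair factors, since its kernel contains the
    whole generated ideal.\<close>
  moreover have "h x = \<zero>\<^bsub>C\<^esub>"
    if "hopf_algebra K C" "h \<in> hopf_homs K A C" "\<forall>b \<in> carrier B. h (f b) = h (g b)" "x \<in> I"
    for C :: "('k, 'c) hopf" and h x
  proof -
    interpret C: hopf_algebra K C by fact
    show ?thesis
      using that(2-4) unfolding assms(6) hopf_homs_def
      by (intro kernel_contains_differences[OF homs C.unital_algebra_axioms]) auto
  qed
  ultimately show "hopf_coequalizer TYPE('c) K B A f g (quotient_hopf K A I) (\<lambda>a. I +>\<^bsub>A\<^esub> a)"
    unfolding hopf_coequalizer_def
    by (intro conjI allI impI ballI A.quotient_hopf_is_hopf_algebra[OF I]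
        A.projection_hopf_hom[OF I] A.quotient_hopf_universal[OF I]) blast+
qed

end
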